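(* Let $\kappa=1$ and $\Lambda^*=(\mu^*,\alpha^*,\lambda^* )=(1,-1,\pi/2)$ (so that $M(\Lambda^* )=\{1\}$), and let $(\overline w(t),\overline\lambda(t))$ be the bifurcation curve of nontrivial solutions of $\mathcal{F}(w,\mu^*,\alpha^*,\lambda)=0$ through $(0,\lambda^* )$. Then the functions $a_0$ and $a_2$ are given by $$a_0(s)=s+\tfrac12s^2\sin(s-1)+\frac{3\sin(s)}{2(\cos(1)-\sin(1))},$$ $$a_2(s)=s+\tfrac12s^2\sin(s-1)+\frac{\sinh(\sqrt3\,s)}{2(\sqrt3\cosh(\sqrt3)-\sinh(\sqrt3))},$$ respectively. This yields $$\ddot{\overline\lambda}(0)=\tfrac32+3a_0(1)+\tfrac12a_2(1)<0.$$ In particular, $\overline\lambda$ is not constant along the bifurcation curve, which therefore does not coincide with the curve of nontrivial solutions bifurcating from $(0,\Lambda^* )$ that is obtained by using $\mu$ instead of $\lambda$ as the bifurcation parameter (i.e. the curve of nontrivial solutions of $\mathcal{F}(w,\mu,\alpha^*,\lambda^* )=0$ through $(0,\mu^* )$).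
   Context: Fix $\kappa>0$ and $\beta\in(0,1)$. Let $\hat\Omega=\{(x,s):x\in\mathbb{R},\ s\in[0,1]\}$; the subscript $\kappa$ on a function space means $2\pi/\kappa$-periodic in $x$, and e means even in $x$. Set $X=X_1\times X_2=C^{2,\beta}_{\kappa,\mathrm{e}}(\mathbb{R})\times\{\hat\phi\in C^{2,\beta}_{\kappa,\mathrm{e}}(\overline{\hat\Omega}):\hat\phi|_{s=0}=\hat\phi|_{s=1}=0\}$, $Y=C^{1,\beta}_{\kappa,\mathrm{e}}(\mathbb{R})\times C^{\beta}_{\kappa,\mathrm{e}}(\overline{\hat\Omega})$, $\tilde X_2=\{\phi\in C^{2,\beta}_{\kappa,\mathrm{e}}(\overline{\hat\Omega}):\phi|_{s=0}=0\}$, $\mathcal{O}=\{w=(\eta,\hat\phi)\in X:\min\eta>-1\}$, and $\mathcal{U}=\{(\mu,\alpha,\lambda)\in\mathbb{R}^3:\mu\ne0,\ \alpha<0,\ 0<\lambda<\pi\}$. For $\Lambda=(\mu,\alpha,\lambda)\in\mathcal{U}$ let $\psi_0(s)=\psi_0(s,\Lambda)=\mu\cos(|\alpha|^{1/2}(s-1)+\lambda)$ and $Q(\Lambda)=\tfrac12\mu^2|\alpha|\sin^2(\lambda)$. The smooth map $\mathcal{F}=(\mathcal{F}_1,\mathcal{F}_2):\mathcal{O}\times\mathcal{U}\to Y$ is $$\mathcal{F}_1(w,\Lambda)=\left[\frac{(1+\eta_x^2)(\psi_{0s}+\hat\phi_s)^2}{2(1+\eta)^2}\right]_{s=1}+\eta-Q(\Lambda),$$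 $$\mathcal{F}_2(w,\Lambda)=\Big(\partial_x-\frac{s\eta_x}{1+\eta}\partial_s\Big)^2(\psi_0+\hat\phi)+\frac{\psi_{0ss}+\hat\phi_{ss}}{(1+\eta)^2}-\alpha(\psi_0+\hat\phi).$$ One has $\mathcal{F}(0,\Lambda)=0$ for all $\Lambda$; a solution of $\mathcal F(w,\Lambda)=0$ is nontrivial if $w\ne0$. The isomorphism $\mathcal{T}(\Lambda):\tilde X_2\to X$ is $$\mathcal{T}(\Lambda)\phi=\Big(-\frac{\phi|_{s=1}}{\psi_{0s}(1)},\ \phi-\frac{s\psi_{0s}}{\psi_{0s}(1)}\phi|_{s=1}\Big).$$ For $n\in\mathbb{N}_0$ let $\theta_n=\theta(n,\alpha)=\sqrt{\alpha+n^2\kappa^2}$ (equal to $i\sqrt{|\alpha|-n^2\kappa^2}$ if the radicand is negative), $\phi_n(x,s)=\cos(n\kappa x)\sinh(\theta_ns)/\theta_n$ (with $\sinh(\theta_ns)/\theta_n:=s$ if $\theta_n=0$), $l(n,\alpha)=\theta_n\coth(\theta_n)$ (equal to $1$ if $\theta_n=0$; defined when $\sinh(\theta_n)/\theta_n\ne0$), and $r(\Lambda)=\frac{1}{\mu^2|\alpha|\sin^2(\lambda)}+|\alpha|^{1/2}\cot(\lambda)$. $M(\Lambda)$ is the finite set of $n\in\mathbb{N}_0$ with $l(n,\alpha)=r(\Lambda)$; the functions $\mathcal{T}(\Lambda)\phi_n$, $n\in M(\Lambda)$, form a basis of $\ker D_w\mathcal{F}(0,\Lambda)$. Bifurcation curve: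 if $M(\Lambda^* )=\{n\}$ with $n\ge1$, $w^*=\mathcal{T}(\Lambda^* )\phi_n$ and $\cot(\lambda^* )\ne-(\mu^* )^2|\alpha^*|^{3/2}/2$, there is a smooth curve $t\mapsto(\overline w(t),\overline\lambda(t))\in\mathcal{O}\times(0,\pi)$, $|t|<\varepsilon$, of solutions of $\mathcal{F}(w,\mu^*,\alpha^*,\lambda)=0$, nontrivial for $t\neq0$, with $(\overline w(0),\overline\lambda(0))=(0,\lambda^* )$ and $\overline w(t)=tw^*+O(t^2)$; these are all nontrivial solutions near $(0,\lambda^* )$. Likewise (a known result of Ehrnström, Escher and Wahlén) there is a smooth curve $t\mapsto(\tilde w(t),\overline\mu(t))$ of nontrivial (for $t\ne0$) solutions of $\mathcal{F}(w,\mu,\alpha^*,\lambda^* )=0$ with $\tilde w(t)=tw^*+O(t^2)$ and $\overline\mu(0)=\mu^*$. The functions $a_0,a_2$: write (with $n=1$ here) $D_w^2\mathcal{F}_1(0,\Lambda^* )(w^* )^2=c_0+c_2\cos(2n\kappa x)$ and $D_w^2\mathcal{F}_2(0,\Lambda^* )(w^* )^2=b_0(s)+b_2(s)\cos(2n\kappa x)$; for $j=0,2$, $a_j$ is the solution on $[0,1]$ of $$a_j''-\theta_{jn}^2a_j=-b_j,\quad a_j(0)=0,\quad \psi_{0s}(1)a_j'(1)-\Big(\psi_{0ss}(1)+\frac1{\psi_{0s}(1)}\Big)a_j(1)=-c_j,$$ with $\psi_0$ and $\theta_{jn}$ taken at $\Lambda^*$. *)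

theory Defs
  imports "HOL-Analysis.Analysis" "HOL-Library.Function_Algebras"
begin

instantiation "fun" :: (type, real_vector) real_vector
begin

definition scaleR_fun :: "real \<Rightarrow> ('a \<Rightarrow> 'b) \<Rightarrow> 'a \<Rightarrow> 'b" where
  "scaleR_fun c f = (\<lambda>x. c *\<^sub>R f x)"

instance
  by standard (auto simp: scaleR_fun_def fun_eq_iff algebra_simps)

end


text \<open>
  The Hoelder spaces depend on the real parameters \<open>\<kappa>\<close> and \<open>\<beta>\<close> and hence cannot be types.  A normed
  space is therefore a subspace \<open>V\<close> of a real vector space of functions together with a norm \<open>nV\<close>,
  which is meaningful on \<open>V\<close> only.
\<close>

definition bounded_linear_in ::
  "'a::real_vector set \<Rightarrow> ('a \<Rightarrow> real) \<Rightarrow> 'b::real_vector set \<Rightarrow> ('b \<Rightarrow> real) \<Rightarrow> ('a \<Rightarrow> 'b) \<Rightarrow> bool" where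
  "bounded_linear_in V nV W nW T \<longleftrightarrow>
     (\<forall>u\<in>V. T u \<in> W) \<and>
     (\<forall>u\<in>V. \<forall>v\<in>V. T (u + v) = T u + T v) \<and>
     (\<forall>c. \<forall>u\<in>V. T (c *\<^sub>R u) = c *\<^sub>R T u) \<and>
     (\<exists>K. \<forall>u\<in>V. nW (T u) \<le> K * nV u)"

definition frechet_derivative_in ::
  "'a::real_vector set \<Rightarrow> ('a \<Rightarrow> real) \<Rightarrow> 'b::real_vector set \<Rightarrow> ('b \<Rightarrow> real) \<Rightarrow>
   ('a \<Rightarrow> 'b) \<Rightarrow> 'a \<Rightarrow> ('a \<Rightarrow> 'b) \<Rightarrow> bool" where
  "frechet_derivative_in V nV W nW f u T \<longleftrightarrow>
     bounded_linear_in V nV W nW T \<and>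
     (\<forall>e>0. \<exists>d>0. \<forall>h\<in>V. nV h < d \<longrightarrow>
        f (u + h) - f u - T h \<in> W \<and> nW (f (u + h) - f u - T h) \<le> e * nV h)"

text \<open>
  The second derivative at \<open>u\<close> is the derivative of \<open>Df\<close>, a map into the bounded linear operators,
  identified with a bounded bilinear map \<open>B\<close>; the estimate uniform in \<open>k\<close> is the one in operator norm.
\<close>

definition second_frechet_derivative_in ::
  "'a::real_vector set \<Rightarrow> ('a \<Rightarrow> real) \<Rightarrow> 'b::real_vector set \<Rightarrow> ('b \<Rightarrow> real) \<Rightarrow>
   ('a \<Rightarrow> 'b) \<Rightarrow> 'a \<Rightarrow> ('a \<Rightarrow> 'a \<Rightarrow> 'b) \<Rightarrow> bool" where
  "second_frechet_derivative_in V nV W nW f u B \<longleftrightarrow>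
     (\<forall>h\<in>V. bounded_linear_in V nV W nW (B h)) \<and>
     (\<forall>k\<in>V. bounded_linear_in V nV W nW (\<lambda>h. B h k)) \<and>
     (\<exists>K. \<forall>h\<in>V. \<forall>k\<in>V. nW (B h k) \<le> K * nV h * nV k) \<and>
     (\<exists>Df r. r > 0 \<and>
        (\<forall>v\<in>V. nV (v - u) < r \<longrightarrow> frechet_derivative_in V nV W nW f v (Df v)) \<and>
        (\<forall>e>0. \<exists>d>0. \<forall>h\<in>V. nV h < d \<longrightarrow>
           (\<forall>k\<in>V. nW (Df (u + h) k - Df u k - B h k) \<le> e * nV h * nV k)))"

text \<open>\<open>W k\<close> is the \<open>k\<close>-th derivative of \<open>w\<close> in the norm \<open>nV\<close>; \<open>I\<close> is meant to be open.\<close>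

definition smooth_curve_in ::
  "'a::real_vector set \<Rightarrow> ('a \<Rightarrow> real) \<Rightarrow> real set \<Rightarrow> (real \<Rightarrow> 'a) \<Rightarrow> bool" where
  "smooth_curve_in V nV I w \<longleftrightarrow>
     (\<exists>W :: nat \<Rightarrow> real \<Rightarrow> 'a. (\<forall>t\<in>I. W 0 t = w t) \<and>
        (\<forall>k. \<forall>t\<in>I. W k t \<in> V \<and>
           ((\<lambda>h. nV ((W k (t + h) - W k t) /\<^sub>R h - W (Suc k) t)) \<longlongrightarrow> 0) (at 0)))"

definition smooth_real_on :: "real set \<Rightarrow> (real \<Rightarrow> real) \<Rightarrow> bool" where
  "smooth_real_on I f \<longleftrightarrow> (\<forall>k. \<forall>t\<in>I. (deriv ^^ k) f differentiable (at t))"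


definition strip :: "(real \<times> real) set" where
  "strip = UNIV \<times> {0..1}"

definition holder_quotients :: "'a::metric_space set \<Rightarrow> real \<Rightarrow> ('a \<Rightarrow> real) \<Rightarrow> real set" where
  "holder_quotients S \<beta> f = {\<bar>f p - f q\<bar> / dist p q powr \<beta> |p q. p \<in> S \<and> q \<in> S \<and> p \<noteq> q}"

definition holder0 :: "'a::metric_space set \<Rightarrow> real \<Rightarrow> ('a \<Rightarrow> real) set" where
  "holder0 S \<beta> = {f. bounded (f ` S) \<and> bdd_above (holder_quotients S \<beta> f)}"

definition sup_norm :: "'a set \<Rightarrow> ('a \<Rightarrow> real) \<Rightarrow> real" where
  "sup_norm S f = (SUP p\<in>S. \<bar>f p\<bar>)"

definition holder0_norm :: "'a::metric_space set \<Rightarrow> real \<Rightarrow> ('a \<Rightarrow> real) \<Rightarrow> real" where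
  "holder0_norm S \<beta> f = sup_norm S f + Sup (holder_quotients S \<beta> f)"

primrec holder_line :: "nat \<Rightarrow> real \<Rightarrow> (real \<Rightarrow> real) set" where
  "holder_line 0 \<beta> = holder0 UNIV \<beta>"
| "holder_line (Suc k) \<beta> =
     {f. bounded (range f) \<and> (\<forall>x. f differentiable (at x)) \<and> deriv f \<in> holder_line k \<beta>}"

primrec holder_line_norm :: "nat \<Rightarrow> real \<Rightarrow> (real \<Rightarrow> real) \<Rightarrow> real" where
  "holder_line_norm 0 \<beta> f = holder0_norm UNIV \<beta> f"
| "holder_line_norm (Suc k) \<beta> f = sup_norm UNIV f + holder_line_norm k \<beta> (deriv f)"

text \<open>The \<open>s\<close>-derivative is one-sided on the boundary of the strip.\<close>

definition dx :: "(real \<times> real \<Rightarrow> real) \<Rightarrow> real \<times> real \<Rightarrow> real" where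
  "dx f = (\<lambda>(x, s). vector_derivative (\<lambda>y. f (y, s)) (at x))"

definition ds :: "(real \<times> real \<Rightarrow> real) \<Rightarrow> real \<times> real \<Rightarrow> real" where
  "ds f = (\<lambda>(x, s). vector_derivative (\<lambda>r. f (x, r)) (at s within {0..1}))"

primrec holder_strip :: "nat \<Rightarrow> real \<Rightarrow> (real \<times> real \<Rightarrow> real) set" where
  "holder_strip 0 \<beta> = holder0 strip \<beta>"
| "holder_strip (Suc k) \<beta> =
     {f. bounded (f ` strip) \<and>
         (\<forall>(x, s)\<in>strip. (\<lambda>y. f (y, s)) differentiable (at x) \<and>
            (\<lambda>r. f (x, r)) differentiable (at s within {0..1})) \<and>
         dx f \<in> holder_strip k \<beta> \<and> ds f \<in> holder_strip k \<beta>}"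

primrec holder_strip_norm :: "nat \<Rightarrow> real \<Rightarrow> (real \<times> real \<Rightarrow> real) \<Rightarrow> real" where
  "holder_strip_norm 0 \<beta> f = holder0_norm strip \<beta> f"
| "holder_strip_norm (Suc k) \<beta> f =
     sup_norm strip f + holder_strip_norm k \<beta> (dx f) + holder_strip_norm k \<beta> (ds f)"

definition C_line :: "nat \<Rightarrow> real \<Rightarrow> real \<Rightarrow> (real \<Rightarrow> real) set" where
  "C_line k \<kappa> \<beta> =
     {f \<in> holder_line k \<beta>. (\<forall>x. f (x + 2 * pi / \<kappa>) = f x) \<and> (\<forall>x. f (- x) = f x)}"

text \<open>
  Functions on the strip are represented by their extension by \<open>0\<close>, so that equality of
  representatives is equality on the strip.
\<close>

definition on_strip :: "(real \<times> real \<Rightarrow> real) \<Rightarrow> real \<times> real \<Rightarrow> real" where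
  "on_strip f = (\<lambda>p. if p \<in> strip then f p else 0)"

definition C_strip :: "nat \<Rightarrow> real \<Rightarrow> real \<Rightarrow> (real \<times> real \<Rightarrow> real) set" where
  "C_strip k \<kappa> \<beta> =
     {f \<in> holder_strip k \<beta>. on_strip f = f \<and>
        (\<forall>x s. f (x + 2 * pi / \<kappa>, s) = f (x, s)) \<and> (\<forall>x s. f (- x, s) = f (x, s))}"

type_synonym state = "(real \<Rightarrow> real) \<times> (real \<times> real \<Rightarrow> real)"

definition X :: "real \<Rightarrow> real \<Rightarrow> state set" where
  "X \<kappa> \<beta> = C_line 2 \<kappa> \<beta> \<times> {\<phi> \<in> C_strip 2 \<kappa> \<beta>. \<forall>x. \<phi> (x, 0) = 0 \<and> \<phi> (x, 1) = 0}"

definition X_norm :: "real \<Rightarrow> state \<Rightarrow> real" where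
  "X_norm \<beta> w = holder_line_norm 2 \<beta> (fst w) + holder_strip_norm 2 \<beta> (snd w)"

definition Y :: "real \<Rightarrow> real \<Rightarrow> state set" where
  "Y \<kappa> \<beta> = C_line 1 \<kappa> \<beta> \<times> C_strip 0 \<kappa> \<beta>"

definition Y_norm :: "real \<Rightarrow> state \<Rightarrow> real" where
  "Y_norm \<beta> w = holder_line_norm 1 \<beta> (fst w) + holder_strip_norm 0 \<beta> (snd w)"


text \<open>A parameter is \<open>\<Lambda> = (\<mu>, \<alpha>, \<lambda>)\<close>; the third component is written \<open>l\<close> below.\<close>

type_synonym params = "real \<times> real \<times> real"

definition \<O> :: "real \<Rightarrow> real \<Rightarrow> state set" where
  "\<O> \<kappa> \<beta> = {w \<in> X \<kappa> \<beta>. (INF x. fst w x) > - 1}"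

definition \<U> :: "params set" where
  "\<U> = {(\<mu>, \<alpha>, l). \<mu> \<noteq> 0 \<and> \<alpha> < 0 \<and> 0 < l \<and> l < pi}"

definition psi0 :: "params \<Rightarrow> real \<Rightarrow> real" where
  "psi0 = (\<lambda>(\<mu>, \<alpha>, l) s. \<mu> * cos (sqrt \<bar>\<alpha>\<bar> * (s - 1) + l))"

abbreviation psi0_s :: "params \<Rightarrow> real \<Rightarrow> real" where
  "psi0_s \<Lambda> \<equiv> deriv (psi0 \<Lambda>)"

abbreviation psi0_ss :: "params \<Rightarrow> real \<Rightarrow> real" where
  "psi0_ss \<Lambda> \<equiv> deriv (deriv (psi0 \<Lambda>))"

definition Q :: "params \<Rightarrow> real" where
  "Q = (\<lambda>(\<mu>, \<alpha>, l). 1 / 2 * \<mu>\<^sup>2 * \<bar>\<alpha>\<bar> * (sin l)\<^sup>2)"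

definition F1 :: "state \<Rightarrow> params \<Rightarrow> real \<Rightarrow> real" where
  "F1 = (\<lambda>(\<eta>, \<phi>) \<Lambda> x.
     (1 + (deriv \<eta> x)\<^sup>2) * (psi0_s \<Lambda> 1 + ds \<phi> (x, 1))\<^sup>2 / (2 * (1 + \<eta> x)\<^sup>2) + \<eta> x - Q \<Lambda>)"

definition flat_dx :: "(real \<Rightarrow> real) \<Rightarrow> (real \<times> real \<Rightarrow> real) \<Rightarrow> real \<times> real \<Rightarrow> real" where
  "flat_dx \<eta> u = (\<lambda>(x, s). dx u (x, s) - s * deriv \<eta> x / (1 + \<eta> x) * ds u (x, s))"

definition F2 :: "state \<Rightarrow> params \<Rightarrow> real \<times> real \<Rightarrow> real" where
  "F2 = (\<lambda>(\<eta>, \<phi>) (\<mu>, \<alpha>, l).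
     let \<Lambda> = (\<mu>, \<alpha>, l); u = (\<lambda>(x, s). psi0 \<Lambda> s + \<phi> (x, s))
     in on_strip (\<lambda>(x, s). flat_dx \<eta> (flat_dx \<eta> u) (x, s)
          + (psi0_ss \<Lambda> s + ds (ds \<phi>) (x, s)) / (1 + \<eta> x)\<^sup>2 - \<alpha> * u (x, s)))"

definition F :: "state \<Rightarrow> params \<Rightarrow> state" where
  "F w \<Lambda> = (F1 w \<Lambda>, F2 w \<Lambda>)"

definition \<T> :: "params \<Rightarrow> (real \<times> real \<Rightarrow> real) \<Rightarrow> state" where
  "\<T> \<Lambda> \<phi> =
     (\<lambda>x. - \<phi> (x, 1) / psi0_s \<Lambda> 1,
      on_strip (\<lambda>(x, s). \<phi> (x, s) - s * psi0_s \<Lambda> s / psi0_s \<Lambda> 1 * \<phi> (x, 1)))"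


text \<open>\<open>csqrt\<close> of a negative real \<open>-r\<close> is \<open>\<i> * sqrt r\<close>.\<close>

definition theta :: "real \<Rightarrow> nat \<Rightarrow> real \<Rightarrow> complex" where
  "theta \<kappa> n \<alpha> = csqrt (of_real (\<alpha> + (real n)\<^sup>2 * \<kappa>\<^sup>2))"

text \<open>
  In the next two definitions the complex quantities are real, since \<open>theta\<close> is real or purely
  imaginary; \<open>Re\<close> only changes the type.
\<close>

definition sinh_theta :: "real \<Rightarrow> nat \<Rightarrow> real \<Rightarrow> real \<Rightarrow> real" where
  "sinh_theta \<kappa> n \<alpha> s =
     (let \<theta> = theta \<kappa> n \<alpha> in if \<theta> = 0 then s else Re (sinh (\<theta> * of_real s) / \<theta>))"

definition l_fun :: "real \<Rightarrow> nat \<Rightarrow> real \<Rightarrow> real" where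
  "l_fun \<kappa> n \<alpha> =
     (let \<theta> = theta \<kappa> n \<alpha> in if \<theta> = 0 then 1 else Re (\<theta> * (cosh \<theta> / sinh \<theta>)))"

definition r_fun :: "params \<Rightarrow> real" where
  "r_fun = (\<lambda>(\<mu>, \<alpha>, l). 1 / (\<mu>\<^sup>2 * \<bar>\<alpha>\<bar> * (sin l)\<^sup>2) + sqrt \<bar>\<alpha>\<bar> * cot l)"

definition M :: "real \<Rightarrow> params \<Rightarrow> nat set" where
  "M \<kappa> = (\<lambda>(\<mu>, \<alpha>, l). {n. sinh_theta \<kappa> n \<alpha> 1 \<noteq> 0 \<and> l_fun \<kappa> n \<alpha> = r_fun (\<mu>, \<alpha>, l)})"

definition phi_mode :: "real \<Rightarrow> nat \<Rightarrow> real \<Rightarrow> real \<times> real \<Rightarrow> real" where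
  "phi_mode \<kappa> n \<alpha> = on_strip (\<lambda>(x, s). cos (real n * \<kappa> * x) * sinh_theta \<kappa> n \<alpha> s)"

definition w_star :: "real \<Rightarrow> nat \<Rightarrow> params \<Rightarrow> state" where
  "w_star \<kappa> n = (\<lambda>(\<mu>, \<alpha>, l). \<T> (\<mu>, \<alpha>, l) (phi_mode \<kappa> n \<alpha>))"


text \<open>The last conjunct is \<open>w(t) = t ws + O(t\<^sup>2)\<close> in the norm of \<open>X\<close>.\<close>

definition solution_curve ::
  "real \<Rightarrow> real \<Rightarrow> state \<Rightarrow> real \<Rightarrow> (real \<Rightarrow> state) \<Rightarrow> (real \<Rightarrow> params) \<Rightarrow> bool" where
  "solution_curve \<kappa> \<beta> ws \<epsilon> w L \<longleftrightarrow>
     \<epsilon> > 0 \<and> w 0 = 0 \<and>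
     smooth_curve_in (X \<kappa> \<beta>) (X_norm \<beta>) {-\<epsilon><..<\<epsilon>} w \<and>
     (\<forall>t\<in>{-\<epsilon><..<\<epsilon>}. w t \<in> \<O> \<kappa> \<beta> \<and> L t \<in> \<U> \<and> F (w t) (L t) = 0 \<and> (t \<noteq> 0 \<longrightarrow> w t \<noteq> 0)) \<and>
     (\<exists>C. \<exists>\<delta>>0. \<forall>t. \<bar>t\<bar> < \<delta> \<longrightarrow> X_norm \<beta> (w t - t *\<^sub>R ws) \<le> C * t\<^sup>2)"

text \<open>The last conjunct: the curve contains all nontrivial solutions near \<open>(0, \<lambda>\<^sup>*)\<close>.\<close>

definition lambda_bifurcation_curve ::
  "real \<Rightarrow> real \<Rightarrow> nat \<Rightarrow> params \<Rightarrow> real \<Rightarrow> (real \<Rightarrow> state) \<Rightarrow> (real \<Rightarrow> real) \<Rightarrow> bool" where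
  "lambda_bifurcation_curve \<kappa> \<beta> n = (\<lambda>(\<mu>, \<alpha>, l) \<epsilon> w lam.
     solution_curve \<kappa> \<beta> (w_star \<kappa> n (\<mu>, \<alpha>, l)) \<epsilon> w (\<lambda>t. (\<mu>, \<alpha>, lam t)) \<and>
     smooth_real_on {-\<epsilon><..<\<epsilon>} lam \<and> lam 0 = l \<and>
     (\<exists>\<delta>>0. \<forall>v\<in>\<O> \<kappa> \<beta>. \<forall>k\<in>{0<..<pi}.
        X_norm \<beta> v < \<delta> \<and> \<bar>k - l\<bar> < \<delta> \<and> F v (\<mu>, \<alpha>, k) = 0 \<and> v \<noteq> 0 \<longrightarrow>
        (\<exists>t\<in>{-\<epsilon><..<\<epsilon>}. v = w t \<and> k = lam t)))"

definition mu_bifurcation_curve ::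
  "real \<Rightarrow> real \<Rightarrow> nat \<Rightarrow> params \<Rightarrow> real \<Rightarrow> (real \<Rightarrow> state) \<Rightarrow> (real \<Rightarrow> real) \<Rightarrow> bool" where
  "mu_bifurcation_curve \<kappa> \<beta> n = (\<lambda>(\<mu>, \<alpha>, l) \<epsilon> w mu.
     solution_curve \<kappa> \<beta> (w_star \<kappa> n (\<mu>, \<alpha>, l)) \<epsilon> w (\<lambda>t. (mu t, \<alpha>, l)) \<and>
     smooth_real_on {-\<epsilon><..<\<epsilon>} mu \<and> mu 0 = \<mu>)"


text \<open>\<open>B\<close> is the second derivative of \<open>F\<close> with respect to \<open>w\<close> at \<open>(0, \<Lambda>)\<close>.\<close>

definition quadratic_coeffs ::
  "real \<Rightarrow> nat \<Rightarrow> params \<Rightarrow> (state \<Rightarrow> state \<Rightarrow> state) \<Rightarrow>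
   real \<Rightarrow> real \<Rightarrow> (real \<Rightarrow> real) \<Rightarrow> (real \<Rightarrow> real) \<Rightarrow> bool" where
  "quadratic_coeffs \<kappa> n \<Lambda> B c0 c2 b0 b2 \<longleftrightarrow>
     B (w_star \<kappa> n \<Lambda>) (w_star \<kappa> n \<Lambda>) =
       (\<lambda>x. c0 + c2 * cos (2 * real n * \<kappa> * x),
        on_strip (\<lambda>(x, s). b0 s + b2 s * cos (2 * real n * \<kappa> * x)))"

definition is_a_solution ::
  "real \<Rightarrow> nat \<Rightarrow> params \<Rightarrow> nat \<Rightarrow> real \<Rightarrow> (real \<Rightarrow> real) \<Rightarrow> (real \<Rightarrow> real) \<Rightarrow> bool" where
  "is_a_solution \<kappa> n \<Lambda> j c b a \<longleftrightarrow>
     (\<exists>a' a''.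
        (\<forall>s\<in>{0..1}. (a has_real_derivative a' s) (at s within {0..1}) \<and>
           (a' has_real_derivative a'' s) (at s within {0..1}) \<and>
           a'' s - Re ((theta \<kappa> (j * n) (fst (snd \<Lambda>)))\<^sup>2) * a s = - b s) \<and>
        a 0 = 0 \<and>
        psi0_s \<Lambda> 1 * a' 1 - (psi0_ss \<Lambda> 1 + 1 / psi0_s \<Lambda> 1) * a 1 = - c)"

end

theory Submission
  imports Defs
begin

text \<open>
  The coefficient \<open>\<lambda>''(0)\<close> is usually obtained by differentiating \<open>F(w(t), \<lambda>(t)) = 0\<close> three times and projecting
  onto the cokernel.  Here the flattening is undone instead.  In the physical domain the stream function
  solves \<open>\<Delta> \<psi> = - \<psi>\<close>, is constant on the bottom and on the free surface, and the Bernoulli condition expresses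
  its normal derivative on the surface by the elevation \<open>\<eta>\<close>.  Green's identity with the solutions
  \<open>cos (n x) S\<^sub>n(y)\<close>, \<open>S\<^sub>n(y) = sinh (\<theta>\<^sub>n y) / \<theta>\<^sub>n\<close>, where \<open>y\<close> is the height above the bottom, therefore yields for each mode \<open>n\<close> an exact scalar identity between
  \<open>\<eta>\<close> and \<open>\<lambda>\<close> (lemma \<open>surface_identity\<close>).  It is proved in the flattened coordinates, where it is the
  divergence theorem on a strip (lemma \<open>greens_identity\<close>).

  Let \<open>\<eta> = t cos x + t\<^sup>2 d\<close>, where \<open>d\<close> and its derivative are bounded.  The identity of the critical mode 1 has
  no linear term in \<open>\<eta>\<close>.  Its second order gives \<open>cos \<lambda> = O(t\<^sup>2)\<close>, and its third order gives
  \<open>\<pi> cos \<lambda> / t\<^sup>2 = - 3/2 \<integral> d - 1/2 \<integral> d cos 2x - 3\<pi>/4 + O(t)\<close> (lemmas \<open>bdd_g\<close> and \<open>third_order\<close>).  The second order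
  of the identities of the modes 0 and 2 gives the limits of the two integrals (lemma \<open>mode_expansion\<close>).
  Thus \<open>\<lambda>''(0) = - 2 lim (cos \<lambda> / t\<^sup>2)\<close> is explicit.

  The second derivative \<open>B\<close> is evaluated on the kernel pointwise, as the limit of \<open>2 F(t w\<^sup>*) / t\<^sup>2\<close>
  (lemma \<open>second_derivative_at_w_star\<close>).  The resulting boundary value problems are nonresonant, so their
  solutions \<open>a\<^sub>0\<close> and \<open>a\<^sub>2\<close> are unique (lemma \<open>is_a_solution_iff\<close>), and the two integrals above tend to \<open>\<pi> a\<^sub>0(1)\<close> and
  \<open>\<pi> a\<^sub>2(1) / 2\<close>.  Finally, along the curve in the parameter \<open>\<mu>\<close> the third parameter is constantly \<open>\<pi> / 2\<close>, so
  equality with an arc of the curve in \<open>\<lambda>\<close> would make \<open>\<lambda>\<close> constant, against \<open>\<lambda>''(0) < 0\<close>.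
\<close>

section \<open>Hoelder spaces\<close>

lemma sup_norm_ge:
  fixes f :: "'a \<Rightarrow> real"
  assumes "bounded (f ` S)" "p \<in> S"
  shows "\<bar>f p\<bar> \<le> sup_norm S f"
proof -
  have "bdd_above ((\<lambda>p. \<bar>f p\<bar>) ` S)"
    using assms(1) by (auto simp: bounded_iff bdd_above_def)
  then show ?thesis unfolding sup_norm_def using assms(2) by (rule cSUP_upper2) auto
qed

lemma sup_norm_scale_le:
  "sup_norm S (\<lambda>p. c * f p) \<le> \<bar>c\<bar> * sup_norm S f" if "bounded (f ` S)" "S \<noteq> {}"
  unfolding sup_norm_def[of S "\<lambda>p. c * f p"]
  using that by (intro cSUP_least) (auto simp: abs_mult intro!: mult_left_mono sup_norm_ge)

lemma sup_norm_cong: "(\<And>p. p \<in> S \<Longrightarrow> f p = g p) \<Longrightarrow> sup_norm S f = sup_norm S g"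
  unfolding sup_norm_def by (auto intro!: SUP_cong)

lemma holder_quotients_cong:
  "(\<And>p. p \<in> S \<Longrightarrow> f p = g p) \<Longrightarrow> holder_quotients S \<beta> f = holder_quotients S \<beta> g"
  unfolding holder_quotients_def by (intro Collect_cong ex_cong1) auto

text \<open>
  On a set with fewer than two points there are no difference quotients, and the supremum in the
  Hoelder norm is an unspecified real; with two points it is nonnegative.
\<close>

definition two_points :: "'a set \<Rightarrow> bool" where
  "two_points S \<longleftrightarrow> (\<exists>p\<in>S. \<exists>q\<in>S. p \<noteq> q)"

lemma two_points_UNIV: "two_points (UNIV :: real set)"
  unfolding two_points_def by (intro bexI[of _ 0] bexI[of _ 1]) auto

lemma two_points_strip: "two_points strip"
  unfolding two_points_def strip_def by (intro bexI[of _ "(0,0)"] bexI[of _ "(0,1)"]) auto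

lemma holder_quotients_nonempty: "two_points S \<Longrightarrow> holder_quotients S \<beta> f \<noteq> {}"
  unfolding two_points_def holder_quotients_def by blast

lemma holder_quotients_nonneg: "z \<in> holder_quotients S \<beta> f \<Longrightarrow> 0 \<le> z"
  unfolding holder_quotients_def by auto

lemma Sup_holder_quotients_nonneg:
  assumes "f \<in> holder0 S \<beta>" "two_points S"
  shows "0 \<le> Sup (holder_quotients S \<beta> f)"
proof -
  obtain z where z: "z \<in> holder_quotients S \<beta> f"
    using holder_quotients_nonempty[OF assms(2)] by blast
  have "z \<le> Sup (holder_quotients S \<beta> f)"
    using assms(1) z by (intro cSup_upper) (auto simp: holder0_def)
  with holder_quotients_nonneg[OF z] show ?thesis by linarith
qed

lemma holder0_norm_ge: "\<bar>f p\<bar> \<le> holder0_norm S \<beta> f"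
  if "f \<in> holder0 S \<beta>" "two_points S" "p \<in> S"
  using sup_norm_ge[of f S p] Sup_holder_quotients_nonneg[OF that(1,2)] that
  unfolding holder0_norm_def by (auto simp: holder0_def)

lemma holder0_estimate:
  assumes "f \<in> holder0 S \<beta>"
  shows "\<exists>K. \<forall>p\<in>S. \<forall>q\<in>S. \<bar>f p - f q\<bar> \<le> K * dist p q powr \<beta>"
proof -
  have "\<exists>K. \<forall>z\<in>holder_quotients S \<beta> f. z \<le> K"
    using assms unfolding holder0_def bdd_above_def by simp
  then obtain K where K: "\<forall>z\<in>holder_quotients S \<beta> f. z \<le> K" ..
  have "\<bar>f p - f q\<bar> \<le> K * dist p q powr \<beta>" if "p \<in> S" "q \<in> S" for p q
  proof (cases "p = q")
    case False
    then have "\<bar>f p - f q\<bar> / dist p q powr \<beta> \<in> holder_quotients S \<beta> f"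
      using that unfolding holder_quotients_def by blast
    then have "\<bar>f p - f q\<bar> / dist p q powr \<beta> \<le> K" using K by blast
    then show ?thesis using False by (simp add: divide_le_eq)
  qed simp
  then show ?thesis by blast
qed

lemma holder0_intro:
  assumes "bounded (f ` S)"
    and "\<And>p q. p \<in> S \<Longrightarrow> q \<in> S \<Longrightarrow> p \<noteq> q \<Longrightarrow> \<bar>f p - f q\<bar> \<le> K * dist p q powr \<beta>"
  shows "f \<in> holder0 S \<beta>"
  unfolding holder0_def bdd_above_def holder_quotients_def
  using assms by (auto intro!: exI[of _ K] simp: divide_le_eq)

text \<open>
  At distances below 1 the Lipschitz bound is stronger than the Hoelder bound; at larger distances the
  bound on the function itself suffices.
\<close>

lemma holder0_lipschitz:
  assumes "0 < \<beta>" "\<beta> < 1" "\<And>p. p \<in> S \<Longrightarrow> \<bar>f p\<bar> \<le> K"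
    and "\<And>p q. p \<in> S \<Longrightarrow> q \<in> S \<Longrightarrow> \<bar>f p - f q\<bar> \<le> L * dist p q"
  shows "f \<in> holder0 S \<beta>"
proof (rule holder0_intro)
  show "bounded (f ` S)" using assms(3) by (auto simp: bounded_iff)
  fix p q assume pq: "p \<in> S" "q \<in> S" "p \<noteq> q"
  have K: "0 \<le> K" using assms(3)[OF pq(1)] by linarith
  have "0 \<le> L * dist p q" using assms(4)[OF pq(1,2)] by linarith
  then have L: "0 \<le> L" using pq(3) by (simp add: zero_le_mult_iff)
  show "\<bar>f p - f q\<bar> \<le> (L + 2 * K) * dist p q powr \<beta>"
  proof (cases "dist p q \<le> 1")
    case True
    have "dist p q powr 1 \<le> dist p q powr \<beta>"
      using True pq assms(2) by (intro powr_mono') auto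
    then have "L * dist p q \<le> L * dist p q powr \<beta>"
      using L pq by (intro mult_left_mono) auto
    then show ?thesis
      using assms(4)[OF pq(1,2)] K by (simp add: algebra_simps add_increasing2)
  next
    case False
    then have "1 \<le> dist p q powr \<beta>" using assms(1) by (simp add: ge_one_powr_ge_zero)
    then have "(2 * K + L) * 1 \<le> (2 * K + L) * dist p q powr \<beta>"
      using K L by (intro mult_left_mono) auto
    then show ?thesis using assms(3)[OF pq(1)] assms(3)[OF pq(2)] L
      by (simp add: algebra_simps)
  qed
qed

lemma holder0_continuous:
  assumes "f \<in> holder0 S \<beta>" "0 < \<beta>"
  shows "continuous_on S f"
proof -
  obtain K where "\<forall>p\<in>S. \<forall>q\<in>S. \<bar>f p - f q\<bar> \<le> K * dist p q powr \<beta>"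
    using holder0_estimate[OF assms(1)] ..
  then have K: "\<And>p q. p \<in> S \<Longrightarrow> q \<in> S \<Longrightarrow> \<bar>f p - f q\<bar> \<le> K * dist p q powr \<beta>"
    by blast
  show ?thesis
    unfolding continuous_on_def
  proof
    fix p assume p: "p \<in> S"
    have d: "((\<lambda>q. dist q p) \<longlongrightarrow> 0) (at p within S)"
      using tendsto_dist_iff[of "\<lambda>q. q" p "at p within S"] by simp
    have "((\<lambda>q. dist q p powr \<beta>) \<longlongrightarrow> 0 powr \<beta>) (at p within S)"
      by (rule tendsto_powr'[OF d]) (use \<open>0 < \<beta>\<close> in auto)
    from tendsto_mult_left[OF this, of K]
    have "((\<lambda>q. K * dist q p powr \<beta>) \<longlongrightarrow> 0) (at p within S)" by simp
    then have "((\<lambda>q. f q - f p) \<longlongrightarrow> 0) (at p within S)"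
      by (rule Lim_null_comparison[rotated])
        (auto simp: eventually_at_filter intro!: K p always_eventually)
    then show "(f \<longlongrightarrow> f p) (at p within S)" by (simp add: LIM_zero_iff)
  qed
qed

lemma holder0_diff:
  assumes "f \<in> holder0 S \<beta>" "g \<in> holder0 S \<beta>"
  shows "(\<lambda>p. f p - g p) \<in> holder0 S \<beta>"
proof -
  obtain K where "\<forall>p\<in>S. \<forall>q\<in>S. \<bar>f p - f q\<bar> \<le> K * dist p q powr \<beta>"
    using holder0_estimate[OF assms(1)] ..
  then have K: "\<And>p q. p \<in> S \<Longrightarrow> q \<in> S \<Longrightarrow> \<bar>f p - f q\<bar> \<le> K * dist p q powr \<beta>"
    by blast
  obtain L where "\<forall>p\<in>S. \<forall>q\<in>S. \<bar>g p - g q\<bar> \<le> L * dist p q powr \<beta>"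
    using holder0_estimate[OF assms(2)] ..
  then have L: "\<And>p q. p \<in> S \<Longrightarrow> q \<in> S \<Longrightarrow> \<bar>g p - g q\<bar> \<le> L * dist p q powr \<beta>"
    by blast
  show ?thesis
  proof (rule holder0_intro)
    show "bounded ((\<lambda>p. f p - g p) ` S)"
      using assms by (intro bounded_minus_comp) (auto simp: holder0_def)
    fix p q assume "p \<in> S" "q \<in> S" "p \<noteq> q"
    with K[of p q] L[of p q]
    show "\<bar>f p - g p - (f q - g q)\<bar> \<le> (K + L) * dist p q powr \<beta>"
      by (simp add: algebra_simps abs_if split: if_splits)
  qed
qed

lemma bounded_scale: "bounded ((\<lambda>p. c * f p) ` S)" if "bounded (f ` S)" for c :: real
  using bounded_scaleR_comp[OF that, of c] by simp

lemma holder0_scale: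
  assumes "f \<in> holder0 S \<beta>"
  shows "(\<lambda>p. c * f p) \<in> holder0 S \<beta>"
proof -
  obtain K where "\<forall>p\<in>S. \<forall>q\<in>S. \<bar>f p - f q\<bar> \<le> K * dist p q powr \<beta>"
    using holder0_estimate[OF assms(1)] ..
  then have K: "\<And>p q. p \<in> S \<Longrightarrow> q \<in> S \<Longrightarrow> \<bar>f p - f q\<bar> \<le> K * dist p q powr \<beta>"
    by blast
  show ?thesis
  proof (rule holder0_intro)
    show "bounded ((\<lambda>p. c * f p) ` S)"
      using assms by (intro bounded_scale) (auto simp: holder0_def)
    fix p q assume "p \<in> S" "q \<in> S" "p \<noteq> q"
    then have "\<bar>c\<bar> * \<bar>f p - f q\<bar> \<le> \<bar>c\<bar> * (K * dist p q powr \<beta>)"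
      by (intro mult_left_mono K) auto
    then show "\<bar>c * f p - c * f q\<bar> \<le> (\<bar>c\<bar> * K) * dist p q powr \<beta>"
      by (simp add: abs_mult[symmetric] algebra_simps)
  qed
qed

lemma holder0_norm_scale_le:
  assumes f: "f \<in> holder0 S \<beta>" and S: "two_points S"
  shows "holder0_norm S \<beta> (\<lambda>p. c * f p) \<le> \<bar>c\<bar> * holder0_norm S \<beta> f"
proof -
  have "Sup (holder_quotients S \<beta> (\<lambda>p. c * f p)) \<le> \<bar>c\<bar> * Sup (holder_quotients S \<beta> f)"
  proof (rule cSup_least[OF holder_quotients_nonempty[OF S]])
    fix z assume "z \<in> holder_quotients S \<beta> (\<lambda>p. c * f p)"
    then obtain p q where pq: "p \<in> S" "q \<in> S" "p \<noteq> q"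
      and z: "z = \<bar>c * f p - c * f q\<bar> / dist p q powr \<beta>"
      by (auto simp: holder_quotients_def)
    have "\<bar>f p - f q\<bar> / dist p q powr \<beta> \<le> Sup (holder_quotients S \<beta> f)"
      using f pq by (intro cSup_upper) (auto simp: holder0_def holder_quotients_def)
    then have "\<bar>c\<bar> * (\<bar>f p - f q\<bar> / dist p q powr \<beta>) \<le> \<bar>c\<bar> * Sup (holder_quotients S \<beta> f)"
      by (intro mult_left_mono) auto
    moreover have "z = \<bar>c\<bar> * (\<bar>f p - f q\<bar> / dist p q powr \<beta>)"
      unfolding z by (simp add: abs_mult right_diff_distrib[symmetric])
    ultimately show "z \<le> \<bar>c\<bar> * Sup (holder_quotients S \<beta> f)" by simp
  qed
  moreover have "sup_norm S (\<lambda>p. c * f p) \<le> \<bar>c\<bar> * sup_norm S f"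
    using f S by (intro sup_norm_scale_le) (auto simp: holder0_def two_points_def)
  ultimately show ?thesis unfolding holder0_norm_def by (simp add: algebra_simps)
qed

lemma holder0_cong: "(\<And>p. p \<in> S \<Longrightarrow> f p = g p) \<Longrightarrow> f \<in> holder0 S \<beta> \<longleftrightarrow> g \<in> holder0 S \<beta>"
  using holder_quotients_cong[of S f g \<beta>] image_cong[of S S f g] unfolding holder0_def by auto

subsection \<open>Functions on the line\<close>

lemma holder_line_norm_ge: "f \<in> holder_line k \<beta> \<Longrightarrow> \<bar>f x\<bar> \<le> holder_line_norm k \<beta> f"
proof (induction k arbitrary: f x)
  case 0
  then show ?case using holder0_norm_ge[OF _ two_points_UNIV] by simp
next
  case (Suc k)
  have "\<bar>deriv f x\<bar> \<le> holder_line_norm k \<beta> (deriv f)" using Suc by simp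
  moreover have "\<bar>f x\<bar> \<le> sup_norm UNIV f" using Suc.prems by (intro sup_norm_ge) auto
  ultimately show ?case by simp
qed

lemma holder_line_norm_deriv_ge:
  assumes "f \<in> holder_line (Suc k) \<beta>"
  shows "\<bar>deriv f x\<bar> \<le> holder_line_norm (Suc k) \<beta> f"
proof -
  have "\<bar>deriv f x\<bar> \<le> holder_line_norm k \<beta> (deriv f)"
    using assms by (intro holder_line_norm_ge) simp
  moreover have "\<bar>f x\<bar> \<le> sup_norm UNIV f" using assms by (intro sup_norm_ge) auto
  ultimately show ?thesis by simp
qed

lemma holder_line_diff:
  "f \<in> holder_line k \<beta> \<Longrightarrow> g \<in> holder_line k \<beta> \<Longrightarrow> (\<lambda>x. f x - g x) \<in> holder_line k \<beta>"
proof (induction k arbitrary: f g)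
  case 0
  then show ?case using holder0_diff by simp
next
  case (Suc k)
  have "deriv (\<lambda>x. f x - g x) = (\<lambda>x. deriv f x - deriv g x)"
    using Suc.prems by (auto simp: DERIV_deriv_iff_real_differentiable[symmetric]
        intro!: ext DERIV_imp_deriv DERIV_diff)
  then show ?case using Suc by (auto intro: bounded_minus_comp)
qed

lemma holder_line_scale:
  "f \<in> holder_line k \<beta> \<Longrightarrow> (\<lambda>x. c * f x) \<in> holder_line k \<beta> \<and>
     holder_line_norm k \<beta> (\<lambda>x. c * f x) \<le> \<bar>c\<bar> * holder_line_norm k \<beta> f"
proof (induction k arbitrary: f)
  case 0
  then show ?case using holder0_scale holder0_norm_scale_le two_points_UNIV by auto
next
  case (Suc k)
  have "deriv (\<lambda>x. c * f x) = (\<lambda>x. c * deriv f x)"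
    using Suc.prems by (auto simp: DERIV_deriv_iff_real_differentiable[symmetric]
        intro!: ext DERIV_imp_deriv DERIV_cmult)
  moreover have "sup_norm UNIV (\<lambda>x. c * f x) \<le> \<bar>c\<bar> * sup_norm UNIV f"
    using Suc.prems by (intro sup_norm_scale_le) auto
  ultimately show ?case using Suc.prems Suc.IH[of "deriv f"]
    by (auto simp: distrib_left intro!: bounded_scale)
qed

lemma holder_line_cos:
  assumes "0 < \<beta>" "\<beta> < 1"
  shows "(\<lambda>x. cos (x + z)) \<in> holder_line k \<beta>"
proof (induction k arbitrary: z)
  case 0
  have "\<bar>cos (x + z) - cos (y + z)\<bar> \<le> 1 * dist x y" for x y
    using field_differentiable_bound[of UNIV "\<lambda>x. cos (x + z)" "\<lambda>x. - sin (x + z)" 1 x y]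
    by (auto simp: dist_norm norm_minus_commute intro!: derivative_eq_intros)
  then show ?case using holder0_lipschitz[OF assms, of UNIV "\<lambda>x. cos (x + z)" 1 1] by simp
next
  case (Suc k)
  have d: "((\<lambda>x. cos (x + z)) has_real_derivative cos (x + (z + pi / 2))) (at x)" for x
  proof -
    have "((\<lambda>x. cos (x + z)) has_real_derivative - sin (x + z)) (at x)"
      by (auto intro!: derivative_eq_intros)
    moreover have "- sin (x + z) = cos (x + (z + pi / 2))"
      by (simp add: add.assoc[symmetric] cos_add[of "x + z" "pi / 2"])
    ultimately show ?thesis by simp
  qed
  then have "deriv (\<lambda>x. cos (x + z)) = (\<lambda>x. cos (x + (z + pi / 2)))"
    by (intro ext DERIV_imp_deriv)
  moreover have "bounded (range (\<lambda>x. cos (x + z)))"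
    by (auto simp: bounded_iff intro!: exI[of _ 1])
  ultimately show ?case using Suc d by (auto simp: real_differentiable_def)
qed

subsection \<open>Functions on the strip\<close>

lemma dx_eqI: "((\<lambda>y. f (y, s)) has_real_derivative D) (at x) \<Longrightarrow> dx f (x, s) = D"
  unfolding dx_def
  by (simp add: has_real_derivative_iff_has_vector_derivative vector_derivative_at)

lemma ds_eqI:
  "s \<in> {0..1} \<Longrightarrow> ((\<lambda>r. f (x, r)) has_real_derivative D) (at s within {0..1}) \<Longrightarrow> ds f (x, s) = D"
  unfolding ds_def
  by (simp add: has_real_derivative_iff_has_vector_derivative vector_derivative_within_closed_interval)

lemma differentiable_real_vector_derivative:
  fixes g :: "real \<Rightarrow> real"
  assumes "g differentiable (at x within A)"
  shows "(g has_real_derivative vector_derivative g (at x within A)) (at x within A)"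
  using assms vector_derivative_works[of g "at x within A"]
  by (simp add: has_real_derivative_iff_has_vector_derivative)

lemma holder_strip_has_dx:
  assumes "f \<in> holder_strip (Suc k) \<beta>" "s \<in> {0..1}"
  shows "((\<lambda>y. f (y, s)) has_real_derivative dx f (x, s)) (at x)"
proof -
  have "(\<lambda>y. f (y, s)) differentiable (at x)" using assms by (auto simp: strip_def)
  from differentiable_real_vector_derivative[OF this] show ?thesis by (simp add: dx_def)
qed

lemma holder_strip_has_ds:
  assumes "f \<in> holder_strip (Suc k) \<beta>" "s \<in> {0..1}"
  shows "((\<lambda>r. f (x, r)) has_real_derivative ds f (x, s)) (at s within {0..1})"
proof -
  have "(\<lambda>r. f (x, r)) differentiable (at s within {0..1})" using assms by (auto simp: strip_def)
  from differentiable_real_vector_derivative[OF this] show ?thesis by (simp add: ds_def)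
qed

lemma mem_strip [simp]: "(x, s) \<in> strip \<longleftrightarrow> s \<in> {0..1}"
  by (simp add: strip_def)

lemma dx_cong_strip:
  assumes "\<And>p. p \<in> strip \<Longrightarrow> f p = g p" "p \<in> strip"
  shows "dx f p = dx g p"
proof -
  obtain x s where p: "p = (x, s)" by (cases p)
  have "(\<lambda>y. f (y, s)) = (\<lambda>y. g (y, s))" using assms p by auto
  then show ?thesis unfolding dx_def p by simp
qed

lemma ds_cong_strip:
  assumes "\<And>p. p \<in> strip \<Longrightarrow> f p = g p" "p \<in> strip"
  shows "ds f p = ds g p"
proof -
  obtain x s where p: "p = (x, s)" by (cases p)
  show ?thesis unfolding ds_def p
    using assms p by (auto intro!: vector_derivative_cong_eq always_eventually)
qed

lemma differentiable_cong_strip: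
  assumes "\<And>p. p \<in> strip \<Longrightarrow> f p = g p" "s \<in> {0..1}"
  shows "((\<lambda>y. f (y, s)) differentiable (at x)) = ((\<lambda>y. g (y, s)) differentiable (at x))"
    and "((\<lambda>r. f (x, r)) differentiable (at s within {0..1})) =
         ((\<lambda>r. g (x, r)) differentiable (at s within {0..1}))"
proof -
  have "(\<lambda>y. f (y, s)) = (\<lambda>y. g (y, s))" using assms by auto
  then show "((\<lambda>y. f (y, s)) differentiable (at x)) = ((\<lambda>y. g (y, s)) differentiable (at x))"
    by simp
  show "((\<lambda>r. f (x, r)) differentiable (at s within {0..1})) =
         ((\<lambda>r. g (x, r)) differentiable (at s within {0..1}))"
    using assms
    by (intro iffI; elim differentiable_transform_within[OF _ zero_less_one assms(2)]) auto
qed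

text \<open>
  The spaces on the strip only see the values there: the \<open>x\<close>-derivative is taken along horizontal lines
  and the \<open>s\<close>-derivative within the unit interval.
\<close>

lemma holder_strip_cong:
  assumes "\<And>p. p \<in> strip \<Longrightarrow> f p = g p"
  shows "(f \<in> holder_strip k \<beta> \<longleftrightarrow> g \<in> holder_strip k \<beta>) \<and>
    holder_strip_norm k \<beta> f = holder_strip_norm k \<beta> g"
  using assms
proof (induction k arbitrary: f g)
  case 0
  then show ?case
    using holder0_cong[of strip f g] holder_quotients_cong[of strip f g] sup_norm_cong[of strip f g]
    by (simp add: holder0_norm_def)
next
  case (Suc k)
  have "f ` strip = g ` strip" using Suc.prems by auto
  moreover have "dx f \<in> holder_strip k \<beta> \<longleftrightarrow> dx g \<in> holder_strip k \<beta>"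
    "holder_strip_norm k \<beta> (dx f) = holder_strip_norm k \<beta> (dx g)"
    using Suc.IH[of "dx f" "dx g"] dx_cong_strip[of f g] Suc.prems by blast+
  moreover have "ds f \<in> holder_strip k \<beta> \<longleftrightarrow> ds g \<in> holder_strip k \<beta>"
    "holder_strip_norm k \<beta> (ds f) = holder_strip_norm k \<beta> (ds g)"
    using Suc.IH[of "ds f" "ds g"] ds_cong_strip[of f g] Suc.prems by blast+
  moreover have "(\<forall>(x, s)\<in>strip. (\<lambda>y. f (y, s)) differentiable (at x) \<and>
            (\<lambda>r. f (x, r)) differentiable (at s within {0..1})) \<longleftrightarrow>
     (\<forall>(x, s)\<in>strip. (\<lambda>y. g (y, s)) differentiable (at x) \<and>
            (\<lambda>r. g (x, r)) differentiable (at s within {0..1}))"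
    using differentiable_cong_strip[of f g] Suc.prems by (intro ball_cong) auto
  ultimately show ?case using sup_norm_cong[of strip f g] Suc.prems by simp
qed

lemma holder_strip_bounded: "f \<in> holder_strip k \<beta> \<Longrightarrow> bounded (f ` strip)"
  by (cases k) (auto simp: holder0_def)

lemma holder_strip_norm_ge:
  "f \<in> holder_strip k \<beta> \<Longrightarrow> p \<in> strip \<Longrightarrow> \<bar>f p\<bar> \<le> holder_strip_norm k \<beta> f"
proof (induction k arbitrary: f p)
  case 0
  then show ?case using holder0_norm_ge[OF _ two_points_strip] by simp
next
  case (Suc k)
  have "\<bar>dx f p\<bar> \<le> holder_strip_norm k \<beta> (dx f)" "\<bar>ds f p\<bar> \<le> holder_strip_norm k \<beta> (ds f)"
    using Suc by auto
  moreover have "\<bar>f p\<bar> \<le> sup_norm strip f" using Suc.prems by (intro sup_norm_ge) auto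
  ultimately show ?case by simp
qed

lemma holder_strip_norm_ds_ge:
  assumes "f \<in> holder_strip (Suc k) \<beta>" "p \<in> strip"
  shows "\<bar>ds f p\<bar> \<le> holder_strip_norm (Suc k) \<beta> f"
proof -
  have "\<bar>dx f p\<bar> \<le> holder_strip_norm k \<beta> (dx f)" "\<bar>ds f p\<bar> \<le> holder_strip_norm k \<beta> (ds f)"
    using assms by (auto intro: holder_strip_norm_ge)
  moreover have "\<bar>f p\<bar> \<le> sup_norm strip f" using assms by (intro sup_norm_ge) auto
  ultimately show ?thesis by simp
qed

lemma holder_strip_diff:
  "f \<in> holder_strip k \<beta> \<Longrightarrow> g \<in> holder_strip k \<beta> \<Longrightarrow> (\<lambda>p. f p - g p) \<in> holder_strip k \<beta>"
proof (induction k arbitrary: f g)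
  case 0
  then show ?case using holder0_diff by simp
next
  case (Suc k)
  have dx: "((\<lambda>y. f (y, s) - g (y, s)) has_real_derivative (dx f (x, s) - dx g (x, s))) (at x)"
    if "s \<in> {0..1}" for x s
    using that Suc.prems by (intro DERIV_diff holder_strip_has_dx) auto
  have ds: "((\<lambda>r. f (x, r) - g (x, r)) has_real_derivative (ds f (x, s) - ds g (x, s)))
      (at s within {0..1})" if "s \<in> {0..1}" for x s
    using that Suc.prems by (intro DERIV_diff holder_strip_has_ds) auto
  have d: "(\<lambda>y. f (y, s) - g (y, s)) differentiable (at x)"
    "(\<lambda>r. f (x, r) - g (x, r)) differentiable (at s within {0..1})" if "s \<in> {0..1}" for x s
    using dx[OF that] ds[OF that] unfolding real_differentiable_def by blast+
  have "dx (\<lambda>p. f p - g p) \<in> holder_strip k \<beta> \<longleftrightarrow> (\<lambda>p. dx f p - dx g p) \<in> holder_strip k \<beta>"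
    using dx_eqI[OF dx] by (intro conjunct1[OF holder_strip_cong]) auto
  moreover have "ds (\<lambda>p. f p - g p) \<in> holder_strip k \<beta> \<longleftrightarrow> (\<lambda>p. ds f p - ds g p) \<in> holder_strip k \<beta>"
    using ds_eqI[OF _ ds] by (intro conjunct1[OF holder_strip_cong]) auto
  ultimately show ?case
    using Suc d by (auto intro: bounded_minus_comp)
qed

lemma holder_strip_scale:
  "f \<in> holder_strip k \<beta> \<Longrightarrow> (\<lambda>p. c * f p) \<in> holder_strip k \<beta> \<and>
     holder_strip_norm k \<beta> (\<lambda>p. c * f p) \<le> \<bar>c\<bar> * holder_strip_norm k \<beta> f"
proof (induction k arbitrary: f)
  case 0
  then show ?case using holder0_scale holder0_norm_scale_le two_points_strip by auto
next
  case (Suc k)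
  have dx: "((\<lambda>y. c * f (y, s)) has_real_derivative (c * dx f (x, s))) (at x)"
    if "s \<in> {0..1}" for x s
    using that Suc.prems by (intro DERIV_cmult holder_strip_has_dx) auto
  have ds: "((\<lambda>r. c * f (x, r)) has_real_derivative (c * ds f (x, s)))
      (at s within {0..1})" if "s \<in> {0..1}" for x s
    using that Suc.prems by (intro DERIV_cmult holder_strip_has_ds) auto
  have 1: "(dx (\<lambda>p. c * f p) \<in> holder_strip k \<beta> \<longleftrightarrow> (\<lambda>p. c * dx f p) \<in> holder_strip k \<beta>) \<and>
     holder_strip_norm k \<beta> (dx (\<lambda>p. c * f p)) = holder_strip_norm k \<beta> (\<lambda>p. c * dx f p)"
    using dx_eqI[OF dx] by (intro holder_strip_cong) auto
  have 2: "(ds (\<lambda>p. c * f p) \<in> holder_strip k \<beta> \<longleftrightarrow> (\<lambda>p. c * ds f p) \<in> holder_strip k \<beta>) \<and>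
     holder_strip_norm k \<beta> (ds (\<lambda>p. c * f p)) = holder_strip_norm k \<beta> (\<lambda>p. c * ds f p)"
    using ds_eqI[OF _ ds] by (intro holder_strip_cong) auto
  have m: "dx f \<in> holder_strip k \<beta>" "ds f \<in> holder_strip k \<beta>" "bounded (f ` strip)"
    using Suc.prems by auto
  have d: "(\<lambda>y. c * f (y, s)) differentiable (at x)"
    "(\<lambda>r. c * f (x, r)) differentiable (at s within {0..1})" if "s \<in> {0..1}" for x s
    using dx[OF that] ds[OF that] unfolding real_differentiable_def by blast+
  have "sup_norm strip (\<lambda>p. c * f p) \<le> \<bar>c\<bar> * sup_norm strip f"
    using m(3) two_points_strip by (intro sup_norm_scale_le) (auto simp: two_points_def)
  moreover have "\<forall>(x, s)\<in>strip. (\<lambda>y. c * f (y, s)) differentiable (at x) \<and>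
      (\<lambda>r. c * f (x, r)) differentiable (at s within {0..1})"
    by (clarify, unfold mem_strip) (use d in blast)
  ultimately show ?case
    using 1 2 Suc.IH[OF m(1)] Suc.IH[OF m(2)] bounded_scale[OF m(3), of c]
    by (simp add: distrib_left)
qed

text \<open>
  The spaces prescribe derivatives along the two coordinate directions separately.  These derivatives
  are bounded, so the function is Lipschitz and hence jointly continuous, which is what the exchange
  of the order of integration in Green's identity needs.
\<close>

lemma holder_strip_continuous:
  assumes "f \<in> holder_strip k \<beta>" "0 < \<beta>"
  shows "continuous_on strip f"
proof (cases k)
  case 0
  then show ?thesis using assms holder0_continuous by auto
next
  case (Suc m)
  have f: "f \<in> holder_strip (Suc m) \<beta>" using assms Suc by simp
  define N where "N = max (holder_strip_norm m \<beta> (dx f)) (holder_strip_norm m \<beta> (ds f))"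
  have dx: "\<bar>dx f p\<bar> \<le> N" and ds: "\<bar>ds f p\<bar> \<le> N" if "p \<in> strip" for p
    using f that holder_strip_norm_ge[of "dx f" m \<beta> p] holder_strip_norm_ge[of "ds f" m \<beta> p]
    by (auto simp: N_def)
  have "f \<in> holder0 strip (1/2)"
  proof (rule holder0_lipschitz)
    have "bounded (f ` strip)" using f by simp
    then show "\<bar>f p\<bar> \<le> sup_norm strip f" if "p \<in> strip" for p using that by (rule sup_norm_ge)
    fix p q assume pq: "p \<in> strip" "q \<in> strip"
    obtain x s y r where p: "p = (x, s)" and q: "q = (y, r)" by (cases p, cases q)
    have sr: "s \<in> {0..1}" "r \<in> {0..1}" using pq p q by auto
    have "norm (f (x, s) - f (y, s)) \<le> N * norm (x - y)"
      by (rule field_differentiable_bound[of UNIV "\<lambda>x. f (x, s)" "\<lambda>x. dx f (x, s)"])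
        (use sr dx holder_strip_has_dx[OF f] in auto)
    moreover have "norm (f (y, s) - f (y, r)) \<le> N * norm (s - r)"
      by (rule field_differentiable_bound[of "{0..1}" "\<lambda>s. f (y, s)" "\<lambda>s. ds f (y, s)"])
        (use sr ds holder_strip_has_ds[OF f] in auto)
    moreover have "norm (x - y) \<le> dist p q" "norm (s - r) \<le> dist p q"
      using dist_fst_le[of p q] dist_snd_le[of p q] p q by (auto simp: dist_norm)
    moreover have "0 \<le> N" using dx[OF pq(1)] by linarith
    ultimately have "norm (f (x, s) - f (y, s)) \<le> N * dist p q"
      "norm (f (y, s) - f (y, r)) \<le> N * dist p q"
      by (meson mult_left_mono order_trans)+
    then show "\<bar>f p - f q\<bar> \<le> (2 * N) * dist p q"
      using p q by (simp add: abs_if split: if_splits)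
  qed auto
  then show ?thesis by (rule holder0_continuous) simp
qed

text \<open>
  Products of a function of \<open>x\<close> and a function of \<open>s\<close>; the sequences list the successive derivatives
  of the factors, so that the induction can pass to any mixed partial derivative.
\<close>

lemma holder_strip_product:
  fixes a b :: "nat \<Rightarrow> real \<Rightarrow> real"
  assumes \<beta>: "0 < \<beta>" "\<beta> < 1"
    and a: "\<And>i x. (a i has_real_derivative a (Suc i) x) (at x)"
    and b: "\<And>i s. (b i has_real_derivative b (Suc i) s) (at s)"
    and A: "\<And>i x. \<bar>a i x\<bar> \<le> A i"
    and f: "\<And>x s. s \<in> {0..1} \<Longrightarrow> f (x, s) = a i x * b j s"
  shows "f \<in> holder_strip k \<beta>"
  using f
proof (induction k arbitrary: i j f)
  case 0
  have "\<exists>K. \<forall>s\<in>{0..1}. \<bar>b j s\<bar> \<le> K" for j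
  proof -
    have "continuous_on {0..1} (b j)" using b
      by (intro DERIV_continuous_on[where D = "b (Suc j)"]) (rule has_field_derivative_at_within)
    then have "bounded (b j ` {0..1})" by (intro compact_imp_bounded compact_continuous_image) auto
    then show ?thesis by (auto simp: bounded_iff)
  qed
  then obtain K where K: "\<And>j s. s \<in> {0..1} \<Longrightarrow> \<bar>b j s\<bar> \<le> K j" by metis
  have A0: "0 \<le> A i" for i using A[of i 0] by linarith
  have K0: "0 \<le> K j" for j using K[of 0 j] by fastforce
  have "f \<in> holder0 strip \<beta>"
  proof (rule holder0_lipschitz[OF \<beta>])
    show "\<bar>f p\<bar> \<le> A i * K j" if "p \<in> strip" for p
      using that 0 A[of i "fst p"] K[of "snd p" j] A0
      by (cases p) (auto simp: abs_mult intro!: mult_mono)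
    fix p q assume pq: "p \<in> strip" "q \<in> strip"
    obtain x s y r where p: "p = (x, s)" and q: "q = (y, r)" by (cases p, cases q)
    have sr: "s \<in> {0..1}" "r \<in> {0..1}" using pq p q by auto
    have 1: "norm (a i x - a i y) \<le> A (Suc i) * norm (x - y)"
      by (rule field_differentiable_bound[of UNIV "a i" "a (Suc i)"]) (use a A in auto)
    have 2: "norm (b j s - b j r) \<le> K (Suc j) * norm (s - r)"
      by (rule field_differentiable_bound[of "{0..1}" "b j" "b (Suc j)"])
        (use sr K b in \<open>auto intro: has_field_derivative_at_within\<close>)
    have d: "norm (x - y) \<le> dist p q" "norm (s - r) \<le> dist p q"
      using dist_fst_le[of p q] dist_snd_le[of p q] p q by (auto simp: dist_norm)
    have 3: "\<bar>a i x - a i y\<bar> \<le> A (Suc i) * dist p q" "\<bar>b j s - b j r\<bar> \<le> K (Suc j) * dist p q"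
      using 1 2 d A0[of "Suc i"] K0[of "Suc j"]
      by (smt (verit) mult_left_mono real_norm_def)+
    have "f p - f q = (a i x - a i y) * b j s + a i y * (b j s - b j r)"
      using 0 p q sr by (simp add: algebra_simps)
    then have "\<bar>f p - f q\<bar> \<le> \<bar>a i x - a i y\<bar> * \<bar>b j s\<bar> + \<bar>a i y\<bar> * \<bar>b j s - b j r\<bar>"
      by (metis abs_mult abs_triangle_ineq)
    also have "\<dots> \<le> (A (Suc i) * dist p q) * K j + A i * (K (Suc j) * dist p q)"
      using 3 A0 K0 sr by (intro add_mono mult_mono A K) auto
    finally show "\<bar>f p - f q\<bar> \<le> (A (Suc i) * K j + A i * K (Suc j)) * dist p q"
      by (simp add: algebra_simps)
  qed
  then show ?case by simp
next
  case (Suc k)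
  have dx: "((\<lambda>y. f (y, s)) has_real_derivative (a (Suc i) x * b j s)) (at x)"
    if "s \<in> {0..1}" for x s
  proof -
    have "(\<lambda>y. f (y, s)) = (\<lambda>y. a i y * b j s)" using that Suc.prems by auto
    then show ?thesis using DERIV_cmult_right[OF a[of i x], of "b j s"] by simp
  qed
  have ds: "((\<lambda>r. f (x, r)) has_real_derivative (a i x * b (Suc j) s)) (at s within {0..1})"
    if "s \<in> {0..1}" for x s
  proof -
    have "((\<lambda>r. a i x * b j r) has_real_derivative (a i x * b (Suc j) s)) (at s within {0..1})"
      by (rule DERIV_cmult, rule has_field_derivative_at_within, rule b)
    then show ?thesis
      by (rule has_field_derivative_transform_within[OF _ zero_less_one that]) (use Suc.prems in auto)
  qed
  have d: "(\<lambda>y. f (y, s)) differentiable (at x)"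
    "(\<lambda>r. f (x, r)) differentiable (at s within {0..1})" if "s \<in> {0..1}" for x s
    using dx[OF that] ds[OF that] unfolding real_differentiable_def by blast+
  have "bounded (f ` strip)" by (rule holder_strip_bounded, rule Suc.IH, rule Suc.prems)
  moreover have "dx f \<in> holder_strip k \<beta>"
    by (rule Suc.IH[of _ "Suc i" j], rule dx_eqI, rule dx)
  moreover have "ds f \<in> holder_strip k \<beta>"
    by (rule Suc.IH[of _ i "Suc j"], rule ds_eqI, assumption, rule ds)
  ultimately show ?case using d by auto
qed

lemma C_line_diff: "f \<in> C_line k \<kappa> \<beta> \<Longrightarrow> g \<in> C_line k \<kappa> \<beta> \<Longrightarrow> f - g \<in> C_line k \<kappa> \<beta>"
  using holder_line_diff[of f k \<beta> g] by (auto simp: C_line_def fun_diff_def)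

lemma on_strip_eq_iff: "on_strip f = f \<longleftrightarrow> (\<forall>p. p \<notin> strip \<longrightarrow> f p = 0)"
  by (auto simp: on_strip_def fun_eq_iff)

lemma C_strip_diff: "f \<in> C_strip k \<kappa> \<beta> \<Longrightarrow> g \<in> C_strip k \<kappa> \<beta> \<Longrightarrow> f - g \<in> C_strip k \<kappa> \<beta>"
  using holder_strip_diff[of f k \<beta> g]
  by (auto simp: C_strip_def fun_diff_def on_strip_eq_iff)

lemma X_diff: "u \<in> X \<kappa> \<beta> \<Longrightarrow> v \<in> X \<kappa> \<beta> \<Longrightarrow> u - v \<in> X \<kappa> \<beta>"
  using C_line_diff C_strip_diff by (auto simp: X_def fun_diff_def mem_Times_iff)

lemma Y_diff: "u \<in> Y \<kappa> \<beta> \<Longrightarrow> v \<in> Y \<kappa> \<beta> \<Longrightarrow> u - v \<in> Y \<kappa> \<beta>"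
  using C_line_diff C_strip_diff by (auto simp: Y_def mem_Times_iff)

lemma X_scale:
  assumes "u \<in> X \<kappa> \<beta>"
  shows "c *\<^sub>R u \<in> X \<kappa> \<beta>" "X_norm \<beta> (c *\<^sub>R u) \<le> \<bar>c\<bar> * X_norm \<beta> u"
proof -
  have e: "c *\<^sub>R u = (\<lambda>x. c * fst u x, \<lambda>p. c * snd u p)"
    by (cases u) (auto simp: scaleR_fun_def)
  have m: "fst u \<in> holder_line 2 \<beta>" "snd u \<in> holder_strip 2 \<beta>"
    using assms by (auto simp: X_def C_line_def C_strip_def mem_Times_iff)
  show "c *\<^sub>R u \<in> X \<kappa> \<beta>"
    unfolding e using assms holder_line_scale[OF m(1), of c] holder_strip_scale[OF m(2), of c]
    by (auto simp: X_def C_line_def C_strip_def mem_Times_iff on_strip_eq_iff)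
  show "X_norm \<beta> (c *\<^sub>R u) \<le> \<bar>c\<bar> * X_norm \<beta> u"
    unfolding e X_norm_def using holder_line_scale[OF m(1), of c] holder_strip_scale[OF m(2), of c]
    by (simp add: distrib_left)
qed

text \<open>
  Applied to \<open>w(t) - t w\<^sup>*\<close>, this gives uniform control of the elevation, of its slope and of the vertical
  derivative of the stream function.
\<close>

lemma X_norm_ge:
  assumes "u \<in> X \<kappa> \<beta>"
  shows "\<bar>fst u x\<bar> \<le> X_norm \<beta> u" "\<bar>deriv (fst u) x\<bar> \<le> X_norm \<beta> u"
    "s \<in> {0..1} \<Longrightarrow> \<bar>ds (snd u) (x, s)\<bar> \<le> X_norm \<beta> u"
proof -
  have m: "fst u \<in> holder_line (Suc 1) \<beta>" "snd u \<in> holder_strip (Suc 1) \<beta>"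
    using assms by (auto simp: X_def C_line_def C_strip_def mem_Times_iff numeral_2_eq_2)
  have n: "X_norm \<beta> u = holder_line_norm (Suc 1) \<beta> (fst u) + holder_strip_norm (Suc 1) \<beta> (snd u)"
    by (simp add: X_norm_def numeral_2_eq_2)
  have l: "0 \<le> holder_line_norm (Suc 1) \<beta> (fst u)"
    using holder_line_norm_ge[OF m(1), of 0] by linarith
  have s: "0 \<le> holder_strip_norm (Suc 1) \<beta> (snd u)"
    using holder_strip_norm_ge[OF m(2), of "(0,0)"] by simp
  show "\<bar>fst u x\<bar> \<le> X_norm \<beta> u" using holder_line_norm_ge[OF m(1), of x] s unfolding n by linarith
  show "\<bar>deriv (fst u) x\<bar> \<le> X_norm \<beta> u"
    using holder_line_norm_deriv_ge[OF m(1), of x] s unfolding n by linarith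
  show "\<bar>ds (snd u) (x, s)\<bar> \<le> X_norm \<beta> u" if "s \<in> {0..1}"
    using holder_strip_norm_ds_ge[OF m(2), of "(x, s)"] l that unfolding n by simp
qed

lemma Y_norm_ge:
  assumes "u \<in> Y \<kappa> \<beta>"
  shows "\<bar>fst u x\<bar> \<le> Y_norm \<beta> u" "p \<in> strip \<Longrightarrow> \<bar>snd u p\<bar> \<le> Y_norm \<beta> u"
proof -
  have m: "fst u \<in> holder_line 1 \<beta>" "snd u \<in> holder_strip 0 \<beta>"
    using assms by (auto simp: Y_def C_line_def C_strip_def mem_Times_iff)
  have l: "0 \<le> holder_line_norm 1 \<beta> (fst u)"
    using holder_line_norm_ge[OF m(1), of 0] by linarith
  have s: "0 \<le> holder_strip_norm 0 \<beta> (snd u)"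
    using holder_strip_norm_ge[OF m(2), of "(0,0)"] by simp
  show "\<bar>fst u x\<bar> \<le> Y_norm \<beta> u"
    using holder_line_norm_ge[OF m(1), of x] s unfolding Y_norm_def by linarith
  show "\<bar>snd u p\<bar> \<le> Y_norm \<beta> u" if "p \<in> strip"
    using holder_strip_norm_ge[OF m(2) that] l that unfolding Y_norm_def by linarith
qed

section \<open>The second derivative along a direction\<close>

text \<open>
  If a twice differentiable function vanishes at 0 and its quotient by \<open>t\<^sup>2\<close> has a limit, then its first
  derivative vanishes at 0 and l'Hopital's rule identifies the limit as half of the second derivative.
  This replaces explicit second derivatives by limits of explicit quotients, both for the map \<open>F\<close> along
  the kernel and for the bifurcation parameter.
\<close>

lemma second_order_limit:
  fixes g g1 :: "real \<Rightarrow> real"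
  assumes g0: "g 0 = 0"
    and ev: "eventually (\<lambda>t. (g has_real_derivative g1 t) (at t)) (nhds 0)"
    and D: "(g1 has_real_derivative D) (at 0)"
    and L: "((\<lambda>t. g t / t\<^sup>2) \<longlongrightarrow> L) (at 0)"
  shows "D = 2 * L"
proof -
  have dg: "(g has_real_derivative g1 0) (at 0)" using ev by (rule eventually_nhds_x_imp_x)
  then have "((\<lambda>t. g t / t) \<longlongrightarrow> g1 0) (at 0)" by (simp add: DERIV_def g0)
  moreover have "((\<lambda>t. t * (g t / t\<^sup>2)) \<longlongrightarrow> 0) (at 0)"
    using tendsto_mult[OF tendsto_ident_at L] by simp
  then have "((\<lambda>t. g t / t) \<longlongrightarrow> 0) (at 0)"
    by (rule Lim_transform_eventually) (auto simp: eventually_at_filter power2_eq_square)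
  ultimately have g10: "g1 0 = 0" by (intro tendsto_unique[of "at (0::real)"]) auto
  have "((\<lambda>t. g1 t / t) \<longlongrightarrow> D) (at 0)" using D by (simp add: DERIV_def g10)
  then have q: "((\<lambda>t. g1 t / (2 * t)) \<longlongrightarrow> D / 2) (at 0)"
    using tendsto_divide[OF _ tendsto_const, of "\<lambda>t. g1 t / t" D "at 0" 2] by (simp add: mult.commute)
  have "((\<lambda>t. g t / t\<^sup>2) \<longlongrightarrow> D / 2) (at 0)"
  proof (rule lhopital[where f' = g1 and g' = "\<lambda>t. 2 * t"])
    show "(g \<longlongrightarrow> 0) (at 0)" using DERIV_isCont[OF dg] by (simp add: isCont_def g0)
    show "((\<lambda>t::real. t\<^sup>2) \<longlongrightarrow> 0) (at 0)" by (auto intro!: tendsto_eq_intros)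
    show "eventually (\<lambda>t. (g has_real_derivative g1 t) (at t)) (at 0)"
      using ev by (auto simp: eventually_at_filter elim: eventually_mono)
    show "eventually (\<lambda>t. ((\<lambda>t. t\<^sup>2) has_real_derivative 2 * t) (at t)) (at (0::real))"
      by (intro always_eventually allI) (auto intro!: derivative_eq_intros)
  qed (use q in \<open>auto simp: eventually_at_filter\<close>)
  then have "D / 2 = L" using L by (intro tendsto_unique[of "at (0::real)"]) auto
  then show ?thesis by simp
qed

text \<open>
  A bounded functional, here a point evaluation, turns the map along a ray into a real function whose
  first two derivatives are the values of the Frechet derivatives on the direction.
\<close>

lemma second_frechet_derivative_functional:
  fixes V :: "'a::real_vector set" and W :: "'b::real_vector set" and E :: "'b \<Rightarrow> real"
  assumes B: "second_frechet_derivative_in V nV W nW f 0 B"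
    and k: "\<And>c. c *\<^sub>R k \<in> V" "\<And>c. nV (c *\<^sub>R k) \<le> \<bar>c\<bar> * nV k" "0 \<le> nV k"
    and W: "\<And>u v. u \<in> W \<Longrightarrow> v \<in> W \<Longrightarrow> u - v \<in> W"
    and E: "\<And>u v. E (u - v) = E u - E v" "\<And>c u. E (c *\<^sub>R u) = c * E u"
      "\<And>u. u \<in> W \<Longrightarrow> \<bar>E u\<bar> \<le> nW u"
    and f0: "E (f 0) = 0"
    and L: "((\<lambda>t. E (f (t *\<^sub>R k)) / t\<^sup>2) \<longlongrightarrow> L) (at 0)"
  shows "E (B k k) = 2 * L"
proof -
  have kV: "k \<in> V" using k(1)[of 1] by simp
  \<comment> \<open>The summand 1 keeps the bound positive, so that it can be divided by.\<close>
  define N where "N = nV k + 1"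
  have N: "0 < N" "nV (c *\<^sub>R k) \<le> \<bar>c\<bar> * N" for c
    using k(2)[of c] k(3) by (auto simp: N_def algebra_simps)
  obtain Df r where r: "0 < r"
    and Df: "\<forall>v\<in>V. nV (v - 0) < r \<longrightarrow> frechet_derivative_in V nV W nW f v (Df v)"
    and DDf: "\<forall>e>0. \<exists>d>0. \<forall>h\<in>V. nV h < d \<longrightarrow>
           (\<forall>k\<in>V. nW (Df (0 + h) k - Df 0 k - B h k) \<le> e * nV h * nV k)"
    using B unfolding second_frechet_derivative_in_def by blast
  have small: "nV (c *\<^sub>R k) < d" if "\<bar>c\<bar> < d / N" for c d
  proof -
    have "\<bar>c\<bar> * N < d" using that N(1) by (simp add: less_divide_eq)
    then show ?thesis using N(2)[of c] by linarith
  qed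
  have FD: "frechet_derivative_in V nV W nW f (t *\<^sub>R k) (Df (t *\<^sub>R k))" if "\<bar>t\<bar> < r / N" for t
    using Df k(1) small[OF that] by simp
  have DfW: "Df (t *\<^sub>R k) k \<in> W" if "\<bar>t\<bar> < r / N" for t
    using FD[OF that] kV by (auto simp: frechet_derivative_in_def bounded_linear_in_def)
  define g where "g t = E (f (t *\<^sub>R k))" for t
  define g1 where "g1 t = E (Df (t *\<^sub>R k) k)" for t
  have g: "(g has_real_derivative g1 t) (at t)" if t: "\<bar>t\<bar> < r / N" for t
    unfolding DERIV_def LIM_eq
  proof (intro allI impI)
    fix e :: real assume e: "0 < e"
    then have "0 < e / (2 * N)" using N(1) by simp
    then obtain d where d: "0 < d" and est: "\<And>h. h \<in> V \<Longrightarrow> nV h < d \<Longrightarrow>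
        f (t *\<^sub>R k + h) - f (t *\<^sub>R k) - Df (t *\<^sub>R k) h \<in> W \<and>
        nW (f (t *\<^sub>R k + h) - f (t *\<^sub>R k) - Df (t *\<^sub>R k) h) \<le> e / (2 * N) * nV h"
      using FD[OF t] unfolding frechet_derivative_in_def by metis
    have "norm ((g (t + \<tau>) - g t) / \<tau> - g1 t) < e" if \<tau>: "\<tau> \<noteq> 0" "norm (\<tau> - 0) < d / N" for \<tau>
    proof -
      define R where "R = f (t *\<^sub>R k + \<tau> *\<^sub>R k) - f (t *\<^sub>R k) - Df (t *\<^sub>R k) (\<tau> *\<^sub>R k)"
      have lin: "Df (t *\<^sub>R k) (\<tau> *\<^sub>R k) = \<tau> *\<^sub>R Df (t *\<^sub>R k) k"
        using FD[OF t] kV by (auto simp: frechet_derivative_in_def bounded_linear_in_def)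
      have "R \<in> W" "nW R \<le> e / (2 * N) * nV (\<tau> *\<^sub>R k)"
        using est[OF k(1) small, of \<tau>] \<tau>(2) unfolding R_def by auto
      then have "\<bar>E R\<bar> \<le> e / (2 * N) * nV (\<tau> *\<^sub>R k)" using E(3) by force
      also have "\<dots> \<le> e / (2 * N) * (\<bar>\<tau>\<bar> * N)"
        using e N by (intro mult_left_mono) auto
      also have "\<dots> = e / 2 * \<bar>\<tau>\<bar>" using N(1) by simp
      finally have 1: "\<bar>E R\<bar> \<le> e / 2 * \<bar>\<tau>\<bar>" .
      have "E R = g (t + \<tau>) - g t - \<tau> * g1 t"
        unfolding R_def lin g_def g1_def by (simp add: E scaleR_add_left)
      then have "(g (t + \<tau>) - g t) / \<tau> - g1 t = E R / \<tau>" using \<tau>(1) by (simp add: field_simps)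
      then have "norm ((g (t + \<tau>) - g t) / \<tau> - g1 t) = \<bar>E R\<bar> / \<bar>\<tau>\<bar>" by simp
      also have "\<dots> \<le> e / 2" using 1 \<tau>(1) by (simp add: divide_le_eq)
      finally show ?thesis using e by linarith
    qed
    then show "\<exists>s>0. \<forall>x. x \<noteq> 0 \<and> norm (x - 0) < s \<longrightarrow> norm ((g (t + x) - g t) / x - g1 t) < e"
      using d N(1) by (intro exI[of _ "d / N"]) auto
  qed
  have g1: "(g1 has_real_derivative E (B k k)) (at 0)"
    unfolding DERIV_def LIM_eq
  proof (intro allI impI)
    fix e :: real assume e: "0 < e"
    then have "0 < e / (2 * N * N)" using N(1) by simp
    with DDf obtain d where d: "0 < d" and est: "\<And>h. h \<in> V \<Longrightarrow> nV h < d \<Longrightarrow>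
        nW (Df (0 + h) k - Df 0 k - B h k) \<le> e / (2 * N * N) * nV h * nV k"
      using kV by metis
    have "norm ((g1 (0 + \<tau>) - g1 0) / \<tau> - E (B k k)) < e"
      if \<tau>: "\<tau> \<noteq> 0" "norm (\<tau> - 0) < min (d / N) (r / N)" for \<tau>
    proof -
      define R where "R = Df (\<tau> *\<^sub>R k) k - Df 0 k - B (\<tau> *\<^sub>R k) k"
      have lin: "B (\<tau> *\<^sub>R k) k = \<tau> *\<^sub>R B k k"
        using B kV by (auto simp: second_frechet_derivative_in_def bounded_linear_in_def)
      have "B (\<tau> *\<^sub>R k) k \<in> W"
        using B kV k(1)[of \<tau>]
        unfolding second_frechet_derivative_in_def bounded_linear_in_def by blast
      moreover have "Df 0 k \<in> W" using DfW[of 0] r N(1) by simp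
      ultimately have "R \<in> W" unfolding R_def using DfW[of \<tau>] \<tau> by (intro W) auto
      have "nW R \<le> e / (2 * N * N) * nV (\<tau> *\<^sub>R k) * nV k"
        using est[OF k(1) small, of \<tau>] \<tau>(2) unfolding R_def by auto
      with \<open>R \<in> W\<close> have "\<bar>E R\<bar> \<le> e / (2 * N * N) * nV (\<tau> *\<^sub>R k) * nV k" using E(3) by force
      also have "\<dots> \<le> e / (2 * N * N) * (\<bar>\<tau>\<bar> * N) * nV k"
        using e N k(3) by (intro mult_left_mono mult_right_mono) auto
      also have "\<dots> \<le> e / (2 * N * N) * (\<bar>\<tau>\<bar> * N) * N"
        using e N by (intro mult_left_mono) (auto simp: N_def)
      also have "\<dots> = e / 2 * \<bar>\<tau>\<bar>" using N(1) by simp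
      finally have 1: "\<bar>E R\<bar> \<le> e / 2 * \<bar>\<tau>\<bar>" .
      have "E R = g1 \<tau> - g1 0 - \<tau> * E (B k k)"
        unfolding R_def lin g1_def by (simp add: E)
      then have "(g1 (0 + \<tau>) - g1 0) / \<tau> - E (B k k) = E R / \<tau>" using \<tau>(1) by (simp add: field_simps)
      then have "norm ((g1 (0 + \<tau>) - g1 0) / \<tau> - E (B k k)) = \<bar>E R\<bar> / \<bar>\<tau>\<bar>" by simp
      also have "\<dots> \<le> e / 2" using 1 \<tau>(1) by (simp add: divide_le_eq)
      finally show ?thesis using e by linarith
    qed
    then show "\<exists>s>0. \<forall>x. x \<noteq> 0 \<and> norm (x - 0) < s \<longrightarrow> norm ((g1 (0 + x) - g1 0) / x - E (B k k)) < e"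
      using d r N(1) by (intro exI[of _ "min (d / N) (r / N)"]) auto
  qed
  have "eventually (\<lambda>t. (g has_real_derivative g1 t) (at t)) (nhds 0)"
    unfolding eventually_nhds_metric using g r N(1)
    by (intro exI[of _ "r / N"]) (auto simp: dist_norm)
  from second_order_limit[OF _ this g1] show ?thesis using f0 L unfolding g_def by simp
qed


section \<open>The kernel element and the quadratic coefficients\<close>

lemma psi0_eq: "psi0 (1, -1, l) = (\<lambda>s. cos (s - 1 + l))"
  by (simp add: psi0_def fun_eq_iff)

lemma psi0_s_eq: "psi0_s (1, -1, l) = (\<lambda>s. - sin (s - 1 + l))"
  unfolding psi0_eq by (intro ext DERIV_imp_deriv) (auto intro!: derivative_eq_intros)

lemma psi0_ss_eq: "psi0_ss (1, -1, l) = (\<lambda>s. - cos (s - 1 + l))"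
  unfolding psi0_s_eq by (intro ext DERIV_imp_deriv) (auto intro!: derivative_eq_intros)

lemma sin_add_pi_half: "sin (z + pi / 2) = cos z" and cos_add_pi_half: "cos (z + pi / 2) = - sin z"
  for z :: real
  by (simp_all add: sin_add cos_add)

lemma psi0_s_crit: "psi0_s (1, -1, pi / 2) = (\<lambda>s. - cos (s - 1))"
  and psi0_ss_crit: "psi0_ss (1, -1, pi / 2) = (\<lambda>s. sin (s - 1))"
  using psi0_s_eq[of "pi / 2"] psi0_ss_eq[of "pi / 2"]
  by (simp_all only: sin_add_pi_half cos_add_pi_half minus_minus)

text \<open>
  The first term comes from the mode \<open>s cos x\<close>, the second is the correction by which the isomorphism
  restores the boundary value 0 at \<open>s = 1\<close>.
\<close>

definition profile :: "real \<Rightarrow> real" where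
  "profile s = s - s * cos (s - 1)"

lemma theta_1_1: "theta 1 (Suc 0) (-1) = 0"
  by (simp add: theta_def)

lemma w_star_eq:
  "w_star 1 1 (1, -1, pi / 2) = (cos, on_strip (\<lambda>(x, s). cos x * profile s))"
  unfolding w_star_def \<T>_def phi_mode_def sinh_theta_def
  by (auto simp: psi0_s_crit theta_1_1 Let_def on_strip_def fun_eq_iff profile_def algebra_simps)

text \<open>
  The derivatives of all orders in closed form: each differentiation of a cosine is a shift by a
  quarter period, and the Leibniz rule for the factor \<open>s\<close> contributes the second cosine.
\<close>

definition profile_deriv :: "nat \<Rightarrow> real \<Rightarrow> real" where
  "profile_deriv j s = (if j = 0 then s else if j = 1 then 1 else 0) -
     (s * cos (s - 1 + real j * (pi / 2)) + real j * cos (s - 1 + real j * (pi / 2) - pi / 2))"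

lemma profile_deriv_0: "profile_deriv 0 s = profile s"
  by (simp add: profile_deriv_def profile_def)

lemma has_derivative_profile_deriv:
  "(profile_deriv j has_real_derivative profile_deriv (Suc j) s) (at s)"
proof -
  define z where "z = s - 1 + real j * (pi / 2)"
  have lin: "((\<lambda>s. if j = 0 then s else if j = 1 then 1 else 0) has_real_derivative
      (if Suc j = 0 then s else if Suc j = 1 then 1 else 0)) (at s)"
    by (cases "j = 0") auto
  have "((\<lambda>s. s * cos (s - 1 + real j * (pi / 2)) + real j * cos (s - 1 + real j * (pi / 2) - pi / 2))
      has_real_derivative (cos z - s * sin z - real j * sin (z - pi / 2))) (at s)"
    unfolding z_def by (auto intro!: derivative_eq_intros)
  moreover have "cos z - s * sin z - real j * sin (z - pi / 2) =
     s * cos (s - 1 + real (Suc j) * (pi / 2)) +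
     real (Suc j) * cos (s - 1 + real (Suc j) * (pi / 2) - pi / 2)"
  proof -
    have "s - 1 + real (Suc j) * (pi / 2) = z + pi / 2" by (simp add: z_def algebra_simps)
    then show ?thesis by (simp add: cos_add_pi_half sin_diff algebra_simps)
  qed
  ultimately have "((\<lambda>s. s * cos (s - 1 + real j * (pi / 2)) +
        real j * cos (s - 1 + real j * (pi / 2) - pi / 2)) has_real_derivative
     (s * cos (s - 1 + real (Suc j) * (pi / 2)) +
      real (Suc j) * cos (s - 1 + real (Suc j) * (pi / 2) - pi / 2))) (at s)" by simp
  from DERIV_diff[OF lin this] show ?thesis unfolding profile_deriv_def .
qed

lemma w_star_in_X:
  assumes "0 < \<beta>" "\<beta> < 1"
  shows "w_star 1 1 (1, -1, pi / 2) \<in> X 1 \<beta>"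
proof -
  have "cos \<in> holder_line 2 \<beta>" using holder_line_cos[OF assms, of 0] by simp
  then have 1: "cos \<in> C_line 2 1 \<beta>" by (auto simp: C_line_def)
  have d: "((\<lambda>x. cos (x + real i * (pi / 2))) has_real_derivative
      cos (x + real (Suc i) * (pi / 2))) (at x)" for i x
  proof -
    have "x + real (Suc i) * (pi / 2) = (x + real i * (pi / 2)) + pi / 2" by (simp add: algebra_simps)
    then have e: "cos (x + real (Suc i) * (pi / 2)) = - sin (x + real i * (pi / 2))"
      by (simp only: cos_add_pi_half)
    show ?thesis unfolding e by (auto intro!: derivative_eq_intros)
  qed
  have "on_strip (\<lambda>(x, s). cos x * profile s) \<in> holder_strip 2 \<beta>"
  proof (rule holder_strip_product[OF assms])
    show "((\<lambda>x. cos (x + real i * (pi / 2))) has_real_derivative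
      cos (x + real (Suc i) * (pi / 2))) (at x)" for i x by (rule d)
    show "(profile_deriv i has_real_derivative profile_deriv (Suc i) s) (at s)" for i s
      by (rule has_derivative_profile_deriv)
    show "\<bar>cos (x + real i * (pi / 2))\<bar> \<le> 1" for i x by simp
    show "on_strip (\<lambda>(x, s). cos x * profile s) (x, s) = cos (x + real 0 * (pi / 2)) * profile_deriv 0 s"
      if "s \<in> {0..1}" for x s using that by (simp add: on_strip_def profile_deriv_0)
  qed
  then have "on_strip (\<lambda>(x, s). cos x * profile s) \<in> C_strip 2 1 \<beta>"
    by (auto simp: C_strip_def on_strip_def fun_eq_iff)
  moreover have "on_strip (\<lambda>(x, s). cos x * profile s) (x, 0) = 0 \<and>
      on_strip (\<lambda>(x, s). cos x * profile s) (x, 1) = 0" for x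
    by (simp add: on_strip_def profile_def)
  ultimately show ?thesis using 1 unfolding w_star_eq X_def by blast
qed

definition profile_s :: "real \<Rightarrow> real" where
  "profile_s s = 1 - cos (s - 1) + s * sin (s - 1)"

definition profile_ss :: "real \<Rightarrow> real" where
  "profile_ss s = 2 * sin (s - 1) + s * cos (s - 1)"

lemma has_derivative_profile: "(profile has_real_derivative profile_s s) (at s)"
  unfolding profile_def profile_s_def by (auto intro!: derivative_eq_intros)

lemma has_derivative_profile_s: "(profile_s has_real_derivative profile_ss s) (at s)"
  unfolding profile_s_def profile_ss_def by (auto intro!: derivative_eq_intros)

definition ray_profile :: "real \<Rightarrow> real \<times> real \<Rightarrow> real" where
  "ray_profile t = (\<lambda>p. t * on_strip (\<lambda>(x, s). cos x * profile s) p)"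

lemma ray_eq: "t *\<^sub>R w_star 1 1 (1, -1, pi / 2) = (\<lambda>x. t * cos x, ray_profile t)"
  unfolding w_star_eq ray_profile_def by (simp add: scaleR_fun_def)

lemma has_real_derivative_within_Icc_cong:
  assumes "s \<in> {0..1}" "(f has_real_derivative D) (at s)" "\<And>r. r \<in> {0..1} \<Longrightarrow> f r = g r"
  shows "(g has_real_derivative D) (at s within {0..1::real})"
  using has_field_derivative_transform_within
    [OF has_field_derivative_at_within[OF assms(2)] zero_less_one assms(1) assms(3)] by blast

lemma ds_ray_profile:
  "s \<in> {0..1} \<Longrightarrow> ds (ray_profile t) (x, s) = t * cos x * profile_s s"
  by (rule ds_eqI, assumption,
      rule has_real_derivative_within_Icc_cong[where f = "\<lambda>r. t * cos x * profile r"])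
    (auto simp: ray_profile_def on_strip_def intro!: derivative_eq_intros has_derivative_profile)

lemma ds_ds_ray_profile:
  "s \<in> {0..1} \<Longrightarrow> ds (ds (ray_profile t)) (x, s) = t * cos x * profile_ss s"
  by (rule ds_eqI, assumption,
      rule has_real_derivative_within_Icc_cong[where f = "\<lambda>r. t * cos x * profile_s r"])
    (auto simp: ds_ray_profile intro!: derivative_eq_intros has_derivative_profile_s)

lemma deriv_cos_scaled: "deriv (\<lambda>x. t * cos x) = (\<lambda>x. - t * sin x)"
  by (intro ext DERIV_imp_deriv) (auto intro!: derivative_eq_intros)

lemma one_plus_cos_pos: "\<bar>t\<bar> < 1 \<Longrightarrow> 0 < 1 + t * cos (x::real)"
proof -
  assume "\<bar>t\<bar> < 1"
  moreover have "\<bar>t * cos x\<bar> \<le> \<bar>t\<bar> * 1" unfolding abs_mult by (intro mult_left_mono) auto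
  ultimately show ?thesis by linarith
qed

text \<open>
  The denominator is kept as an atom \<open>h\<close>, so that clearing it leaves a polynomial identity.
\<close>

lemma F1_ray_algebra:
  fixes h t C S :: real
  assumes "h \<noteq> 0" "h = 1 + t * C"
  shows "(1 + (t * S)\<^sup>2) / (2 * h\<^sup>2) + t * C - 1 / 2 =
    t\<^sup>2 * ((S\<^sup>2 + 3 * C\<^sup>2 + 2 * t * C ^ 3) / (2 * h\<^sup>2))"
proof -
  have "(1 + (t * S)\<^sup>2) / (2 * h\<^sup>2) + t * C - 1 / 2 =
      ((1 + (t * S)\<^sup>2) + h\<^sup>2 * (2 * (t * C) - 1)) / (2 * h\<^sup>2)"
    using assms(1) by (simp add: field_simps)
  also have "(1 + (t * S)\<^sup>2) + h\<^sup>2 * (2 * (t * C) - 1) = t\<^sup>2 * (S\<^sup>2 + 3 * C\<^sup>2 + 2 * t * C ^ 3)"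
    unfolding assms(2) by algebra
  finally show ?thesis by simp
qed

lemma F2_ray_algebra:
  fixes h t C S :: real
  assumes "h \<noteq> 0" "h = 1 + t * C" "p2 = 2 * \<sigma> + s * c"
  shows "t * C * (s * (t * C * p1 - c) / h - p)
      + t * S * (s * (- t * S * p1) / h + s * (t * C * p1 - c) * (t * S) / h\<^sup>2)
      + s * (t * S) / h * (t * S * ((t * C * p1 - c) / h + s * (t * C * p2 + \<sigma>) / h - p1))
      + (\<sigma> + t * C * p2) / h\<^sup>2 + (t * C * p - \<sigma>) =
    t\<^sup>2 * ((- s * C\<^sup>2 * c + s * C\<^sup>2 * p1 * h + 2 * s * S\<^sup>2 * (t * C * p1 - c)
       - 2 * s * h * S\<^sup>2 * p1 + s\<^sup>2 * S\<^sup>2 * (\<sigma> + t * C * p2) - C\<^sup>2 * \<sigma>) / h\<^sup>2)"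
    (is "?L = t\<^sup>2 * (?N / h\<^sup>2)")
proof -
  have "?L * h\<^sup>2 = t * C * (s * (t * C * p1 - c) * h - p * h\<^sup>2)
      + t * S * (s * (- t * S * p1) * h + s * (t * C * p1 - c) * (t * S))
      + s * (t * S) * (t * S * ((t * C * p1 - c) + s * (t * C * p2 + \<sigma>) - p1 * h))
      + (\<sigma> + t * C * p2) + (t * C * p - \<sigma>) * h\<^sup>2"
    using assms(1) by (simp add: field_simps power2_eq_square)
  also have "\<dots> = t\<^sup>2 * ?N" unfolding assms(2,3) by algebra
  finally show ?thesis using assms(1) by (simp add: field_simps)
qed

text \<open>
  The kernel element annihilates the linearisation, so \<open>t\<^sup>2\<close> can be factored out.
\<close>

lemma F1_ray:
  assumes "\<bar>t\<bar> < 1"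
  shows "F1 (t *\<^sub>R w_star 1 1 (1, -1, pi / 2)) (1, -1, pi / 2) x =
    t\<^sup>2 * (((sin x)\<^sup>2 + 3 * (cos x)\<^sup>2 + 2 * t * cos x ^ 3) / (2 * (1 + t * cos x)\<^sup>2))"
proof -
  have "F1 (t *\<^sub>R w_star 1 1 (1, -1, pi / 2)) (1, -1, pi / 2) x =
     (1 + (t * sin x)\<^sup>2) / (2 * (1 + t * cos x)\<^sup>2) + t * cos x - 1 / 2"
    unfolding ray_eq F1_def
    by (simp add: ds_ray_profile deriv_cos_scaled psi0_s_crit profile_s_def Q_def)
  also have "\<dots> = t\<^sup>2 * (((sin x)\<^sup>2 + 3 * (cos x)\<^sup>2 + 2 * t * cos x ^ 3) / (2 * (1 + t * cos x)\<^sup>2))"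
    using one_plus_cos_pos[OF assms, of x] by (intro F1_ray_algebra) auto
  finally show ?thesis .
qed

text \<open>
  Again there is no term of first order in \<open>t\<close>: the profile \<open>p\<close> solves the linearised equation
  \<open>p'' + s \<psi>' + 2 \<psi> = 0\<close>, where \<open>\<psi>\<close> is the trivial flow.
\<close>

lemma F2_ray:
  assumes t: "\<bar>t\<bar> < 1" and s: "s \<in> {0..1}"
  shows "F2 (t *\<^sub>R w_star 1 1 (1, -1, pi / 2)) (1, -1, pi / 2) (x, s) =
    t\<^sup>2 * ((- s * (cos x)\<^sup>2 * cos (s - 1) + s * (cos x)\<^sup>2 * profile_s s * (1 + t * cos x)
       + 2 * s * (sin x)\<^sup>2 * (t * cos x * profile_s s - cos (s - 1))
       - 2 * s * (1 + t * cos x) * (sin x)\<^sup>2 * profile_s s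
       + s\<^sup>2 * (sin x)\<^sup>2 * (sin (s - 1) + t * cos x * profile_ss s)
       - (cos x)\<^sup>2 * sin (s - 1)) / (1 + t * cos x)\<^sup>2)"
proof -
  define u where "u = (\<lambda>(x, s). psi0 (1, -1, pi / 2) s + ray_profile t (x, s))"
  define G where "G x s = t * sin x * (s * (t * cos x * profile_s s - cos (s - 1)) / (1 + t * cos x)
      - profile s)" for x s
  have psi: "(psi0 (1, -1, pi / 2) has_real_derivative - cos (s - 1)) (at s)" for s
    unfolding psi0_eq by (auto simp: sin_add_pi_half intro!: derivative_eq_intros)
  have dsu: "ds u (x, s) = t * cos x * profile_s s - cos (s - 1)" if "s \<in> {0..1}" for x s
    by (rule ds_eqI[OF that], rule has_real_derivative_within_Icc_cong[OF that,
          where f = "\<lambda>r. psi0 (1, -1, pi / 2) r + t * cos x * profile r"])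
      (auto simp: u_def ray_profile_def on_strip_def
        intro!: derivative_eq_intros has_derivative_profile psi)
  have dxu: "dx u (x, s) = - t * sin x * profile s" if "s \<in> {0..1}" for x s
    using that by (intro dx_eqI) (auto simp: u_def ray_profile_def on_strip_def
        intro!: derivative_eq_intros)
  have flat: "flat_dx (\<lambda>x. t * cos x) u (x, s) = G x s" if "s \<in> {0..1}" for x s
    using that one_plus_cos_pos[OF t, of x] unfolding flat_dx_def G_def
    by (simp add: dsu dxu deriv_cos_scaled field_simps)
  define h where "h = 1 + t * cos x"
  have h: "h \<noteq> 0" using one_plus_cos_pos[OF t, of x] by (simp add: h_def)
  have dxG: "dx (flat_dx (\<lambda>x. t * cos x) u) (x, s) =
      t * cos x * (s * (t * cos x * profile_s s - cos (s - 1)) / h - profile s)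
      + t * sin x * (s * (- t * sin x * profile_s s) / h
          + s * (t * cos x * profile_s s - cos (s - 1)) * (t * sin x) / h\<^sup>2)"
  proof (rule dx_eqI)
    have "((\<lambda>y. G y s) has_real_derivative
      t * cos x * (s * (t * cos x * profile_s s - cos (s - 1)) / h - profile s)
      + t * sin x * (s * (- t * sin x * profile_s s) / h
          + s * (t * cos x * profile_s s - cos (s - 1)) * (t * sin x) / h\<^sup>2)) (at x)"
      unfolding G_def h_def using h[unfolded h_def]
      by (auto intro!: derivative_eq_intros)
        (unfold h_def[symmetric], use h in \<open>simp add: field_simps power2_eq_square\<close>)
    then show "((\<lambda>y. flat_dx (\<lambda>x. t * cos x) u (y, s)) has_real_derivative
      t * cos x * (s * (t * cos x * profile_s s - cos (s - 1)) / h - profile s)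
      + t * sin x * (s * (- t * sin x * profile_s s) / h
          + s * (t * cos x * profile_s s - cos (s - 1)) * (t * sin x) / h\<^sup>2)) (at x)"
      using flat[OF s] by simp
  qed
  have dsG: "ds (flat_dx (\<lambda>x. t * cos x) u) (x, s) =
      t * sin x * ((t * cos x * profile_s s - cos (s - 1)) / h
          + s * (t * cos x * profile_ss s + sin (s - 1)) / h - profile_s s)"
  proof (rule ds_eqI[OF s], rule has_real_derivative_within_Icc_cong[OF s])
    show "(G x has_real_derivative t * sin x * ((t * cos x * profile_s s - cos (s - 1)) / h
          + s * (t * cos x * profile_ss s + sin (s - 1)) / h - profile_s s)) (at s)"
      unfolding G_def h_def using h[unfolded h_def]
      by (auto intro!: derivative_eq_intros has_derivative_profile has_derivative_profile_s)
        (unfold h_def[symmetric], use h in \<open>simp add: field_simps\<close>)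
  qed (use flat in auto)
  define A where "A = flat_dx (\<lambda>x. t * cos x) (flat_dx (\<lambda>x. t * cos x) u) (x, s)"
  have F2: "F2 (t *\<^sub>R w_star 1 1 (1, -1, pi / 2)) (1, -1, pi / 2) (x, s) =
      A + (sin (s - 1) + t * cos x * profile_ss s) / h\<^sup>2 + u (x, s)"
    unfolding ray_eq F2_def Let_def A_def u_def h_def on_strip_def using s
    by (simp add: ds_ds_ray_profile psi0_ss_crit)
  have A: "A = dx (flat_dx (\<lambda>x. t * cos x) u) (x, s)
      + s * (t * sin x) / h * ds (flat_dx (\<lambda>x. t * cos x) u) (x, s)"
    unfolding A_def h_def flat_dx_def[of _ "flat_dx _ u"] by (simp add: deriv_cos_scaled)
  have u: "u (x, s) = t * cos x * profile s - sin (s - 1)"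
    using s by (simp add: u_def psi0_eq cos_add_pi_half ray_profile_def on_strip_def)
  show ?thesis unfolding F2 A u dxG dsG h_def[symmetric]
    by (rule F2_ray_algebra[OF h h_def]) (simp add: profile_ss_def)
qed

text \<open>
  At each point the value is twice the limit of \<open>F(t w\<^sup>*) / t\<^sup>2\<close>.
\<close>

lemma second_derivative_at_w_star:
  assumes \<beta>: "0 < \<beta>" "\<beta> < 1"
    and B: "second_frechet_derivative_in (X 1 \<beta>) (X_norm \<beta>) (Y 1 \<beta>) (Y_norm \<beta>)
      (\<lambda>w. F w (1, -1, pi / 2)) 0 B"
  defines "ws \<equiv> w_star 1 1 (1, -1, pi / 2)"
  shows "B ws ws = (\<lambda>x. 2 + cos (2 * x), on_strip (\<lambda>(x, s).
      (- s - sin (s - 1) - 2 * s * cos (s - 1)) +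
      (3 * s + 2 * s\<^sup>2 * sin (s - 1) - sin (s - 1) - 2 * s * cos (s - 1)) * cos (2 * x)))"
proof -
  have ws: "ws \<in> X 1 \<beta>" unfolding ws_def by (rule w_star_in_X[OF \<beta>])
  have k: "c *\<^sub>R ws \<in> X 1 \<beta>" "X_norm \<beta> (c *\<^sub>R ws) \<le> \<bar>c\<bar> * X_norm \<beta> ws" "0 \<le> X_norm \<beta> ws" for c
    using X_scale[OF ws] X_norm_ge(1)[OF ws, of 0] by auto
  have BY: "B ws ws \<in> Y 1 \<beta>"
    using B ws unfolding second_frechet_derivative_in_def bounded_linear_in_def by blast
  have near: "eventually (\<lambda>t. \<bar>t\<bar> < 1) (at (0::real))"
    by (auto simp: eventually_at intro!: exI[of _ 1])
  have F0: "F1 0 (1, -1, pi / 2) x = 0" "s \<in> {0..1} \<Longrightarrow> F2 0 (1, -1, pi / 2) (x, s) = 0" for x s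
    using F1_ray[of 0 x] F2_ray[of 0 s x] by auto
  have 1: "fst (B ws ws) x = 2 + cos (2 * x)" for x
  proof -
    define L where "L = ((sin x)\<^sup>2 + 3 * (cos x)\<^sup>2) / 2"
    have "((\<lambda>t. ((sin x)\<^sup>2 + 3 * (cos x)\<^sup>2 + 2 * t * cos x ^ 3) / (2 * (1 + t * cos x)\<^sup>2)) \<longlongrightarrow> L) (at 0)"
      unfolding L_def by (auto intro!: tendsto_eq_intros)
    then have L: "((\<lambda>t. fst (F (t *\<^sub>R ws) (1, -1, pi / 2)) x / t\<^sup>2) \<longlongrightarrow> L) (at 0)"
      by (rule Lim_transform_eventually)
        (use near in \<open>auto simp: eventually_at_filter F_def ws_def F1_ray
          simp del: One_nat_def elim!: eventually_mono\<close>)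
    have "fst (B ws ws) x = 2 * L"
      by (rule second_frechet_derivative_functional[OF B k, where E = "\<lambda>u. fst u x", OF _ _ _ _ _ L])
        (auto simp: F_def F0 Y_diff Y_norm_ge scaleR_fun_def)
    then show ?thesis by (simp add: L_def cos_double sin_squared_eq)
  qed
  have 2: "snd (B ws ws) (x, s) = (- s - sin (s - 1) - 2 * s * cos (s - 1)) +
      (3 * s + 2 * s\<^sup>2 * sin (s - 1) - sin (s - 1) - 2 * s * cos (s - 1)) * cos (2 * x)"
    if s: "s \<in> {0..1}" for x s
  proof -
    define N where "N t = (- s * (cos x)\<^sup>2 * cos (s - 1) + s * (cos x)\<^sup>2 * profile_s s * (1 + t * cos x)
       + 2 * s * (sin x)\<^sup>2 * (t * cos x * profile_s s - cos (s - 1))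
       - 2 * s * (1 + t * cos x) * (sin x)\<^sup>2 * profile_s s
       + s\<^sup>2 * (sin x)\<^sup>2 * (sin (s - 1) + t * cos x * profile_ss s)
       - (cos x)\<^sup>2 * sin (s - 1)) / (1 + t * cos x)\<^sup>2" for t
    have "isCont N 0" unfolding N_def by (auto intro!: continuous_intros)
    then have "(N \<longlongrightarrow> N 0) (at 0)" by (simp add: isCont_def)
    then have L: "((\<lambda>t. snd (F (t *\<^sub>R ws) (1, -1, pi / 2)) (x, s) / t\<^sup>2) \<longlongrightarrow> N 0) (at 0)"
      by (rule Lim_transform_eventually)
        (use near s in \<open>auto simp: eventually_at_filter F_def ws_def F2_ray N_def
          simp del: One_nat_def elim!: eventually_mono\<close>)
    have B2: "snd (B ws ws) (x, s) = 2 * N 0"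
      by (rule second_frechet_derivative_functional[OF B k, where E = "\<lambda>u. snd u (x, s)", OF _ _ _ _ _ L])
        (use s in \<open>auto simp: F_def F0 Y_diff Y_norm_ge scaleR_fun_def\<close>)
    have trig: "(sin x)\<^sup>2 = 1 - (cos x)\<^sup>2" "cos (2 * x) = 2 * (cos x)\<^sup>2 - 1"
      by (simp_all add: sin_squared_eq cos_double_cos)
    have N0: "N 0 = - s * (cos x)\<^sup>2 * cos (s - 1) + s * (cos x)\<^sup>2 * profile_s s
        - 2 * s * (sin x)\<^sup>2 * cos (s - 1) - 2 * s * (sin x)\<^sup>2 * profile_s s
        + s\<^sup>2 * (sin x)\<^sup>2 * sin (s - 1) - (cos x)\<^sup>2 * sin (s - 1)"
      by (simp add: N_def)
    show ?thesis unfolding B2 N0 trig profile_s_def by algebra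
  qed
  have "snd (B ws ws) \<in> C_strip 0 1 \<beta>" using BY unfolding Y_def by (simp add: mem_Times_iff)
  then have "on_strip (snd (B ws ws)) = snd (B ws ws)" unfolding C_strip_def by blast
  then have "snd (B ws ws) p = 0" if "p \<notin> strip" for p
    using that on_strip_eq_iff by blast
  then show ?thesis
    using 1 2 by (auto simp: prod_eq_iff fun_eq_iff on_strip_def)
qed

lemma on_strip_modes_unique:
  assumes "on_strip (\<lambda>(x, s). a s + b s * cos (2 * x)) = on_strip (\<lambda>(x, s). a' s + b' s * cos (2 * x))"
    and "s \<in> {0..1}"
  shows "a s = a' s \<and> b s = b' s"
proof -
  have "a s + b s = a' s + b' s" "a s - b s = a' s - b' s"
    using fun_cong[OF assms(1), of "(0, s)"] fun_cong[OF assms(1), of "(pi / 2, s)"] assms(2)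
    by (simp_all add: on_strip_def)
  then show ?thesis by linarith
qed

lemma quadratic_coeffs_iff:
  assumes \<beta>: "0 < \<beta>" "\<beta> < 1"
    and B: "second_frechet_derivative_in (X 1 \<beta>) (X_norm \<beta>) (Y 1 \<beta>) (Y_norm \<beta>)
      (\<lambda>w. F w (1, -1, pi / 2)) 0 B"
  shows "quadratic_coeffs 1 1 (1, -1, pi / 2) B c0 c2 b0 b2 \<longleftrightarrow> c0 = 2 \<and> c2 = 1 \<and>
    (\<forall>s\<in>{0..1}. b0 s = - s - sin (s - 1) - 2 * s * cos (s - 1) \<and>
       b2 s = 3 * s + 2 * s\<^sup>2 * sin (s - 1) - sin (s - 1) - 2 * s * cos (s - 1))"
    (is "?Q \<longleftrightarrow> ?R")
proof
  assume ?Q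
  then have e: "(\<lambda>x. c0 + c2 * cos (2 * x)) = (\<lambda>x. 2 + cos (2 * x))"
    "on_strip (\<lambda>(x, s). b0 s + b2 s * cos (2 * x)) = on_strip (\<lambda>(x, s).
      (- s - sin (s - 1) - 2 * s * cos (s - 1)) +
      (3 * s + 2 * s\<^sup>2 * sin (s - 1) - sin (s - 1) - 2 * s * cos (s - 1)) * cos (2 * x))"
    unfolding quadratic_coeffs_def second_derivative_at_w_star[OF assms] by auto
  have "c0 = 2 \<and> c2 = 1"
    using fun_cong[OF e(1), of 0] fun_cong[OF e(1), of "pi / 2"] by simp
  moreover have "b0 s = - s - sin (s - 1) - 2 * s * cos (s - 1) \<and>
       b2 s = 3 * s + 2 * s\<^sup>2 * sin (s - 1) - sin (s - 1) - 2 * s * cos (s - 1)" if "s \<in> {0..1}" for s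
    using on_strip_modes_unique[OF e(2) that] .
  ultimately show ?R by blast
next
  assume ?R
  then show ?Q unfolding quadratic_coeffs_def second_derivative_at_w_star[OF assms]
    by (auto simp: on_strip_def fun_eq_iff)
qed

section \<open>The boundary value problems for the second-order coefficients\<close>

text \<open>
  The Wronskian-like quantities \<open>d C - d' S\<close>, \<open>d' C - \<vartheta> d S\<close> and \<open>C\<^sup>2 - \<vartheta> S\<^sup>2\<close> are constant, and they can be solved
  for \<open>d\<close> and \<open>d'\<close>.  No division occurs, so zeros of \<open>C\<close> or \<open>S\<close> do no harm.
\<close>

lemma linear_ivp_solution:
  fixes d d' S C :: "real \<Rightarrow> real" and th :: real
  assumes d: "\<And>s. s \<in> {0..1} \<Longrightarrow> (d has_real_derivative d' s) (at s within {0..1})"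
    and d': "\<And>s. s \<in> {0..1} \<Longrightarrow> (d' has_real_derivative th * d s) (at s within {0..1})"
    and S: "\<And>s. (S has_real_derivative C s) (at s)" "\<And>s. (C has_real_derivative th * S s) (at s)"
    and init: "S 0 = 0" "C 0 = 1" "d 0 = 0"
    and s: "s \<in> {0..1}"
  shows "d s = d' 0 * S s \<and> d' s = d' 0 * C s"
proof -
  have const: "f s = f 0"
    if "\<And>s. s \<in> {0..1} \<Longrightarrow> (f has_real_derivative 0) (at s within {0..1})" for f :: "real \<Rightarrow> real"
    using has_field_derivative_zero_constant[of "{0..1}" f] that s by fastforce
  note S' = S[THEN has_field_derivative_at_within]
  have "((\<lambda>s. d s * C s - d' s * S s) has_real_derivative 0) (at s within {0..1})"
    "((\<lambda>s. d' s * C s - th * (d s * S s)) has_real_derivative 0) (at s within {0..1})"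
    "((\<lambda>s. C s * C s - th * (S s * S s)) has_real_derivative 0) (at s within {0..1})"
    if "s \<in> {0..1}" for s
    by (rule derivative_eq_intros refl d[OF that] d'[OF that] S' | simp add: algebra_simps)+
  from const[OF this(1)] const[OF this(2)] const[OF this(3)]
  have A: "d s * C s - d' s * S s = 0" and B: "d' s * C s - th * (d s * S s) = d' 0"
    and N: "C s * C s - th * (S s * S s) = 1"
    using init by auto
  show ?thesis using A B N by algebra
qed

text \<open>
  The difference of two solutions of the boundary value problem is a multiple of \<open>S\<close>, and the boundary
  condition at \<open>s = 1\<close> kills the multiple unless \<open>S 1 = C 1\<close>.  The latter equality is the resonance
  condition \<open>l(n, \<alpha>) = r(\<Lambda>)\<close> and characterises the critical mode 1.
\<close>

lemma is_a_solution_iff: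
  fixes f f' f'' S C :: "real \<Rightarrow> real"
  assumes th: "Re ((theta 1 (j * 1) (-1))\<^sup>2) = th"
    and f: "\<And>s. (f has_real_derivative f' s) (at s)" "\<And>s. (f' has_real_derivative f'' s) (at s)"
    and eq: "\<And>s. s \<in> {0..1} \<Longrightarrow> f'' s - th * f s = - b s"
    and bc: "f 0 = 0" "f 1 - f' 1 = - c"
    and S: "\<And>s. (S has_real_derivative C s) (at s)" "\<And>s. (C has_real_derivative th * S s) (at s)"
    and init: "S 0 = 0" "C 0 = 1"
    and nondegenerate: "S 1 \<noteq> C 1"
  shows "is_a_solution 1 1 (1, -1, pi / 2) j c b a \<longleftrightarrow> (\<forall>s\<in>{0..1}. a s = f s)"
proof
  assume "is_a_solution 1 1 (1, -1, pi / 2) j c b a"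
  then obtain a' a'' where A: "\<forall>s\<in>{0..1}. (a has_real_derivative a' s) (at s within {0..1}) \<and>
        (a' has_real_derivative a'' s) (at s within {0..1}) \<and> a'' s - th * a s = - b s"
    and a_bc: "a 0 = 0" "a 1 - a' 1 = - c"
    unfolding is_a_solution_def snd_conv fst_conv th psi0_ss_crit unfolding psi0_s_crit by auto
  have a: "(a has_real_derivative a' s) (at s within {0..1})"
    "(a' has_real_derivative a'' s) (at s within {0..1})" "a'' s - th * a s = - b s"
    if "s \<in> {0..1}" for s using A that by blast+
  note f' = f[THEN has_field_derivative_at_within]
  have d: "a s - f s = (a' 0 - f' 0) * S s \<and> a' s - f' s = (a' 0 - f' 0) * C s"
    if "s \<in> {0..1}" for s
  proof (rule linear_ivp_solution[where d = "\<lambda>s. a s - f s" and d' = "\<lambda>s. a' s - f' s"])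
    show "((\<lambda>s. a s - f s) has_real_derivative a' s - f' s) (at s within {0..1})"
      if "s \<in> {0..1}" for s using that by (intro DERIV_diff a f')
    show "((\<lambda>s. a' s - f' s) has_real_derivative th * (a s - f s)) (at s within {0..1})"
      if "s \<in> {0..1}" for s
    proof -
      have "a'' s - f'' s = th * (a s - f s)"
        using a(3)[OF that] eq[OF that] by (simp add: algebra_simps)
      then show ?thesis using DERIV_diff[OF a(2)[OF that] f'(2)[of s]] by simp
    qed
  qed (use S init a_bc bc that in auto)
  have "(a' 0 - f' 0) * (S 1 - C 1) = 0"
    using d[of 1] a_bc(2) bc(2) by (simp add: algebra_simps)
  then have z: "a' 0 - f' 0 = 0" using nondegenerate by simp
  have "a s - f s = 0" if "s \<in> {0..1}" for s
    using conjunct1[OF d[OF that]] unfolding z by (simp only: mult_zero_left)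
  then show "\<forall>s\<in>{0..1}. a s = f s" by simp
next
  assume a: "\<forall>s\<in>{0..1}. a s = f s"
  have "(a has_real_derivative f' s) (at s within {0..1})" if "s \<in> {0..1}" for s
    using has_real_derivative_within_Icc_cong[OF that f(1)] a by auto
  moreover have "(f' has_real_derivative f'' s) (at s within {0..1})" for s
    using f(2) by (rule has_field_derivative_at_within)
  ultimately show "is_a_solution 1 1 (1, -1, pi / 2) j c b a"
    unfolding is_a_solution_def snd_conv fst_conv th psi0_ss_crit unfolding psi0_s_crit
    using a eq bc by (intro exI[of _ f'] exI[of _ f'']) auto
qed

lemma cos_1_less_sin_1: "cos (1::real) < sin 1"
proof -
  have "sin (pi / 2 - 1) < sin (1::real)"
    using pi_gt3 pi_less_4 by (intro sin_monotone_2pi) auto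
  then show ?thesis by (simp add: sin_diff)
qed

lemma half_less_cos_1: "1 / 2 < cos (1::real)"
  using cos_monotone_0_pi[of 1 "pi / 3"] pi_gt3 by (simp add: cos_60)

lemma sinh_less_cosh: "sinh x < cosh (x::real)"
  using cosh_minus_sinh[of x] exp_gt_zero[of "- x"] by linarith

lemma sqrt_3_gt: "17 / 10 < sqrt (3::real)"
  by (rule real_less_rsqrt) (simp add: power2_eq_square)

lemma sinh_less_cosh_sqrt_3: "sinh (sqrt 3) < sqrt 3 * cosh (sqrt 3 :: real)"
proof -
  have "1 * cosh (sqrt 3) \<le> sqrt 3 * cosh (sqrt 3 :: real)"
    using sqrt_3_gt cosh_real_pos[of "sqrt 3"] by (intro mult_right_mono) auto
  then show ?thesis using sinh_less_cosh[of "sqrt 3"] by linarith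
qed

text \<open>The function \<open>sinh (\<theta> s) / \<theta>\<close> for the mode 2, where \<open>\<theta>\<^sup>2 = 3\<close>.\<close>

definition hyp :: "real \<Rightarrow> real" where
  "hyp s = sinh (sqrt 3 * s) / sqrt 3"

lemma has_derivative_hyp: "(hyp has_real_derivative cosh (sqrt 3 * s)) (at s)"
  unfolding hyp_def by (auto intro!: derivative_eq_intros)

lemma has_derivative_cosh_sqrt_3:
  "((\<lambda>s. cosh (sqrt 3 * s)) has_real_derivative 3 * hyp s) (at s)"
proof -
  have "sinh (sqrt 3 * s) * sqrt 3 = 3 * hyp s"
    unfolding hyp_def using real_sqrt_mult_self[of 3] by (simp add: field_simps)
  moreover have "((\<lambda>s. cosh (sqrt 3 * s)) has_real_derivative sinh (sqrt 3 * s) * sqrt 3) (at s)"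
    by (auto intro!: derivative_eq_intros)
  ultimately show ?thesis by simp
qed

lemma a0_iff:
  assumes "\<And>s. s \<in> {0..1} \<Longrightarrow> b s = - s - sin (s - 1) - 2 * s * cos (s - 1)"
  shows "is_a_solution 1 1 (1, -1, pi / 2) 0 2 b a \<longleftrightarrow>
    (\<forall>s\<in>{0..1}. a s = s + 1 / 2 * s\<^sup>2 * sin (s - 1) + 3 * sin s / (2 * (cos 1 - sin 1)))"
proof (rule is_a_solution_iff[where S = sin and C = cos and th = "-1"
      and f' = "\<lambda>s. 1 + s * sin (s - 1) + 1 / 2 * s\<^sup>2 * cos (s - 1) + 3 * cos s / (2 * (cos 1 - sin 1))"
      and f'' = "\<lambda>s. sin (s - 1) + 2 * s * cos (s - 1) - 1 / 2 * s\<^sup>2 * sin (s - 1)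
          - 3 * sin s / (2 * (cos 1 - sin 1))"])
  show "Re ((theta 1 (0 * 1) (-1))\<^sup>2) = -1" by (simp add: theta_def)
  define q :: real where "q = 2 * (cos 1 - sin 1)"
  have q: "q \<noteq> 0" using cos_1_less_sin_1 by (simp add: q_def)
  show "((\<lambda>s. s + 1 / 2 * s\<^sup>2 * sin (s - 1) + 3 * sin s / (2 * (cos 1 - sin 1))) has_real_derivative
      1 + s * sin (s - 1) + 1 / 2 * s\<^sup>2 * cos (s - 1) + 3 * cos s / (2 * (cos 1 - sin 1))) (at s)" for s
    unfolding q_def[symmetric] using q by (auto intro!: derivative_eq_intros simp: field_simps)
  show "((\<lambda>s. 1 + s * sin (s - 1) + 1 / 2 * s\<^sup>2 * cos (s - 1) + 3 * cos s / (2 * (cos 1 - sin 1)))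
      has_real_derivative sin (s - 1) + 2 * s * cos (s - 1) - 1 / 2 * s\<^sup>2 * sin (s - 1)
          - 3 * sin s / (2 * (cos 1 - sin 1))) (at s)" for s
    unfolding q_def[symmetric] using q by (auto intro!: derivative_eq_intros simp: field_simps)
  have n: "3 * sin 1 - 3 * cos 1 = - 3 / 2 * q" unfolding q_def by argo
  have "(3 * sin 1 - 3 * cos 1) / q = - 3 / 2" unfolding n using q by simp
  then have "3 * sin 1 / q - 3 * cos 1 / q = - 3 / 2" by (simp add: diff_divide_distrib)
  then show "1 + 1 / 2 * 1\<^sup>2 * sin (1 - 1) + 3 * sin 1 / (2 * (cos 1 - sin 1)) -
      (1 + 1 * sin (1 - 1) + 1 / 2 * 1\<^sup>2 * cos (1 - 1) + 3 * cos 1 / (2 * (cos 1 - sin 1))) = - (2::real)"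
    unfolding q_def[symmetric] by simp
qed (use assms cos_1_less_sin_1 in \<open>auto intro!: derivative_eq_intros\<close>)

lemma a2_iff:
  assumes "\<And>s. s \<in> {0..1} \<Longrightarrow>
    b s = 3 * s + 2 * s\<^sup>2 * sin (s - 1) - sin (s - 1) - 2 * s * cos (s - 1)"
  shows "is_a_solution 1 1 (1, -1, pi / 2) 2 1 b a \<longleftrightarrow>
    (\<forall>s\<in>{0..1}. a s = s + 1 / 2 * s\<^sup>2 * sin (s - 1)
       + sinh (sqrt 3 * s) / (2 * (sqrt 3 * cosh (sqrt 3) - sinh (sqrt 3))))"
proof -
  define q :: real where "q = 2 * (cosh (sqrt 3) - hyp 1)"
  have sq: "2 * (sqrt 3 * cosh (sqrt 3) - sinh (sqrt 3)) = sqrt 3 * q"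
    by (simp add: q_def hyp_def field_simps)
  have q: "q \<noteq> 0" using sq sinh_less_cosh_sqrt_3 by auto
  have e: "sinh (sqrt 3 * s) / (2 * (sqrt 3 * cosh (sqrt 3) - sinh (sqrt 3))) = hyp s / q" for s
    unfolding sq hyp_def by simp
  show ?thesis unfolding e
  proof (rule is_a_solution_iff[where S = hyp and C = "\<lambda>s. cosh (sqrt 3 * s)" and th = "3"
        and f' = "\<lambda>s. 1 + s * sin (s - 1) + 1 / 2 * s\<^sup>2 * cos (s - 1) + cosh (sqrt 3 * s) / q"
        and f'' = "\<lambda>s. sin (s - 1) + 2 * s * cos (s - 1) - 1 / 2 * s\<^sup>2 * sin (s - 1) + 3 * hyp s / q"])
    show "Re ((theta 1 (2 * 1) (-1))\<^sup>2) = 3" by (simp add: theta_def)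
    show "((\<lambda>s. s + 1 / 2 * s\<^sup>2 * sin (s - 1) + hyp s / q) has_real_derivative
        1 + s * sin (s - 1) + 1 / 2 * s\<^sup>2 * cos (s - 1) + cosh (sqrt 3 * s) / q) (at s)" for s
      using q by (auto intro!: derivative_eq_intros has_derivative_hyp simp: field_simps)
    show "((\<lambda>s. 1 + s * sin (s - 1) + 1 / 2 * s\<^sup>2 * cos (s - 1) + cosh (sqrt 3 * s) / q)
        has_real_derivative sin (s - 1) + 2 * s * cos (s - 1) - 1 / 2 * s\<^sup>2 * sin (s - 1)
          + 3 * hyp s / q) (at s)" for s
    proof -
      have "((\<lambda>s. 1 + s * sin (s - 1) + 1 / 2 * s\<^sup>2 * cos (s - 1)) has_real_derivative
          sin (s - 1) + 2 * s * cos (s - 1) - 1 / 2 * s\<^sup>2 * sin (s - 1)) (at s)"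
        by (auto intro!: derivative_eq_intros simp: field_simps)
      from DERIV_add[OF this DERIV_cdivide[OF has_derivative_cosh_sqrt_3]] show ?thesis .
    qed
    have n: "hyp 1 - cosh (sqrt 3) = - 1 / 2 * q" unfolding q_def by argo
    have "(hyp 1 - cosh (sqrt 3)) / q = - 1 / 2" unfolding n using q by simp
    then have "hyp 1 / q - cosh (sqrt 3) / q = - 1 / 2" by (simp add: diff_divide_distrib)
    then show "1 + 1 / 2 * 1\<^sup>2 * sin (1 - 1) + hyp 1 / q -
        (1 + 1 * sin (1 - 1) + 1 / 2 * 1\<^sup>2 * cos (1 - 1) + cosh (sqrt 3 * 1) / q) = - (1::real)"
      by simp
    show "hyp 1 \<noteq> cosh (sqrt 3 * 1)" using q by (auto simp: q_def)
  qed (use assms has_derivative_hyp has_derivative_cosh_sqrt_3 in \<open>auto simp: hyp_def algebra_simps\<close>)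
qed

text \<open>
  Crude estimates suffice: the negative contribution of the mean flow dominates because \<open>tan 1\<close> is
  less than 2.
\<close>

lemma second_derivative_negative:
  "3 / 2 + 3 * (1 + 3 * sin 1 / (2 * (cos 1 - sin 1))) +
   1 / 2 * (1 + sinh (sqrt 3) / (2 * (sqrt 3 * cosh (sqrt 3) - sinh (sqrt 3)))) < (0::real)"
proof -
  have "sin 1 / (cos 1 - sin 1) \<le> (- 2::real)"
  proof -
    have "- 2 * (cos 1 - sin 1) \<le> sin (1::real)"
      using half_less_cos_1 sin_le_one[of "1::real"] cos_1_less_sin_1 by argo
    then show ?thesis using cos_1_less_sin_1 by (simp add: divide_le_eq)
  qed
  moreover have "sinh (sqrt 3) / (sqrt 3 * cosh (sqrt 3) - sinh (sqrt 3)) \<le> (2::real)"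
  proof -
    have "17 / 10 * cosh (sqrt 3) \<le> sqrt 3 * cosh (sqrt 3 :: real)"
      using sqrt_3_gt cosh_real_pos[of "sqrt 3"] by (intro mult_right_mono) auto
    moreover have "sinh x \<le> 2 * (y - sinh x)" if "17 / 10 * cosh x \<le> y" for x y :: real
      using that sinh_less_cosh[of x] cosh_real_pos[of x] by argo
    ultimately have "sinh (sqrt 3) \<le> 2 * (sqrt 3 * cosh (sqrt 3) - sinh (sqrt 3 :: real))"
      by blast
    then show ?thesis using sinh_less_cosh_sqrt_3 by (simp add: divide_le_eq)
  qed
  moreover have "3 * sin 1 / (2 * (cos 1 - sin 1)) = 3 / 2 * (sin 1 / (cos 1 - sin (1::real)))"
    by simp
  moreover have "sinh (sqrt 3) / (2 * (sqrt 3 * cosh (sqrt 3) - sinh (sqrt 3))) =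
      1 / 2 * (sinh (sqrt 3) / (sqrt 3 * cosh (sqrt 3) - sinh (sqrt 3 :: real)))" by simp
  ultimately show ?thesis by argo
qed

section \<open>The critical mode\<close>

text \<open>
  The mode 0 is trigonometric with \<open>l = cot 1\<close>, the mode 1 is the degenerate case \<open>\<theta> = 0\<close>, and for the
  higher modes \<open>\<theta> coth \<theta>\<close> exceeds 1 because \<open>\<theta>\<close> does.
\<close>

lemma l_fun_values:
  "l_fun 1 0 (-1) < 1" "l_fun 1 (Suc 0) (-1) = 1" "2 \<le> n \<Longrightarrow> 1 < l_fun 1 n (-1)"
proof -
  have "l_fun 1 0 (-1) = cos 1 / sin 1"
  proof -
    have "\<i> * (cosh \<i> / sinh \<i>) = complex_of_real (cos 1 / sin 1)"
      by (simp add: cosh_conv_cos sinh_conv_sin flip: cos_of_real sin_of_real)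
    then show ?thesis by (simp add: l_fun_def theta_def Let_def)
  qed
  then show "l_fun 1 0 (-1) < 1" using cos_1_less_sin_1 half_less_cos_1 by (simp add: divide_less_eq)
  show "l_fun 1 (Suc 0) (-1) = 1" by (simp add: l_fun_def theta_1_1)
  assume n: "2 \<le> n"
  define c where "c = sqrt ((real n)\<^sup>2 - 1)"
  have "2 * 2 \<le> real n * real n" using n by (intro mult_mono) auto
  then have c2: "3 \<le> (real n)\<^sup>2 - 1" by (simp add: power2_eq_square)
  then have "sqrt 3 \<le> c" unfolding c_def by (rule real_sqrt_le_mono)
  then have c: "1 < c" using sqrt_3_gt by linarith
  have th: "theta 1 n (-1) = of_real c"
    unfolding theta_def c_def using c2 by (subst of_real_sqrt) auto
  have "1 * cosh c < c * cosh c" using c cosh_real_pos[of c] by (intro mult_strict_right_mono) auto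
  then have "sinh c < c * cosh c" using sinh_less_cosh[of c] by linarith
  moreover have "0 < sinh c" using c by simp
  ultimately have "1 < c * (cosh c / sinh c)" by (simp add: less_divide_eq)
  moreover have "l_fun 1 n (-1) = c * (cosh c / sinh c)"
  proof -
    have "complex_of_real c * (cosh (complex_of_real c) / sinh (complex_of_real c)) =
        complex_of_real (c * (cosh c / sinh c))" by (simp add: cosh_field_def sinh_field_def flip: exp_of_real)
    then show ?thesis using c by (simp add: l_fun_def th Let_def)
  qed
  ultimately show "1 < l_fun 1 n (-1)" by simp
qed

lemma M_crit: "M 1 (1, -1, pi / 2) = {1}"
proof -
  have r: "r_fun (1, -1, pi / 2) = 1" by (simp add: r_fun_def cot_def)
  have "l_fun 1 n (-1) = 1 \<longleftrightarrow> n = 1" for n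
    using l_fun_values(1,2) l_fun_values(3)[of n] by (cases n; cases "n - 1") auto
  moreover have "sinh_theta 1 1 (-1) 1 \<noteq> 0" by (simp add: sinh_theta_def theta_1_1)
  ultimately show ?thesis unfolding M_def by (auto simp: r simp del: One_nat_def)
qed

section \<open>Green's identity for a solution\<close>

lemma has_integral_antiderivative:
  fixes f F :: "real \<Rightarrow> real"
  assumes "\<And>x. (F has_real_derivative f x) (at x)" "I = F (2 * pi) - F 0"
  shows "(f has_integral I) {0..2 * pi}"
  unfolding assms(2)
  using assms(1) by (intro fundamental_theorem_of_calculus)
    (auto simp: has_real_derivative_iff_has_vector_derivative intro: has_vector_derivative_at_within)

lemma integral_periodic_derivative:
  fixes f f' :: "real \<Rightarrow> real"
  assumes "\<And>x. (f has_real_derivative f' x) (at x)" "f (2 * pi) = f 0"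
  shows "(f' has_integral 0) {0..2 * pi}"
  using has_integral_antiderivative[OF assms(1)] assms(2) by simp

text \<open>
  The divergence theorem on a period of the strip, for a field with components \<open>P\<close> and \<open>R\<close> and divergence 0.
  The partial derivatives of the two components are each other's negatives, so continuity of one of
  them suffices for Fubini's theorem.
\<close>

lemma integral_boundary_eq_0:
  fixes P Px R :: "real \<Rightarrow> real \<Rightarrow> real"
  assumes P: "\<And>x s. s \<in> {0..1} \<Longrightarrow> ((\<lambda>y. P y s) has_real_derivative Px x s) (at x)"
    and R: "\<And>x s. s \<in> {0..1} \<Longrightarrow> ((\<lambda>r. R x r) has_real_derivative - Px x s) (at s within {0..1})"
    and per: "\<And>s. s \<in> {0..1} \<Longrightarrow> P (2 * pi) s = P 0 s"
    and cont: "continuous_on strip (\<lambda>(x, s). Px x s)"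
  shows "integral {0..2 * pi} (\<lambda>x. R x 1 - R x 0) = 0"
proof -
  have "continuous_on (cbox (0, 0) (2 * pi, 1)) (\<lambda>(x, s). Px x s)"
    by (rule continuous_on_subset[OF cont]) (auto simp: strip_def cbox_Pair_eq)
  from integral_swap_continuous[OF this]
  have "integral {0..2 * pi} (\<lambda>x. integral {0..1} (Px x)) =
      integral {0..1} (\<lambda>s. integral {0..2 * pi} (\<lambda>x. Px x s))"
    by simp
  also have "\<dots> = integral {0..1} (\<lambda>s::real. 0)"
  proof (rule Henstock_Kurzweil_Integration.integral_cong)
    fix s :: real assume s: "s \<in> {0..1}"
    show "integral {0..2 * pi} (\<lambda>x. Px x s) = 0"
      by (rule integral_unique, rule integral_periodic_derivative[OF P[OF s] per[OF s]])
  qed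
  finally have "integral {0..2 * pi} (\<lambda>x. integral {0..1} (Px x)) = 0" by simp
  moreover have "R x 1 - R x 0 = - integral {0..1} (Px x)" for x
  proof -
    have "((\<lambda>s. - Px x s) has_integral R x 1 - R x 0) {0..1}"
      using R by (intro fundamental_theorem_of_calculus)
        (auto simp: has_real_derivative_iff_has_vector_derivative)
    from integral_unique[OF this] show ?thesis by simp
  qed
  ultimately show ?thesis by simp
qed

text \<open>
  In the flattened coordinates the operators \<open>D = \<partial>\<^sub>x - s \<eta>\<^sub>x / h \<partial>\<^sub>s\<close> and \<open>N = \<partial>\<^sub>s / h\<close>, \<open>h = 1 + \<eta>\<close>, are the
  pullbacks of the Cartesian partial derivatives.  With \<open>\<chi> = cos (n x) S (s h)\<close>, a solution of the same
  linear equation, the field \<open>\<chi> (D u, N u) - u (D \<chi>, N \<chi>)\<close> is divergence free, and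
  \<open>h D f = \<partial>\<^sub>x (h f) - \<partial>\<^sub>s (s \<eta>\<^sub>x f)\<close> turns this into an exact divergence on the strip.
\<close>

lemma greens_identity:
  fixes n :: nat and \<eta> \<eta>' \<eta>'' S C T :: "real \<Rightarrow> real"
    and u ux us uss G Gx Gs :: "real \<Rightarrow> real \<Rightarrow> real"
  assumes \<eta>: "\<And>x. (\<eta> has_real_derivative \<eta>' x) (at x)" "\<And>x. (\<eta>' has_real_derivative \<eta>'' x) (at x)"
    and pos: "\<And>x. 0 < 1 + \<eta> x"
    and per: "\<eta> (2 * pi) = \<eta> 0" "\<eta>' (2 * pi) = \<eta>' 0"
      "\<And>s. s \<in> {0..1} \<Longrightarrow> u (2 * pi) s = u 0 s" "\<And>s. s \<in> {0..1} \<Longrightarrow> G (2 * pi) s = G 0 s"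
    and ux: "\<And>x s. s \<in> {0..1} \<Longrightarrow> ((\<lambda>y. u y s) has_real_derivative ux x s) (at x)"
    and us: "\<And>x s. s \<in> {0..1} \<Longrightarrow> (u x has_real_derivative us x s) (at s within {0..1})"
    and uss: "\<And>x s. s \<in> {0..1} \<Longrightarrow> (us x has_real_derivative uss x s) (at s within {0..1})"
    and G: "\<And>x s. s \<in> {0..1} \<Longrightarrow> G x s = ux x s - s * \<eta>' x / (1 + \<eta> x) * us x s"
    and Gx: "\<And>x s. s \<in> {0..1} \<Longrightarrow> ((\<lambda>y. G y s) has_real_derivative Gx x s) (at x)"
    and Gs: "\<And>x s. s \<in> {0..1} \<Longrightarrow> (G x has_real_derivative Gs x s) (at s within {0..1})"
    and pde: "\<And>x s. s \<in> {0..1} \<Longrightarrow>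
      Gx x s - s * \<eta>' x / (1 + \<eta> x) * Gs x s + uss x s / (1 + \<eta> x)\<^sup>2 + u x s = 0"
    and cont: "continuous_on strip (\<lambda>(x, s). u x s)" "continuous_on strip (\<lambda>(x, s). ux x s)"
      "continuous_on strip (\<lambda>(x, s). G x s)" "continuous_on strip (\<lambda>(x, s). Gx x s)"
      "continuous_on UNIV (\<lambda>x. us x 1)"
    and S: "\<And>z. (S has_real_derivative C z) (at z)"
    and C: "\<And>z. (C has_real_derivative ((real n)\<^sup>2 - 1) * S z) (at z)"
    and T: "\<And>z. (T has_real_derivative S z) (at z)" "\<And>z. C z = 1 + ((real n)\<^sup>2 - 1) * T z"
    and init: "S 0 = 0" "T 0 = 0"
    and bottom: "\<And>x. u x 0 = m0" and top: "\<And>x. u x 1 = m1"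
  shows "integral {0..2 * pi} (\<lambda>x. cos (real n * x) *
    (S (1 + \<eta> x) * (us x 1 / (1 + \<eta> x) * (1 + (\<eta>' x)\<^sup>2)) - m1 * (1 - T (1 + \<eta> x)) + m0)) = 0"
proof -
  define N where "N = real n"
  define h where "h x = 1 + \<eta> x" for x
  have h0: "h x \<noteq> 0" for x using pos[of x] by (simp add: h_def)
  have h': "(h has_real_derivative \<eta>' x) (at x)" for x
    unfolding h_def by (auto intro!: derivative_eq_intros \<eta>)
  define P where "P x s = h x * (cos (N * x) * S (s * h x) * G x s
      + u x s * (N * sin (N * x) * S (s * h x)))" for x s
  define Px where "Px x s = \<eta>' x * (cos (N * x) * S (s * h x) * G x s
      + u x s * (N * sin (N * x) * S (s * h x)))
    + h x * ((- N * sin (N * x) * S (s * h x) + cos (N * x) * (C (s * h x) * (s * \<eta>' x))) * G x s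
      + cos (N * x) * S (s * h x) * Gx x s
      + ux x s * (N * sin (N * x) * S (s * h x))
      + u x s * (N * N * cos (N * x) * S (s * h x) + N * sin (N * x) * (C (s * h x) * (s * \<eta>' x))))" for x s
  define R where "R x s = cos (N * x) * S (s * h x) * us x s / h x - u x s * (cos (N * x) * C (s * h x))
      - s * \<eta>' x * (cos (N * x) * S (s * h x) * G x s + u x s * (N * sin (N * x) * S (s * h x)))" for x s
  have dP: "((\<lambda>y. P y s) has_real_derivative Px x s) (at x)" if s: "s \<in> {0..1}" for x s
  proof -
    have dS: "((\<lambda>y. S (s * h y)) has_real_derivative C (s * h x) * (s * \<eta>' x)) (at x)"
      by (rule DERIV_chain2[OF S]) (rule DERIV_cmult[OF h'])
    have dc: "((\<lambda>y. cos (N * y)) has_real_derivative - N * sin (N * x)) (at x)"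
      by (auto intro!: derivative_eq_intros)
    have dn: "((\<lambda>y. N * sin (N * y)) has_real_derivative N * N * cos (N * x)) (at x)"
      by (auto intro!: derivative_eq_intros)
    note 1 = DERIV_mult[OF DERIV_mult[OF dc dS] Gx[OF s]]
    note 2 = DERIV_mult[OF ux[OF s] DERIV_mult[OF dn dS]]
    from DERIV_mult[OF h' DERIV_add[OF 1 2]] show ?thesis
      unfolding P_def Px_def by (rule DERIV_cong) (simp add: algebra_simps)
  qed
  have dR: "(R x has_real_derivative - Px x s) (at s within {0..1})" if s: "s \<in> {0..1}" for x s
  proof -
    have dS: "((\<lambda>r. S (r * h x)) has_real_derivative C (s * h x) * h x) (at s within {0..1})"
      by (rule DERIV_chain2[OF S]) (auto intro!: derivative_eq_intros)
    have dC: "((\<lambda>r. C (r * h x)) has_real_derivative (N\<^sup>2 - 1) * S (s * h x) * h x) (at s within {0..1})"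
      unfolding N_def by (rule DERIV_chain2[OF C]) (auto intro!: derivative_eq_intros)
    define c where "c = cos (N * x)"
    define q where "q = N * sin (N * x)"
    define i where "i = inverse (h x)"
    have i: "i * h x = 1" using h0[of x] by (simp add: i_def)
    note 1 = DERIV_mult[OF DERIV_cmult[OF dS, of c] uss[OF s, of x], THEN DERIV_cmult, of i]
    note 2 = DERIV_mult[OF us[OF s, of x] DERIV_cmult[OF dC, of c]]
    note 3 = DERIV_mult[OF DERIV_cmult_Id[of "\<eta>' x"] DERIV_add[OF
      DERIV_mult[OF DERIV_cmult[OF dS, of c] Gs[OF s, of x]]
      DERIV_mult[OF us[OF s, of x] DERIV_cmult[OF dS, of q]]]]
    have Ge: "G x s = ux x s - s * \<eta>' x * i * us x s"
      using G[OF s, of x] by (simp add: i_def h_def divide_inverse)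
    have pe: "Gx x s - s * \<eta>' x * i * Gs x s + uss x s * i\<^sup>2 + u x s = 0"
      using pde[OF s, of x] by (simp add: i_def h_def divide_inverse power_inverse)
    \<comment> \<open>With the reciprocal of h as an atom the divergence vanishes by polynomial algebra alone.\<close>
    have e: "R x = (\<lambda>r. i * (c * S (r * h x) * us x r) - u x r * (c * C (r * h x))
        - \<eta>' x * r * (c * S (r * h x) * G x r + u x r * (q * S (r * h x))))"
      unfolding R_def c_def q_def i_def by (auto simp: fun_eq_iff divide_inverse)
    show ?thesis
      unfolding e
    proof (rule DERIV_cong[OF DERIV_diff[OF DERIV_diff[OF 1 2] 3]], goal_cases)
      case 1
      show ?case
        using i Ge pe unfolding Px_def c_def[symmetric] q_def by algebra
    qed
  qed
  have continuous_h: "continuous_on A (\<lambda>(x, s). h x)" and continuous_\<eta>': "continuous_on A (\<lambda>(x, s). \<eta>' x)"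
    for A :: "(real \<times> real) set"
    using DERIV_continuous_on[of UNIV h \<eta>'] DERIV_continuous_on[of UNIV \<eta>' \<eta>''] h' \<eta>(2)
    by (auto simp: case_prod_beta intro!: continuous_on_compose2[of UNIV _ A fst] continuous_intros)
  have contS: "continuous_on UNIV S" and contC: "continuous_on UNIV C" and contT: "continuous_on UNIV T"
    using DERIV_continuous_on[of UNIV S C] DERIV_continuous_on[of UNIV T S]
      DERIV_continuous_on[of UNIV C "\<lambda>z. ((real n)\<^sup>2 - 1) * S z"] S C T(1) by auto
  have contPx: "continuous_on strip (\<lambda>(x, s). Px x s)"
  proof -
    have "continuous_on strip (\<lambda>p. snd p * h (fst p))"
      using continuous_h[of strip] by (auto simp: case_prod_beta intro!: continuous_intros)
    then have "continuous_on strip (\<lambda>p. S (snd p * h (fst p)))"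
      "continuous_on strip (\<lambda>p. C (snd p * h (fst p)))"
      by (auto intro!: continuous_on_compose2[OF contS] continuous_on_compose2[OF contC])
    then show ?thesis
      using continuous_h[of strip] continuous_\<eta>'[of strip] cont(1-4)
      unfolding Px_def case_prod_beta by (intro continuous_intros) auto
  qed
  have "integral {0..2 * pi} (\<lambda>x. R x 1 - R x 0) = 0"
  proof (rule integral_boundary_eq_0[OF dP dR _ contPx])
    have "cos (N * (2 * pi)) = cos (N * 0)" "sin (N * (2 * pi)) = sin (N * 0)"
      using cos_2npi[of n] sin_2npi[of n] by (simp_all add: N_def mult.commute mult.left_commute)
    then show "P (2 * pi) s = P 0 s" if "s \<in> {0..1}" for s
      using per that unfolding P_def h_def by simp
  qed
  define f where "f x = cos (real n * x) *
    (S (1 + \<eta> x) * (us x 1 / (1 + \<eta> x) * (1 + (\<eta>' x)\<^sup>2)) - m1 * (1 - T (1 + \<eta> x)) + m0)" for x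
  define g where "g x = N * N * cos (N * x) * T (h x) + N * sin (N * x) * (S (h x) * \<eta>' x)" for x
  have g: "(g has_integral 0) {0..2 * pi}"
  proof (rule integral_periodic_derivative)
    show "((\<lambda>x. N * sin (N * x) * T (h x)) has_real_derivative g x) (at x)" for x
    proof -
      have dT: "((\<lambda>x. T (h x)) has_real_derivative S (h x) * \<eta>' x) (at x)"
        by (rule DERIV_chain2[OF T(1) h'])
      have dn: "((\<lambda>y. N * sin (N * y)) has_real_derivative N * N * cos (N * x)) (at x)"
        by (auto intro!: derivative_eq_intros)
      show ?thesis
        by (rule DERIV_cong[OF DERIV_mult[OF dn dT]]) (simp add: g_def algebra_simps)
    qed
    have "sin (N * (2 * pi)) = sin (N * 0)"
      using sin_2npi[of n] by (simp add: N_def mult.commute mult.left_commute)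
    then show "N * sin (N * (2 * pi)) * T (h (2 * pi)) = N * sin (N * 0) * T (h 0)" by simp
  qed
  \<comment> \<open>The contribution of the constant surface value is cos (n x) (1 - T h) up to the exact derivative g.\<close>
  have R: "R x 1 - R x 0 = f x - m1 * g x" for x
  proof -
    have "((\<lambda>y. u y 1) has_real_derivative 0) (at x)" unfolding top by simp
    then have "ux x 1 = 0" using ux[of 1 x] DERIV_unique by fastforce
    then have "G x 1 = - (\<eta>' x / h x * us x 1)" using G[of 1 x] by (simp add: h_def)
    moreover have "C 0 = 1" using T(2)[of 0] init by simp
    ultimately have "R x 1 - R x 0 = cos (N * x) * S (h x) * us x 1 / h x - m1 * (cos (N * x) * C (h x))
      - \<eta>' x * (cos (N * x) * S (h x) * (- (\<eta>' x / h x * us x 1)) + m1 * (N * sin (N * x) * S (h x)))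
      + m0 * cos (N * x)"
      unfolding R_def by (simp add: top bottom init)
    also have "C (h x) = 1 + (N\<^sup>2 - 1) * T (h x)" unfolding N_def by (rule T(2))
    finally show ?thesis
      unfolding f_def g_def h_def[symmetric] N_def[symmetric]
      by (simp add: divide_inverse algebra_simps power2_eq_square)
  qed
  have ch: "continuous_on UNIV h" and c\<eta>': "continuous_on UNIV \<eta>'"
    using DERIV_continuous_on[of UNIV h \<eta>'] DERIV_continuous_on[of UNIV \<eta>' \<eta>''] h' \<eta>(2) by auto
  have "continuous_on UNIV (\<lambda>x. S (h x))" "continuous_on UNIV (\<lambda>x. T (h x))"
    using continuous_on_compose2[OF contS ch] continuous_on_compose2[OF contT ch] by auto
  then have "continuous_on UNIV f"
    unfolding f_def h_def[symmetric] using ch c\<eta>' cont(5) h0 by (intro continuous_intros) auto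
  then have "continuous_on {0..2 * pi} f" by (rule continuous_on_subset) auto
  then have f_int: "f integrable_on {0..2 * pi}" by (rule integrable_continuous_real)
  have "((\<lambda>x. m1 * g x) has_integral m1 * 0) {0..2 * pi}" using g by (rule has_integral_mult_right)
  from integral_unique[OF has_integral_diff[OF integrable_integral[OF f_int] this]]
  have "integral {0..2 * pi} (\<lambda>x. f x - m1 * g x) = integral {0..2 * pi} f" by simp
  then have "integral {0..2 * pi} f = 0"
    using \<open>integral {0..2 * pi} (\<lambda>x. R x 1 - R x 0) = 0\<close> unfolding R by simp
  then show ?thesis unfolding f_def[abs_def] .
qed


text \<open>
  On the free surface the stream function is constant, so the Bernoulli condition determines its normal
  derivative in terms of the surface elevation alone.  Green's identity therefore becomes an identity
  for the elevation and the bifurcation parameter only.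
\<close>

lemma surface_identity:
  fixes n :: nat and S C T :: "real \<Rightarrow> real"
  assumes \<beta>: "0 < \<beta>" "\<beta> < 1"
    and w: "(\<eta>, \<phi>) \<in> \<O> 1 \<beta>"
    and F: "F (\<eta>, \<phi>) (1, -1, l) = 0"
    and slope: "\<And>x. psi0_s (1, -1, l) 1 + ds \<phi> (x, 1) < 0"
    and S: "\<And>z. (S has_real_derivative C z) (at z)"
    and C: "\<And>z. (C has_real_derivative ((real n)\<^sup>2 - 1) * S z) (at z)"
    and T: "\<And>z. (T has_real_derivative S z) (at z)" "\<And>z. C z = 1 + ((real n)\<^sup>2 - 1) * T z"
    and init: "S 0 = 0" "T 0 = 0"
  shows "integral {0..2 * pi} (\<lambda>x. cos (real n * x) *
    (S (1 + \<eta> x) * sqrt ((1 + (deriv \<eta> x)\<^sup>2) * ((sin l)\<^sup>2 - 2 * \<eta> x))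
      + cos l * (1 - T (1 + \<eta> x)) - cos (l - 1))) = 0"
proof -
  let ?L = "(1, -1, l) :: params"
  have \<eta>2: "\<eta> \<in> holder_line (Suc (Suc 0)) \<beta>" and \<eta>per: "\<eta> (x + 2 * pi) = \<eta> x"
    and \<phi>2: "\<phi> \<in> holder_strip (Suc (Suc 0)) \<beta>" and \<phi>per: "\<phi> (x + 2 * pi, s) = \<phi> (x, s)"
    and \<phi>bc: "\<phi> (x, 0) = 0" "\<phi> (x, 1) = 0" and inf: "(INF x. \<eta> x) > - 1" for x s
    using w by (auto simp: \<O>_def X_def C_line_def C_strip_def numeral_2_eq_2)
  have pos: "0 < 1 + \<eta> x" for x
  proof -
    have "bdd_below (range \<eta>)" using \<eta>2 by (auto intro: bounded_imp_bdd_below)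
    then have "(INF x. \<eta> x) \<le> \<eta> x" by (intro cINF_lower) auto
    then show ?thesis using inf by linarith
  qed
  have \<eta>: "(\<eta> has_real_derivative deriv \<eta> x) (at x)"
    "(deriv \<eta> has_real_derivative deriv (deriv \<eta>) x) (at x)" for x
    using \<eta>2 by (auto simp: DERIV_deriv_iff_real_differentiable)
  have \<eta>'': "continuous_on UNIV (deriv (deriv \<eta>))"
    using \<eta>2 by (intro holder0_continuous[OF _ \<beta>(1)]) auto
  have \<eta>'per: "deriv \<eta> (x + 2 * pi) = deriv \<eta> x" for x
  proof -
    have "((\<lambda>x. \<eta> (x + 2 * pi)) has_real_derivative deriv \<eta> (x + 2 * pi)) (at x)"
      using \<eta>(1)[of "x + 2 * pi"] by (simp add: DERIV_shift)
    then have "(\<eta> has_real_derivative deriv \<eta> (x + 2 * pi)) (at x)" unfolding \<eta>per .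
    then show ?thesis using DERIV_imp_deriv by metis
  qed
  have \<phi>1: "dx \<phi> \<in> holder_strip (Suc 0) \<beta>" "ds \<phi> \<in> holder_strip (Suc 0) \<beta>" using \<phi>2 by auto
  define ux where "ux x s = dx \<phi> (x, s)" for x s
  define us where "us x s = - sin (s - 1 + l) + ds \<phi> (x, s)" for x s
  define uss where "uss x s = - cos (s - 1 + l) + ds (ds \<phi>) (x, s)" for x s
  define u where "u x s = cos (s - 1 + l) + \<phi> (x, s)" for x s
  define h where "h x = 1 + \<eta> x" for x
  define G where "G x s = ux x s - s * deriv \<eta> x / h x * us x s" for x s
  define Gx where "Gx x s = dx (dx \<phi>) (x, s) - (s * deriv (deriv \<eta>) x / h x * us x s
      - s * (deriv \<eta> x)\<^sup>2 / (h x)\<^sup>2 * us x s + s * deriv \<eta> x / h x * dx (ds \<phi>) (x, s))" for x s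
  define Gs where "Gs x s = ds (dx \<phi>) (x, s) - (deriv \<eta> x / h x * us x s
      + s * deriv \<eta> x / h x * uss x s)" for x s
  have h0: "h x \<noteq> 0" for x using pos[of x] by (simp add: h_def)
  have h': "(h has_real_derivative deriv \<eta> x) (at x)" for x
    unfolding h_def by (auto intro!: derivative_eq_intros \<eta>)
  have dux: "((\<lambda>y. u y s) has_real_derivative ux x s) (at x)" if "s \<in> {0..1}" for x s
    unfolding u_def ux_def using holder_strip_has_dx[OF \<phi>2 that] by (auto intro!: derivative_eq_intros)
  have dus: "(u x has_real_derivative us x s) (at s within {0..1})" if "s \<in> {0..1}" for x s
    unfolding u_def us_def using holder_strip_has_ds[OF \<phi>2 that] by (auto intro!: derivative_eq_intros)
  have duss: "(us x has_real_derivative uss x s) (at s within {0..1})" if "s \<in> {0..1}" for x s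
    unfolding us_def uss_def using holder_strip_has_ds[OF \<phi>1(2) that]
    by (auto intro!: derivative_eq_intros)
  have dusx: "((\<lambda>y. us y s) has_real_derivative dx (ds \<phi>) (x, s)) (at x)" if "s \<in> {0..1}" for x s
    unfolding us_def using holder_strip_has_dx[OF \<phi>1(2) that] by (auto intro!: derivative_eq_intros)
  have dGx: "((\<lambda>y. G y s) has_real_derivative Gx x s) (at x)" if s: "s \<in> {0..1}" for x s
    unfolding G_def
    by (rule DERIV_cong[OF DERIV_diff[OF holder_strip_has_dx[OF \<phi>1(1) s, folded ux_def]
          DERIV_mult[OF DERIV_divide[OF DERIV_cmult[OF \<eta>(2)] h' h0] dusx[OF s]]]])
      (use h0[of x] in \<open>simp add: Gx_def field_simps power2_eq_square\<close>)
  have dGs: "(G x has_real_derivative Gs x s) (at s within {0..1})" if s: "s \<in> {0..1}" for x s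
    unfolding G_def
    by (rule DERIV_cong[OF DERIV_diff[OF holder_strip_has_ds[OF \<phi>1(1) s, folded ux_def]
          DERIV_mult[OF DERIV_cdivide[OF DERIV_cmult_right[OF DERIV_ident]] duss[OF s]]]])
      (simp add: Gs_def algebra_simps)
  define U where "U = (\<lambda>(x, s). psi0 ?L s + \<phi> (x, s))"
  have U: "U (x, s) = u x s" for x s by (simp add: U_def u_def psi0_eq)
  have flat: "flat_dx \<eta> U (x, s) = G x s" if s: "s \<in> {0..1}" for x s
  proof -
    have "dx U (x, s) = ux x s" by (rule dx_eqI) (use dux[OF s] U in simp)
    moreover have "ds U (x, s) = us x s" by (rule ds_eqI[OF s]) (use dus[OF s] U in simp)
    ultimately show ?thesis by (simp add: flat_dx_def G_def h_def)
  qed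
  have flat2: "flat_dx \<eta> (flat_dx \<eta> U) (x, s) = Gx x s - s * deriv \<eta> x / h x * Gs x s"
    if s: "s \<in> {0..1}" for x s
  proof -
    have "dx (flat_dx \<eta> U) (x, s) = Gx x s" by (rule dx_eqI) (use dGx[OF s] flat[OF s] in simp)
    moreover have "ds (flat_dx \<eta> U) (x, s) = Gs x s"
      by (rule ds_eqI[OF s], rule has_field_derivative_transform_within[OF dGs[OF s] zero_less_one s])
        (use flat in auto)
    ultimately show ?thesis by (simp add: flat_dx_def[of _ "flat_dx _ U"] h_def)
  qed
  have F1: "F1 (\<eta>, \<phi>) ?L x = 0" for x
    using F by (simp add: F_def zero_prod_def zero_fun_def)
  have F2: "F2 (\<eta>, \<phi>) ?L p = 0" for p
    using F by (simp add: F_def zero_prod_def zero_fun_def)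
  have pde: "Gx x s - s * deriv \<eta> x / (1 + \<eta> x) * Gs x s + uss x s / (1 + \<eta> x)\<^sup>2 + u x s = 0"
    if s: "s \<in> {0..1}" for x s
    using F2[of "(x, s)"] s unfolding F2_def Let_def U_def[symmetric] prod.case on_strip_def
    unfolding psi0_ss_eq by (simp add: flat2 U uss_def h_def u_def psi0_eq)
  have strip_cont: "continuous_on strip (\<lambda>(x, s). f x)" if "continuous_on UNIV f" for f :: "real \<Rightarrow> real"
    unfolding case_prod_beta by (intro continuous_on_compose2[OF that] continuous_intros) auto
  have c\<eta>: "continuous_on strip (\<lambda>(x, s). h x)" "continuous_on strip (\<lambda>(x, s). deriv \<eta> x)"
    "continuous_on strip (\<lambda>(x, s). deriv (deriv \<eta>) x)"
    using strip_cont \<eta>'' DERIV_continuous_on[of UNIV h "deriv \<eta>"] h'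
      DERIV_continuous_on[of UNIV "deriv \<eta>" "deriv (deriv \<eta>)"] \<eta>(2) by auto
  have c\<phi>: "continuous_on strip \<phi>" "continuous_on strip (dx \<phi>)" "continuous_on strip (ds \<phi>)"
    "continuous_on strip (dx (dx \<phi>))" "continuous_on strip (dx (ds \<phi>))"
    using holder_strip_continuous[OF \<phi>2 \<beta>(1)] holder_strip_continuous[OF \<phi>1(1) \<beta>(1)]
      holder_strip_continuous[OF \<phi>1(2) \<beta>(1)] holder0_continuous[OF _ \<beta>(1)] \<phi>1 by auto
  have cu: "continuous_on strip (\<lambda>(x, s). u x s)" "continuous_on strip (\<lambda>(x, s). ux x s)"
    "continuous_on strip (\<lambda>(x, s). us x s)"
    using c\<phi> unfolding u_def ux_def us_def case_prod_beta by (auto intro!: continuous_intros)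
  have cG: "continuous_on strip (\<lambda>(x, s). G x s)" "continuous_on strip (\<lambda>(x, s). Gx x s)"
    using c\<phi> c\<eta> cu h0 unfolding G_def Gx_def case_prod_beta by (auto intro!: continuous_intros)
  have cus: "continuous_on UNIV (\<lambda>x. us x 1)"
    by (rule continuous_on_compose2[OF cu(3), of UNIV "\<lambda>x. (x, 1)", simplified])
      (auto intro!: continuous_intros)
  have Gper: "G (2 * pi) s = G 0 s" if s: "s \<in> {0..1}" for s
  proof -
    have "((\<lambda>y. u (y + 2 * pi) s) has_real_derivative ux (2 * pi) s) (at 0)"
      using dux[OF s, of "2 * pi"] DERIV_shift[of "\<lambda>y. u y s" "ux (2 * pi) s" 0 "2 * pi"] by simp
    then have "((\<lambda>y. u y s) has_real_derivative ux (2 * pi) s) (at 0)"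
      unfolding u_def \<phi>per .
    then have "ux (2 * pi) s = ux 0 s" using dux[OF s, of 0] DERIV_unique by blast
    moreover have "us (2 * pi) s = us 0 s"
      using \<phi>per[of 0] unfolding us_def ds_def by simp
    ultimately show ?thesis using \<eta>per[of 0] \<eta>'per[of 0] by (simp add: G_def h_def)
  qed
  \<comment> \<open>The Bernoulli condition only gives the square; the sign of the slope selects the negative root.\<close>
  define V where "V x = us x 1 / (1 + \<eta> x) * (1 + (deriv \<eta> x)\<^sup>2)" for x
  have V: "V x = - sqrt ((1 + (deriv \<eta> x)\<^sup>2) * ((sin l)\<^sup>2 - 2 * \<eta> x))" for x
  proof -
    have us1: "us x 1 < 0" using slope[of x] by (simp add: us_def psi0_s_eq)
    have "V x < 0" unfolding V_def
      by (intro mult_neg_pos divide_neg_pos us1 pos) (simp add: add_pos_nonneg)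
    moreover have "(V x)\<^sup>2 = (1 + (deriv \<eta> x)\<^sup>2) * ((sin l)\<^sup>2 - 2 * \<eta> x)"
    proof -
      have "(1 + (deriv \<eta> x)\<^sup>2) * (us x 1)\<^sup>2 / (2 * (1 + \<eta> x)\<^sup>2) + \<eta> x - 1 / 2 * (sin l)\<^sup>2 = 0"
        using F1[of x] by (simp add: F1_def us_def psi0_s_eq Q_def)
      then have "(1 + (deriv \<eta> x)\<^sup>2) * (us x 1)\<^sup>2 / (1 + \<eta> x)\<^sup>2 = (sin l)\<^sup>2 - 2 * \<eta> x"
        unfolding divide_divide_eq_left[symmetric] divide_divide_eq_left'[symmetric] by simp
      moreover have "(V x)\<^sup>2 = (1 + (deriv \<eta> x)\<^sup>2) *
          ((1 + (deriv \<eta> x)\<^sup>2) * (us x 1)\<^sup>2 / (1 + \<eta> x)\<^sup>2)"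
        unfolding V_def by (simp add: power2_eq_square)
      ultimately show ?thesis by simp
    qed
    ultimately show ?thesis using real_sqrt_abs[of "V x"] by simp
  qed
  have "integral {0..2 * pi} (\<lambda>x. cos (real n * x) *
    (S (1 + \<eta> x) * (us x 1 / (1 + \<eta> x) * (1 + (deriv \<eta> x)\<^sup>2)) - cos l * (1 - T (1 + \<eta> x))
      + cos (l - 1))) = 0"
    by (rule greens_identity[where u = u and ux = ux and uss = uss and G = G and Gx = Gx and Gs = Gs
          and \<eta>'' = "deriv (deriv \<eta>)" and C = C])
      (use \<eta>per[of 0] \<eta>'per[of 0] \<phi>per[of 0] Gper \<phi>bc pde cu cG cus S C T init pos \<eta> \<eta>'' dux dus duss
        dGx dGs in \<open>auto simp: u_def G_def h_def\<close>)
  then have "integral {0..2 * pi} (\<lambda>x. - (cos (real n * x) *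
    (S (1 + \<eta> x) * (us x 1 / (1 + \<eta> x) * (1 + (deriv \<eta> x)\<^sup>2)) - cos l * (1 - T (1 + \<eta> x))
      + cos (l - 1)))) = 0" by simp
  then show ?thesis unfolding V_def[symmetric] V by (simp add: algebra_simps)
qed

section \<open>Expansion of the surface identities\<close>

subsection \<open>Trigonometric integrals over one period\<close>

lemma has_integral_cos: "(cos has_integral 0) {0..2 * pi :: real}"
  by (rule has_integral_antiderivative[where F = sin]) (auto intro!: derivative_eq_intros)

lemma has_integral_cos_cubed: "((\<lambda>x. cos x ^ 3) has_integral 0) {0..2 * pi :: real}"
proof (rule has_integral_antiderivative[where F = "\<lambda>x. sin x - sin x ^ 3 / 3"])
  fix x :: real
  have "((\<lambda>x. sin x - sin x ^ 3 / 3) has_real_derivative cos x - (sin x)\<^sup>2 * cos x) (at x)"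
    by (auto intro!: derivative_eq_intros)
  moreover have "cos x - (sin x)\<^sup>2 * cos x = cos x ^ 3"
    unfolding sin_squared_eq by algebra
  ultimately show "((\<lambda>x. sin x - sin x ^ 3 / 3) has_real_derivative cos x ^ 3) (at x)" by simp
qed auto

lemma has_integral_cos_squared: "((\<lambda>x. (cos x)\<^sup>2) has_integral pi) {0..2 * pi :: real}"
proof (rule has_integral_antiderivative[where F = "\<lambda>x. (x + sin x * cos x) / 2"])
  fix x :: real
  have "((\<lambda>x. (x + sin x * cos x) / 2) has_real_derivative (1 + (cos x)\<^sup>2 - (sin x)\<^sup>2) / 2) (at x)"
    by (auto intro!: derivative_eq_intros simp: power2_eq_square)
  moreover have "(1 + (cos x)\<^sup>2 - (sin x)\<^sup>2) / 2 = (cos x)\<^sup>2" by (simp add: sin_squared_eq)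
  ultimately show "((\<lambda>x. (x + sin x * cos x) / 2) has_real_derivative (cos x)\<^sup>2) (at x)" by simp
qed auto

lemma has_integral_cos_fourth: "((\<lambda>x. cos x ^ 4) has_integral 3 * pi / 4) {0..2 * pi :: real}"
proof (rule has_integral_antiderivative[where
      F = "\<lambda>x. 3 * x / 8 + cos x ^ 3 * sin x / 4 + 3 * (cos x * sin x) / 8"])
  fix x :: real
  have "((\<lambda>x. 3 * x / 8 + cos x ^ 3 * sin x / 4 + 3 * (cos x * sin x) / 8) has_real_derivative
      3 / 8 + (cos x ^ 4 - 3 * (cos x)\<^sup>2 * (sin x)\<^sup>2) / 4 + 3 * ((cos x)\<^sup>2 - (sin x)\<^sup>2) / 8) (at x)"
    by (auto intro!: derivative_eq_intros simp: power2_eq_square power4_eq_xxxx power3_eq_cube field_simps)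
  moreover have "3 / 8 + (cos x ^ 4 - 3 * (cos x)\<^sup>2 * (sin x)\<^sup>2) / 4 + 3 * ((cos x)\<^sup>2 - (sin x)\<^sup>2) / 8 = cos x ^ 4"
    unfolding sin_squared_eq by algebra
  ultimately show "((\<lambda>x. 3 * x / 8 + cos x ^ 3 * sin x / 4 + 3 * (cos x * sin x) / 8)
      has_real_derivative cos x ^ 4) (at x)" by simp
qed auto

lemma has_integral_cos_double: "((\<lambda>x. cos (2 * x)) has_integral 0) {0..2 * pi :: real}"
  by (rule has_integral_antiderivative[where F = "\<lambda>x. sin (2 * x) / 2"])
    (use sin_2npi[of 2] in \<open>auto intro!: derivative_eq_intros simp: mult.commute\<close>)

lemma has_integral_cos_double_cos: "((\<lambda>x. cos (2 * x) * cos x) has_integral 0) {0..2 * pi :: real}"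
proof -
  have e: "cos (2 * x) * cos x = 2 * cos x ^ 3 - cos x" for x :: real
    unfolding cos_double_cos by algebra
  show ?thesis unfolding e
    using has_integral_diff[OF has_integral_mult_right[OF has_integral_cos_cubed, of 2] has_integral_cos]
    by simp
qed

lemma has_integral_cos_double_cos_squared:
  "((\<lambda>x. cos (2 * x) * (cos x)\<^sup>2) has_integral pi / 2) {0..2 * pi :: real}"
proof -
  have e: "cos (2 * x) * (cos x)\<^sup>2 = 2 * cos x ^ 4 - (cos x)\<^sup>2" for x :: real
    unfolding cos_double_cos by algebra
  have "2 * (3 * pi / 4) - pi = pi / 2" by simp
  then show ?thesis unfolding e
    using has_integral_diff[OF has_integral_mult_right[OF has_integral_cos_fourth, of 2]
        has_integral_cos_squared] by metis
qed

subsection \<open>Families of bounded functions\<close>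

text \<open>
  Remainder terms are written as a power of the curve parameter \<open>t\<close> times a function that is bounded
  uniformly in \<open>t\<close> and \<open>x\<close>.  All remainders are polynomials in a few such functions.
\<close>

definition bounded_family :: "real \<Rightarrow> (real \<Rightarrow> real \<Rightarrow> real) \<Rightarrow> bool" where
  "bounded_family t0 f \<longleftrightarrow> (\<exists>K. \<forall>t x. t \<noteq> 0 \<and> \<bar>t\<bar> < t0 \<longrightarrow> \<bar>f t x\<bar> \<le> K)"

lemma bounded_familyI:
  "(\<And>t x. t \<noteq> 0 \<Longrightarrow> \<bar>t\<bar> < t0 \<Longrightarrow> \<bar>f t x\<bar> \<le> K) \<Longrightarrow> bounded_family t0 f"
  unfolding bounded_family_def by blast

lemma bounded_familyE:
  assumes "bounded_family t0 f"
  obtains K where "0 \<le> K" "\<And>t x. t \<noteq> 0 \<Longrightarrow> \<bar>t\<bar> < t0 \<Longrightarrow> \<bar>f t x\<bar> \<le> K"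
proof -
  obtain K where K: "\<forall>t x. t \<noteq> 0 \<and> \<bar>t\<bar> < t0 \<longrightarrow> \<bar>f t x\<bar> \<le> K"
    using assms unfolding bounded_family_def by blast
  show ?thesis by (rule that[of "max K 0"]) (use K in \<open>auto simp: le_max_iff_disj\<close>)
qed

lemma bounded_family_const: "bounded_family t0 (\<lambda>t x. k)"
  by (rule bounded_familyI[of _ _ "\<bar>k\<bar>"]) simp

lemma bounded_family_parameter: "bounded_family t0 (\<lambda>t x. t)"
  by (rule bounded_familyI[of _ _ t0]) simp

lemma bounded_family_cos: "bounded_family t0 (\<lambda>t x. cos x)"
  by (rule bounded_familyI[of _ _ 1]) simp

lemma bounded_family_cos_mult: "bounded_family t0 (\<lambda>t x. cos (k * x))"
  by (rule bounded_familyI[of _ _ 1]) simp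

lemma bounded_family_sin: "bounded_family t0 (\<lambda>t x. sin x)"
  by (rule bounded_familyI[of _ _ 1]) simp

lemma bounded_family_add:
  assumes "bounded_family t0 f" "bounded_family t0 g"
  shows "bounded_family t0 (\<lambda>t x. f t x + g t x)"
proof -
  obtain K L where "\<And>t x. t \<noteq> 0 \<Longrightarrow> \<bar>t\<bar> < t0 \<Longrightarrow> \<bar>f t x\<bar> \<le> K"
    and "\<And>t x. t \<noteq> 0 \<Longrightarrow> \<bar>t\<bar> < t0 \<Longrightarrow> \<bar>g t x\<bar> \<le> L"
    using assms by (elim bounded_familyE) blast
  then show ?thesis
    by (intro bounded_familyI[of _ _ "K + L"] order_trans[OF abs_triangle_ineq] add_mono)
qed

lemma bounded_family_mult:
  assumes "bounded_family t0 f" "bounded_family t0 g"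
  shows "bounded_family t0 (\<lambda>t x. f t x * g t x)"
proof -
  obtain K L where "0 \<le> K" "\<And>t x. t \<noteq> 0 \<Longrightarrow> \<bar>t\<bar> < t0 \<Longrightarrow> \<bar>f t x\<bar> \<le> K"
    and "\<And>t x. t \<noteq> 0 \<Longrightarrow> \<bar>t\<bar> < t0 \<Longrightarrow> \<bar>g t x\<bar> \<le> L"
    using assms by (elim bounded_familyE) blast
  then show ?thesis
    by (intro bounded_familyI[of _ _ "K * L"]) (auto simp: abs_mult intro!: mult_mono)
qed

lemma bounded_family_minus: "bounded_family t0 f \<Longrightarrow> bounded_family t0 (\<lambda>t x. - f t x)"
  unfolding bounded_family_def by simp

lemma bounded_family_diff:
  "bounded_family t0 f \<Longrightarrow> bounded_family t0 g \<Longrightarrow> bounded_family t0 (\<lambda>t x. f t x - g t x)"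
  using bounded_family_add[of t0 f "\<lambda>t x. - g t x"] bounded_family_minus[of t0 g] by simp

lemma bounded_family_power: "bounded_family t0 f \<Longrightarrow> bounded_family t0 (\<lambda>t x. f t x ^ k)"
  by (induction k) (auto intro: bounded_family_mult bounded_family_const)

lemma bounded_family_divide: "bounded_family t0 f \<Longrightarrow> bounded_family t0 (\<lambda>t x. f t x / k)"
  using bounded_family_mult[of t0 f "\<lambda>t x. 1 / k"] bounded_family_const[of t0 "1 / k"] by simp

lemmas bounded_family_intros = bounded_family_const bounded_family_parameter bounded_family_cos
  bounded_family_cos_mult bounded_family_sin bounded_family_add bounded_family_mult
  bounded_family_minus bounded_family_diff bounded_family_power bounded_family_divide

text \<open>
  The way in which the expansions are used: the leading part of an integrand with vanishing integral
  has an integral of the order of the remainder, which is integrable as a difference of integrable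
  functions.
\<close>

lemma remainder_bound:
  assumes r: "bounded_family t0 r"
    and f: "\<And>t. t \<noteq> 0 \<Longrightarrow> \<bar>t\<bar> < t0 \<Longrightarrow> (f t has_integral 0) {0..2 * pi}"
    and a: "\<And>t. t \<noteq> 0 \<Longrightarrow> \<bar>t\<bar> < t0 \<Longrightarrow> (a t has_integral \<alpha> t) {0..2 * pi}"
    and e: "\<And>t x. t \<noteq> 0 \<Longrightarrow> \<bar>t\<bar> < t0 \<Longrightarrow> f t x = a t x + t * r t x"
  shows "\<exists>K. \<forall>t. t \<noteq> 0 \<and> \<bar>t\<bar> < t0 \<longrightarrow> \<bar>\<alpha> t\<bar> \<le> K * \<bar>t\<bar>"
proof -
  obtain K where K: "0 \<le> K" "\<And>t x. t \<noteq> 0 \<Longrightarrow> \<bar>t\<bar> < t0 \<Longrightarrow> \<bar>r t x\<bar> \<le> K"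
    using r by (elim bounded_familyE) blast
  have "\<bar>\<alpha> t\<bar> \<le> (2 * pi * K) * \<bar>t\<bar>" if t: "t \<noteq> 0" "\<bar>t\<bar> < t0" for t
  proof -
    have "((\<lambda>x. f t x - a t x) has_integral 0 - \<alpha> t) {0..2 * pi}"
      by (rule has_integral_diff[OF f[OF t] a[OF t]])
    then have "((\<lambda>x. t * r t x) has_integral - \<alpha> t) (cbox 0 (2 * pi))" using e[OF t] by simp
    then have "norm (- \<alpha> t) \<le> (\<bar>t\<bar> * K) * measure lborel (cbox 0 (2 * pi))"
      by (rule has_integral_bound[rotated]) (use K t in \<open>auto simp: abs_mult intro!: mult_left_mono\<close>)
    then show ?thesis by (simp add: algebra_simps)
  qed
  then show ?thesis by blast
qed

text \<open>
  The interval of length 1/2 around 1 contains the water depth of all waves considered later.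
\<close>

lemma second_order_Taylor:
  fixes S C :: "real \<Rightarrow> real"
  assumes S: "\<And>z. (S has_real_derivative C z) (at z)" "\<And>z. (C has_real_derivative th * S z) (at z)"
  shows "\<exists>K. \<forall>h. \<bar>h\<bar> \<le> 1 / 4 \<longrightarrow> \<bar>S (1 + h) - S 1 - C 1 * h - th * S 1 / 2 * h\<^sup>2\<bar> \<le> K * \<bar>h\<bar> ^ 3"
proof -
  have "continuous_on {3/4..5/4} C" using S(2) by (intro DERIV_continuous_on[of _ C "\<lambda>z. th * S z"])
      (auto intro: has_field_derivative_at_within)
  then have "bounded (C ` {3/4..5/4})" by (intro compact_imp_bounded compact_continuous_image) auto
  then have "\<exists>B. \<forall>z\<in>{3/4..5/4}. \<bar>C z\<bar> \<le> B" unfolding bounded_iff by simp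
  then obtain B where B: "\<And>z. z \<in> {3/4..5/4} \<Longrightarrow> \<bar>C z\<bar> \<le> B" by blast
  define D where "D m = (if m = 0 then S else if m = 1 then C else if m = 2 then (\<lambda>z. th * S z)
    else (\<lambda>z. th * C z))" for m :: nat
  have "\<bar>S (1 + h) - S 1 - C 1 * h - th * S 1 / 2 * h\<^sup>2\<bar> \<le> \<bar>th\<bar> * B / 6 * \<bar>h\<bar> ^ 3"
    if h: "\<bar>h\<bar> \<le> 1 / 4" for h
  proof (cases "h = 0")
    case False
    have "(D m has_real_derivative D (Suc m) z) (at z)" if m: "m < 3" for m z
    proof -
      consider "m = 0" | "m = 1" | "m = 2" using m by linarith
      then show ?thesis by cases (auto simp: D_def S intro!: DERIV_cmult)
    qed
    then have D: "\<forall>m z. m < 3 \<and> 3/4 \<le> z \<and> z \<le> 5/4 \<longrightarrow> (D m has_real_derivative D (Suc m) z) (at z)"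
      by blast
    have "\<exists>z. (if 1 + h < 1 then 1 + h < z \<and> z < 1 else 1 < z \<and> z < 1 + h) \<and>
        S (1 + h) = (\<Sum>m<3. D m 1 / fact m * (1 + h - 1) ^ m) + D 3 z / fact 3 * (1 + h - 1) ^ 3"
      by (rule Taylor[OF _ _ D]) (use h False in \<open>auto simp: D_def abs_le_iff\<close>)
    then obtain z where z': "if 1 + h < 1 then 1 + h < z \<and> z < 1 else 1 < z \<and> z < 1 + h"
      and e': "S (1 + h) = (\<Sum>m<3. D m 1 / fact m * (1 + h - 1) ^ m) + D 3 z / fact 3 * (1 + h - 1) ^ 3"
      by blast
    have z: "z \<in> {3/4..5/4}" using z' h by (auto simp: abs_le_iff split: if_splits)
    have e: "S (1 + h) = (\<Sum>m<3. D m 1 / fact m * h ^ m) + D 3 z / fact 3 * h ^ 3"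
      using e' by simp
    have "S (1 + h) - S 1 - C 1 * h - th * S 1 / 2 * h\<^sup>2 = th * C z / 6 * h ^ 3"
      unfolding e by (simp add: D_def numeral_3_eq_3 fact_numeral power2_eq_square)
    then have "\<bar>S (1 + h) - S 1 - C 1 * h - th * S 1 / 2 * h\<^sup>2\<bar> = \<bar>th * C z / 6 * h ^ 3\<bar>"
      by (simp only:)
    also have "\<dots> = \<bar>th\<bar> * \<bar>C z\<bar> / 6 * \<bar>h\<bar> ^ 3" by (simp add: abs_mult power_abs)
    also have "\<dots> \<le> \<bar>th\<bar> * B / 6 * \<bar>h\<bar> ^ 3"
      using B[OF z] by (intro mult_right_mono divide_right_mono mult_left_mono) auto
    finally show ?thesis .
  qed simp
  then show ?thesis by blast
qed

lemma Lipschitz_at_1: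
  fixes T S :: "real \<Rightarrow> real"
  assumes T: "\<And>z. (T has_real_derivative S z) (at z)" and S: "continuous_on UNIV S"
  shows "\<exists>K. \<forall>h. \<bar>h\<bar> \<le> 1 / 4 \<longrightarrow> \<bar>T (1 + h) - T 1\<bar> \<le> K * \<bar>h\<bar>"
proof -
  have "bounded (S ` {3/4..5/4})"
    using S by (intro compact_imp_bounded compact_continuous_image continuous_on_subset[OF S]) auto
  then have "\<exists>B. \<forall>z\<in>{3/4..5/4}. \<bar>S z\<bar> \<le> B" unfolding bounded_iff by simp
  then obtain B where B: "\<And>z. z \<in> {3/4..5/4} \<Longrightarrow> \<bar>S z\<bar> \<le> B" by blast
  have "\<bar>T (1 + h) - T 1\<bar> \<le> B * \<bar>h\<bar>" if h: "\<bar>h\<bar> \<le> 1 / 4" for h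
  proof -
    have "norm (T (1 + h) - T 1) \<le> B * norm (1 + h - 1)"
    proof (rule field_differentiable_bound[of "{3/4..5/4}" T S B])
      show "(T has_field_derivative S z) (at z within {3/4..5/4})" for z
        using T by (rule has_field_derivative_at_within)
    qed (use h B in \<open>auto simp: abs_le_iff\<close>)
    then show ?thesis by simp
  qed
  then show ?thesis by blast
qed

subsection \<open>Small waves close to the kernel element\<close>

text \<open>
  The properties of the bifurcation curve that determine \<open>\<lambda>''(0)\<close>.  The functions \<open>S\<close>, \<open>C\<close> and \<open>T\<close> in the identity
  stand for \<open>sinh (\<theta> z) / \<theta>\<close>, its derivative, and its primitive, in the form that makes sense for all signs
  of \<open>\<theta>\<^sup>2 = n\<^sup>2 - 1\<close>.
\<close>

locale small_waves =
  fixes t0 A :: real and \<eta> \<eta>' :: "real \<Rightarrow> real \<Rightarrow> real" and l :: "real \<Rightarrow> real"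
  assumes der: "\<And>t x. t \<noteq> 0 \<Longrightarrow> \<bar>t\<bar> < t0 \<Longrightarrow> (\<eta> t has_real_derivative \<eta>' t x) (at x)"
    and cont_\<eta>': "\<And>t. t \<noteq> 0 \<Longrightarrow> \<bar>t\<bar> < t0 \<Longrightarrow> continuous_on UNIV (\<eta>' t)"
    and per: "\<And>t. t \<noteq> 0 \<Longrightarrow> \<bar>t\<bar> < t0 \<Longrightarrow> \<eta> t (2 * pi) = \<eta> t 0"
    and close: "\<And>t x. t \<noteq> 0 \<Longrightarrow> \<bar>t\<bar> < t0 \<Longrightarrow> \<bar>\<eta> t x - t * cos x\<bar> \<le> A * t\<^sup>2"
      "\<And>t x. t \<noteq> 0 \<Longrightarrow> \<bar>t\<bar> < t0 \<Longrightarrow> \<bar>\<eta>' t x + t * sin x\<bar> \<le> A * t\<^sup>2"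
    and cos_l: "\<And>t. t \<noteq> 0 \<Longrightarrow> \<bar>t\<bar> < t0 \<Longrightarrow> \<bar>cos (l t)\<bar> \<le> A * \<bar>t\<bar>"
    and sin_l: "\<And>t. t \<noteq> 0 \<Longrightarrow> \<bar>t\<bar> < t0 \<Longrightarrow> 0 < sin (l t)"
    and small: "\<And>t x. t \<noteq> 0 \<Longrightarrow> \<bar>t\<bar> < t0 \<Longrightarrow> \<bar>\<eta> t x\<bar> \<le> 1 / 4"
      "\<And>t. t \<noteq> 0 \<Longrightarrow> \<bar>t\<bar> < t0 \<Longrightarrow> \<bar>cos (l t)\<bar> \<le> 1 / 4"
    and identity: "\<And>t n S C T. \<lbrakk>t \<noteq> 0; \<bar>t\<bar> < t0;
      \<And>z. (S has_real_derivative C z) (at z);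
      \<And>z. (C has_real_derivative ((real n)\<^sup>2 - 1) * S z) (at z);
      \<And>z. (T has_real_derivative S z) (at z); \<And>z. C z = 1 + ((real n)\<^sup>2 - 1) * T z;
      S 0 = 0; T 0 = 0\<rbrakk> \<Longrightarrow>
      integral {0..2 * pi} (\<lambda>x. cos (real n * x) *
        (S (1 + \<eta> t x) * sqrt ((1 + (\<eta>' t x)\<^sup>2) * ((sin (l t))\<^sup>2 - 2 * \<eta> t x))
          + cos (l t) * (1 - T (1 + \<eta> t x)) - cos (l t - 1))) = 0"
begin

abbreviation "bdd \<equiv> bounded_family t0"

text \<open>
  The elevation is \<open>\<eta> = t z\<close> with \<open>z = cos x + t d\<close>, its slope is \<open>t q\<close> with \<open>q = - sin x + t e\<close>, and \<open>cos \<lambda>\<close> is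
  first known to be \<open>t \<gamma>\<close> and later \<open>t\<^sup>2 g\<close>.  Here \<open>\<sigma>\<close> is minus the normal derivative of the stream function
  at the surface, per unit length in \<open>x\<close>; \<open>\<zeta>\<close> and \<open>r4\<close> are the coefficient and the remainder in the
  expansion \<open>(1 + \<eta>) \<sigma> = 1 + t\<^sup>2 \<zeta> / 2 + t\<^sup>4 r4\<close>.
\<close>

definition "d t x = (\<eta> t x - t * cos x) / t\<^sup>2"
definition "e t x = (\<eta>' t x + t * sin x) / t\<^sup>2"
definition "z t x = cos x + t * d t x"
definition "q t x = - sin x + t * e t x"
definition "c t = cos (l t)"
definition "\<gamma> t = c t / t"
definition "g t = c t / t\<^sup>2"
definition "\<sigma> t x = sqrt ((1 + (\<eta>' t x)\<^sup>2) * ((sin (l t))\<^sup>2 - 2 * \<eta> t x))"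
definition "\<zeta> t x = (q t x)\<^sup>2 - (3 * (z t x)\<^sup>2 + 2 * t * z t x ^ 3 + (\<gamma> t)\<^sup>2 * (1 + t * z t x)\<^sup>2) * (1 + t\<^sup>2 * (q t x)\<^sup>2)"
definition "r4 t x = ((1 + t * z t x) * \<sigma> t x - 1 - t\<^sup>2 * \<zeta> t x / 2) / t ^ 4"

lemma \<eta>_eq: "t \<noteq> 0 \<Longrightarrow> \<eta> t x = t * z t x"
  by (simp add: z_def d_def field_simps power2_eq_square)

lemma \<eta>'_eq: "t \<noteq> 0 \<Longrightarrow> \<eta>' t x = t * q t x"
  by (simp add: q_def e_def field_simps power2_eq_square)

lemma bdd_d: "bdd d" and bdd_e: "bdd e" and bdd_\<gamma>: "bdd (\<lambda>t x. \<gamma> t)"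
proof -
  show "bdd d" using close(1) by (intro bounded_familyI[of _ _ A]) (auto simp: d_def abs_divide divide_le_eq)
  show "bdd e" using close(2) by (intro bounded_familyI[of _ _ A]) (auto simp: e_def abs_divide divide_le_eq)
  show "bdd (\<lambda>t x. \<gamma> t)"
    using cos_l by (intro bounded_familyI[of _ _ A]) (auto simp: \<gamma>_def c_def abs_divide divide_le_eq)
qed

lemma bdd_z: "bdd z" and bdd_q: "bdd q" and bdd_\<zeta>: "bdd \<zeta>"
proof -
  show z: "bdd z" unfolding z_def[abs_def] by (intro bounded_family_intros bdd_d)
  show q: "bdd q" unfolding q_def[abs_def] by (intro bounded_family_intros bdd_e)
  show "bdd \<zeta>" unfolding \<zeta>_def[abs_def] by (intro bounded_family_intros z q bdd_\<gamma>)
qed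

lemma y_squared:
  assumes t: "t \<noteq> 0" "\<bar>t\<bar> < t0"
  shows "((1 + t * z t x) * \<sigma> t x)\<^sup>2 = 1 + t\<^sup>2 * \<zeta> t x" "0 \<le> (1 + t * z t x) * \<sigma> t x"
proof -
  have sl: "(sin (l t))\<^sup>2 = 1 - (c t)\<^sup>2" by (simp add: c_def sin_squared_eq)
  have "(c t)\<^sup>2 \<le> (1 / 4)\<^sup>2" using power_mono[OF small(2)[OF t], of 2] by (simp add: c_def)
  then have nonneg: "0 \<le> (sin (l t))\<^sup>2 - 2 * \<eta> t x"
  proof -
    have "(1 / 4 :: real)\<^sup>2 = 1 / 16" by (simp add: power2_eq_square)
    moreover have "\<eta> t x \<le> 1 / 4" using small(1)[OF t, of x] by linarith
    ultimately show ?thesis using \<open>(c t)\<^sup>2 \<le> (1 / 4)\<^sup>2\<close> unfolding sl by linarith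
  qed
  have ct: "c t = t * \<gamma> t" using t by (simp add: \<gamma>_def)
  have "(\<sigma> t x)\<^sup>2 = (1 + (\<eta>' t x)\<^sup>2) * ((sin (l t))\<^sup>2 - 2 * \<eta> t x)"
    unfolding \<sigma>_def using nonneg by (intro real_sqrt_pow2 mult_nonneg_nonneg) auto
  also have "\<dots> = (1 + (t * q t x)\<^sup>2) * (1 - (t * \<gamma> t)\<^sup>2 - 2 * (t * z t x))"
    using t unfolding sl ct by (simp add: \<eta>_eq \<eta>'_eq)
  finally have "((1 + t * z t x) * \<sigma> t x)\<^sup>2 =
      (1 + t * z t x)\<^sup>2 * ((1 + (t * q t x)\<^sup>2) * (1 - (t * \<gamma> t)\<^sup>2 - 2 * (t * z t x)))"
    by (simp add: power_mult_distrib)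
  also have "\<dots> = 1 + t\<^sup>2 * \<zeta> t x" unfolding \<zeta>_def by algebra
  finally show "((1 + t * z t x) * \<sigma> t x)\<^sup>2 = 1 + t\<^sup>2 * \<zeta> t x" .
  have "0 \<le> \<sigma> t x" unfolding \<sigma>_def using nonneg by (simp add: add_nonneg_nonneg)
  moreover have "0 \<le> 1 + t * z t x" using small(1)[OF t, of x] \<eta>_eq[OF t(1), of x] by (simp add: abs_le_iff)
  ultimately show "0 \<le> (1 + t * z t x) * \<sigma> t x" by simp
qed

lemma y_eq: "t \<noteq> 0 \<Longrightarrow> (1 + t * z t x) * \<sigma> t x = 1 + t\<^sup>2 * \<zeta> t x / 2 + t ^ 4 * r4 t x"
  unfolding r4_def by simp

text \<open>
  The linear terms cancel in \<open>y\<^sup>2 = 1 + t\<^sup>2 \<zeta>\<close> for \<open>y = (1 + \<eta>) \<sigma>\<close>.  Hence \<open>y - 1 = O(t\<^sup>2)\<close>, and the error of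
  linearising the square root is \<open>(y - 1)\<^sup>2 / 2 = O(t\<^sup>4)\<close>.
\<close>

lemma bdd_r4: "bdd r4"
proof -
  obtain K where K: "\<And>t x. t \<noteq> 0 \<Longrightarrow> \<bar>t\<bar> < t0 \<Longrightarrow> \<bar>\<zeta> t x\<bar> \<le> K"
    using bdd_\<zeta> by (elim bounded_familyE) blast
  show ?thesis
  proof (rule bounded_familyI[of _ _ "K\<^sup>2 / 2"])
    fix t x assume t: "t \<noteq> 0" "\<bar>t\<bar> < t0"
    define y where "y = (1 + t * z t x) * \<sigma> t x"
    have y: "y\<^sup>2 = 1 + t\<^sup>2 * \<zeta> t x" "0 \<le> y" unfolding y_def by (rule y_squared[OF t])+
    have r4: "r4 t x = - ((y - 1)\<^sup>2 / 2) / t ^ 4"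
    proof -
      have "y - 1 - t\<^sup>2 * \<zeta> t x / 2 = - ((y - 1)\<^sup>2 / 2)" using y(1) by algebra
      then show ?thesis unfolding r4_def y_def[symmetric] by simp
    qed
    have "(y - 1) * (y + 1) = t\<^sup>2 * \<zeta> t x" using y(1) by (simp add: power2_eq_square algebra_simps)
    then have "\<bar>y - 1\<bar> * (y + 1) = t\<^sup>2 * \<bar>\<zeta> t x\<bar>"
      using y(2) by (metis abs_mult abs_of_nonneg add_nonneg_nonneg zero_le_one zero_le_power2)
    moreover have "\<bar>y - 1\<bar> \<le> \<bar>y - 1\<bar> * (y + 1)" using y(2) by (simp add: mult_le_cancel_left1)
    moreover have "t\<^sup>2 * \<bar>\<zeta> t x\<bar> \<le> t\<^sup>2 * K" using K[OF t] by (intro mult_left_mono) auto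
    ultimately have "\<bar>y - 1\<bar> \<le> t\<^sup>2 * K" by (metis order_trans)
    then have "\<bar>y - 1\<bar>\<^sup>2 \<le> (t\<^sup>2 * K)\<^sup>2" by (rule power_mono) simp
    then have "(y - 1)\<^sup>2 \<le> K\<^sup>2 * t ^ 4" by (simp add: power_mult_distrib mult.commute)
    then show "\<bar>r4 t x\<bar> \<le> K\<^sup>2 / 2"
      unfolding r4 using t by (simp add: abs_divide divide_le_eq)
  qed
qed

lemma cont:
  assumes t: "t \<noteq> 0" "\<bar>t\<bar> < t0"
  shows "continuous_on B (\<eta> t)" "continuous_on B (\<eta>' t)" "continuous_on B (d t)" "continuous_on B (e t)"
    "continuous_on B (\<sigma> t)"
proof -
  have "continuous_on UNIV (\<eta> t)" using der[OF t] by (auto intro: DERIV_continuous_on)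
  then show 1: "continuous_on B (\<eta> t)" by (rule continuous_on_subset) simp
  show 2: "continuous_on B (\<eta>' t)" using cont_\<eta>'[OF t] by (rule continuous_on_subset) simp
  show "continuous_on B (d t)" "continuous_on B (e t)"
    using 1 2 t unfolding d_def e_def by (auto intro!: continuous_intros)
  show "continuous_on B (\<sigma> t)" using 1 2 unfolding \<sigma>_def by (intro continuous_intros)
qed

lemma identity_has_integral:
  assumes t: "t \<noteq> 0" "\<bar>t\<bar> < t0"
    and S: "\<And>z. (S has_real_derivative C z) (at z)"
      "\<And>z. (C has_real_derivative ((real n)\<^sup>2 - 1) * S z) (at z)"
    and T: "\<And>z. (T has_real_derivative S z) (at z)" "\<And>z. C z = 1 + ((real n)\<^sup>2 - 1) * T z"
    and init: "S 0 = 0" "T 0 = 0"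
  shows "((\<lambda>x. cos (real n * x) * (S (1 + t * z t x) * \<sigma> t x + c t * (1 - T (1 + t * z t x))
     - cos (l t - 1))) has_integral 0) {0..2 * pi}"
proof -
  have ST: "continuous_on UNIV S" "continuous_on UNIV T"
    using DERIV_continuous_on[of UNIV S C] DERIV_continuous_on[of UNIV T S] S T by auto
  have "continuous_on {0..2 * pi} (\<lambda>x. cos (real n * x) * (S (1 + \<eta> t x) * \<sigma> t x + c t * (1 - T (1 + \<eta> t x))
     - cos (l t - 1)))"
    by (intro continuous_intros continuous_on_compose2[OF ST(1)] continuous_on_compose2[OF ST(2)] cont[OF t]) auto
  then have "(\<lambda>x. cos (real n * x) * (S (1 + \<eta> t x) * \<sigma> t x + c t * (1 - T (1 + \<eta> t x))
     - cos (l t - 1))) integrable_on {0..2 * pi}" by (rule integrable_continuous_real)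
  from integrable_integral[OF this] identity[OF t S T init]
  show ?thesis unfolding \<sigma>_def c_def \<eta>_eq[OF t(1)] by simp
qed

text \<open>
  For the critical mode \<open>S z = z\<close>, so the surface term is exactly \<open>(1 + \<eta>) \<sigma>\<close> and has no part linear in \<open>\<eta>\<close>:
  this is the solvability condition.
\<close>

lemma first_mode:
  assumes t: "t \<noteq> 0" "\<bar>t\<bar> < t0"
  shows "((\<lambda>x. cos x * ((1 + t * z t x) * \<sigma> t x - 1 - c t * (t * z t x + t\<^sup>2 * (z t x)\<^sup>2 / 2)))
    has_integral 0) {0..2 * pi}"
proof -
  have "((\<lambda>x. cos (real 1 * x) * ((1 + t * z t x) * \<sigma> t x + c t * (1 - (1 + t * z t x)\<^sup>2 / 2)
     - cos (l t - 1))) has_integral 0) {0..2 * pi}"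
    by (rule identity_has_integral[OF t, where C = "\<lambda>_. 1"]) (auto intro!: derivative_eq_intros)
  from has_integral_diff[OF this has_integral_mult_right[OF has_integral_cos, of "1 + c t / 2 - cos (l t - 1)"]]
  have "((\<lambda>x. cos (real 1 * x) * ((1 + t * z t x) * \<sigma> t x + c t * (1 - (1 + t * z t x)\<^sup>2 / 2)
     - cos (l t - 1)) - (1 + c t / 2 - cos (l t - 1)) * cos x) has_integral 0) {0..2 * pi}" by simp
  moreover have "cos (real 1 * x) * ((1 + t * z t x) * \<sigma> t x + c t * (1 - (1 + t * z t x)\<^sup>2 / 2)
     - cos (l t - 1)) - (1 + c t / 2 - cos (l t - 1)) * cos x =
     cos x * ((1 + t * z t x) * \<sigma> t x - 1 - c t * (t * z t x + t\<^sup>2 * (z t x)\<^sup>2 / 2))" for x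
    unfolding of_nat_1 mult_1 by algebra
  ultimately show ?thesis by (simp only:)
qed

text \<open>
  At second order the quadratic terms in \<open>cos x\<close> and \<open>sin x\<close> are orthogonal to \<open>cos x\<close>, which leaves
  \<open>\<pi> cos \<lambda> = O(t\<^sup>2)\<close>; in particular \<open>\<lambda>'(0) = 0\<close>.
\<close>

lemma bdd_g: "bdd (\<lambda>t x. g t)"
proof -
  define r where "r t x = cos x * ((- 2 * sin x * e t x + t * (e t x)\<^sup>2 - 6 * cos x * d t x - 3 * t * (d t x)\<^sup>2
      - 2 * z t x ^ 3 - (\<gamma> t)\<^sup>2 * (2 * z t x + t * (z t x)\<^sup>2)
      - (3 * (z t x)\<^sup>2 + 2 * t * z t x ^ 3 + (\<gamma> t)\<^sup>2 * (1 + t * z t x)\<^sup>2) * t * (q t x)\<^sup>2) / 2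
      + t * r4 t x - \<gamma> t * d t x - \<gamma> t * (z t x)\<^sup>2 / 2)" for t x
  have r: "bdd r" unfolding r_def[abs_def]
    by (intro bounded_family_intros bdd_z bdd_q bdd_\<gamma> bdd_r4 bdd_d bdd_e)
  define f where "f t x = (cos x * ((1 + t * z t x) * \<sigma> t x - 1 - c t * (t * z t x + t\<^sup>2 * (z t x)\<^sup>2 / 2))) / t\<^sup>2" for t x
  define a where "a t x = (1 - (\<gamma> t)\<^sup>2) / 2 * cos x - 2 * cos x ^ 3 - \<gamma> t * (cos x)\<^sup>2" for t x
  have "\<exists>K. \<forall>t. t \<noteq> 0 \<and> \<bar>t\<bar> < t0 \<longrightarrow> \<bar>- \<gamma> t * pi\<bar> \<le> K * \<bar>t\<bar>"
  proof (rule remainder_bound[OF r, of f a])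
    fix t assume t: "t \<noteq> 0" "\<bar>t\<bar> < t0"
    show "(f t has_integral 0) {0..2 * pi}"
      unfolding f_def using has_integral_divide[OF first_mode[OF t], of "t\<^sup>2"] by simp
    show "(a t has_integral - \<gamma> t * pi) {0..2 * pi}"
      unfolding a_def
      using has_integral_diff[OF has_integral_diff[OF has_integral_mult_right[OF has_integral_cos, of "(1 - (\<gamma> t)\<^sup>2) / 2"]
            has_integral_mult_right[OF has_integral_cos_cubed, of 2]]
          has_integral_mult_right[OF has_integral_cos_squared, of "\<gamma> t"]] by simp
    show "f t x = a t x + t * r t x" for x
    proof -
      have ct: "c t = t * \<gamma> t" using t by (simp add: \<gamma>_def)
      have "f t x = (cos x * (t\<^sup>2 * \<zeta> t x / 2 + t ^ 4 * r4 t x - t * \<gamma> t * (t * z t x + t\<^sup>2 * (z t x)\<^sup>2 / 2))) / t\<^sup>2"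
        unfolding f_def y_eq[OF t(1)] ct by simp
      also have "\<dots> = cos x * (\<zeta> t x / 2 + t\<^sup>2 * r4 t x - \<gamma> t * (z t x + t * (z t x)\<^sup>2 / 2))"
        using t(1) by (simp add: field_simps power2_eq_square power4_eq_xxxx)
      also have "\<dots> = a t x + t * r t x"
      proof -
        have s: "(sin x)\<^sup>2 = 1 - (cos x)\<^sup>2" by (simp add: sin_squared_eq)
        show ?thesis using s unfolding a_def r_def \<zeta>_def z_def q_def by algebra
      qed
      finally show ?thesis .
    qed
  qed
  then obtain K where K: "\<And>t. t \<noteq> 0 \<Longrightarrow> \<bar>t\<bar> < t0 \<Longrightarrow> \<bar>- \<gamma> t * pi\<bar> \<le> K * \<bar>t\<bar>" by blast
  show ?thesis
  proof (rule bounded_familyI[of _ _ "K / pi"])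
    fix t x :: real assume t: "t \<noteq> 0" "\<bar>t\<bar> < t0"
    have "\<gamma> t = t * g t" using t(1) by (simp add: \<gamma>_def g_def power2_eq_square)
    then have "\<bar>t\<bar> * (\<bar>g t\<bar> * pi) \<le> \<bar>t\<bar> * K" using K[OF t] by (simp add: abs_mult mult_ac)
    then have "\<bar>g t\<bar> * pi \<le> K" using t(1) by simp
    then show "\<bar>g t\<bar> \<le> K / pi" by (simp add: le_divide_eq)
  qed
qed

text \<open>
  The second-order part of the elevation enters \<open>\<lambda>''(0)\<close> only through its mean and its second harmonic.
\<close>

definition "E0 t = integral {0..2 * pi} (d t)"
definition "E2 t = integral {0..2 * pi} (\<lambda>x. cos (2 * x) * d t x)"

text \<open>
  Remainders of \<open>\<zeta> = sin\<^sup>2 x - 3 cos\<^sup>2 x + t \<rho>\<close> and of the next order, once \<open>\<gamma> = t g\<close> is known.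
\<close>

definition "\<rho>2 t x = (e t x)\<^sup>2 - 3 * (d t x)\<^sup>2 - 2 * d t x * ((z t x)\<^sup>2 + z t x * cos x + (cos x)\<^sup>2)
  - (g t)\<^sup>2 * (1 + t * z t x)\<^sup>2
  - (3 * (z t x)\<^sup>2 + 2 * t * z t x ^ 3 + t\<^sup>2 * (g t)\<^sup>2 * (1 + t * z t x)\<^sup>2) * (q t x)\<^sup>2"

definition "\<rho> t x = - 2 * sin x * e t x - 6 * cos x * d t x - 2 * cos x ^ 3 + t * \<rho>2 t x"

lemma bdd_\<rho>2: "bdd \<rho>2" unfolding \<rho>2_def[abs_def]
  by (intro bounded_family_intros bdd_z bdd_q bdd_g bdd_d bdd_e)

lemma bdd_\<rho>: "bdd \<rho>" unfolding \<rho>_def[abs_def]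
  by (intro bounded_family_intros bdd_\<rho>2 bdd_d bdd_e)

lemma \<zeta>_eq: "t \<noteq> 0 \<Longrightarrow> \<zeta> t x = 1 - 4 * (cos x)\<^sup>2 + t * \<rho> t x"
proof -
  assume t: "t \<noteq> 0"
  have \<gamma>: "\<gamma> t = t * g t" using t by (simp add: \<gamma>_def g_def power2_eq_square)
  have "(sin x)\<^sup>2 = 1 - (cos x)\<^sup>2" by (simp add: sin_squared_eq)
  then show ?thesis unfolding \<zeta>_def \<rho>_def \<rho>2_def \<gamma> z_def q_def by algebra
qed

lemma has_integral_d:
  assumes t: "t \<noteq> 0" "\<bar>t\<bar> < t0"
  shows "(d t has_integral E0 t) {0..2 * pi}" "((\<lambda>x. cos (2 * x) * d t x) has_integral E2 t) {0..2 * pi}"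
  unfolding E0_def E2_def
  by (intro integrable_integral integrable_continuous_real continuous_intros cont[OF t])+

text \<open>
  At third order, \<open>- cos x sin x e - 3 cos\<^sup>2 x d\<close> becomes \<open>(cos\<^sup>2 x - sin\<^sup>2 x - 3 cos\<^sup>2 x) d\<close> after an integration
  by parts.  Only the mean of \<open>d\<close> and its second harmonic survive.
\<close>

lemma third_order:
  "\<exists>K. \<forall>t. t \<noteq> 0 \<and> \<bar>t\<bar> < t0 \<longrightarrow> \<bar>- (3 / 2) * E0 t - 1 / 2 * E2 t - 3 * pi / 4 - g t * pi\<bar> \<le> K * \<bar>t\<bar>"
proof -
  define r where "r t x = cos x * (\<rho>2 t x / 2 + r4 t x - g t * (d t x + (z t x)\<^sup>2 / 2))" for t x
  have r: "bdd r" unfolding r_def[abs_def]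
    by (intro bounded_family_intros bdd_\<rho>2 bdd_z bdd_g bdd_r4 bdd_d)
  define f where "f t x = (cos x * ((1 + t * z t x) * \<sigma> t x - 1 - c t * (t * z t x + t\<^sup>2 * (z t x)\<^sup>2 / 2))) / t ^ 3" for t x
  define a where "a t x = 1 / (2 * t) * cos x - 2 / t * cos x ^ 3
      - (cos (2 * x) * d t x + cos x * sin x * e t x) + - (3 / 2) * d t x - 1 / 2 * (cos (2 * x) * d t x)
      - cos x ^ 4 - g t * (cos x)\<^sup>2" for t x
  show ?thesis
  proof (rule remainder_bound[OF r, of f a])
    fix t assume t: "t \<noteq> 0" "\<bar>t\<bar> < t0"
    show "(f t has_integral 0) {0..2 * pi}"
      unfolding f_def using has_integral_divide[OF first_mode[OF t], of "t ^ 3"] by simp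
    have parts: "((\<lambda>x. cos (2 * x) * d t x + cos x * sin x * e t x) has_integral 0) {0..2 * pi}"
    proof (rule has_integral_antiderivative[where F = "\<lambda>x. cos x * sin x * d t x"])
      fix x
      have "(d t has_real_derivative e t x) (at x)"
        unfolding d_def e_def
        by (rule DERIV_cong[OF DERIV_cdivide[OF DERIV_diff[OF der[OF t] DERIV_cmult[OF DERIV_cos]]]]) simp
      then have dd: "(d t has_real_derivative e t x) (at x)" .
      have dc: "((\<lambda>x. cos x * sin x) has_real_derivative cos (2 * x)) (at x)"
        by (auto intro!: derivative_eq_intros simp: cos_double power2_eq_square)
      show "((\<lambda>x. cos x * sin x * d t x) has_real_derivative
          cos (2 * x) * d t x + cos x * sin x * e t x) (at x)"
        by (rule DERIV_cong[OF DERIV_mult[OF dc dd]]) (simp add: mult.commute)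
    qed simp
    have "(a t has_integral 1 / (2 * t) * 0 - 2 / t * 0 - 0 + - (3 / 2) * E0 t - 1 / 2 * E2 t
        - 3 * pi / 4 - g t * pi) {0..2 * pi}"
      unfolding a_def
      by (intro has_integral_add has_integral_diff has_integral_mult_right has_integral_cos
          has_integral_cos_cubed has_integral_cos_fourth has_integral_cos_squared parts has_integral_d[OF t])
    then show "(a t has_integral - (3 / 2) * E0 t - 1 / 2 * E2 t - 3 * pi / 4 - g t * pi) {0..2 * pi}"
      by simp
    show "f t x = a t x + t * r t x" for x
    proof -
      have ct: "c t = t\<^sup>2 * g t" using t by (simp add: g_def)
      have ta: "t * a t x = 1 / 2 * cos x - 2 * cos x ^ 3
        + t * (- (cos (2 * x) * d t x + cos x * sin x * e t x) - 3 / 2 * d t x - 1 / 2 * (cos (2 * x) * d t x)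
        - cos x ^ 4 - g t * (cos x)\<^sup>2)"
        unfolding a_def using t(1) by (simp add: algebra_simps)
      have "t\<^sup>2 * \<zeta> t x / 2 + t ^ 4 * r4 t x - t\<^sup>2 * g t * (t * z t x + t\<^sup>2 * (z t x)\<^sup>2 / 2) =
        t\<^sup>2 * (\<zeta> t x / 2 + t\<^sup>2 * r4 t x - g t * (t * z t x + t\<^sup>2 * (z t x)\<^sup>2 / 2))" by algebra
      then have "f t x = t\<^sup>2 * (cos x * (\<zeta> t x / 2 + t\<^sup>2 * r4 t x - g t * (t * z t x + t\<^sup>2 * (z t x)\<^sup>2 / 2))) / t ^ 3"
        unfolding f_def y_eq[OF t(1)] ct by simp
      then have "t * f t x = cos x * (\<zeta> t x / 2 + t\<^sup>2 * r4 t x - g t * (t * z t x + t\<^sup>2 * (z t x)\<^sup>2 / 2))"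
        using t(1) by (simp add: power2_eq_square power3_eq_cube)
      also have "\<dots> = t * a t x + t * (t * r t x)"
        unfolding ta r_def \<zeta>_eq[OF t(1)] \<rho>_def z_def cos_double_cos
        by (simp add: field_simps power2_eq_square power3_eq_cube power4_eq_xxxx)
      finally have "t * f t x = t * (a t x + t * r t x)" by (simp add: distrib_left)
      then show ?thesis using t(1) by simp
    qed
  qed
qed

definition "r\<sigma> t x = (\<sigma> t x - (1 - t * z t x + t\<^sup>2 * ((z t x)\<^sup>2 + \<zeta> t x / 2))) / t ^ 3"

lemma \<sigma>_eq: "t \<noteq> 0 \<Longrightarrow> \<sigma> t x = 1 - t * z t x + t\<^sup>2 * ((z t x)\<^sup>2 + \<zeta> t x / 2) + t ^ 3 * r\<sigma> t x"
  unfolding r\<sigma>_def by simp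

lemma bdd_r\<sigma>: "bdd r\<sigma>"
proof -
  have "bdd (\<lambda>t x. t * r4 t x - z t x ^ 3 - z t x * \<zeta> t x / 2)"
    by (intro bounded_family_intros bdd_r4 bdd_z bdd_\<zeta>)
  then obtain K where K: "0 \<le> K"
      "\<And>t x. t \<noteq> 0 \<Longrightarrow> \<bar>t\<bar> < t0 \<Longrightarrow> \<bar>t * r4 t x - z t x ^ 3 - z t x * \<zeta> t x / 2\<bar> \<le> K"
    by (elim bounded_familyE) blast
  show ?thesis
  proof (rule bounded_familyI[of _ _ "2 * K"])
    fix t x assume t: "t \<noteq> 0" "\<bar>t\<bar> < t0"
    have "t ^ 3 * ((1 + t * z t x) * r\<sigma> t x) = t ^ 3 * (t * r4 t x - z t x ^ 3 - z t x * \<zeta> t x / 2)"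
    proof -
      define m where "m = 1 - t * z t x + t\<^sup>2 * ((z t x)\<^sup>2 + \<zeta> t x / 2)"
      have m: "t ^ 3 * r\<sigma> t x = \<sigma> t x - m"
        using \<sigma>_eq[OF t(1), of x] by (simp add: m_def)
      have "t ^ 3 * ((1 + t * z t x) * r\<sigma> t x) = (1 + t * z t x) * (t ^ 3 * r\<sigma> t x)"
        by (simp only: mult.left_commute)
      also have "\<dots> = (1 + t * z t x) * \<sigma> t x - (1 + t * z t x) * m"
        unfolding m by (rule right_diff_distrib)
      also have "\<dots> = t ^ 3 * (t * r4 t x - z t x ^ 3 - z t x * \<zeta> t x / 2)"
        unfolding y_eq[OF t(1)] m_def
        by (simp add: field_simps power2_eq_square power3_eq_cube power4_eq_xxxx)
      finally show ?thesis .
    qed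
    then have "(1 + t * z t x) * r\<sigma> t x = t * r4 t x - z t x ^ 3 - z t x * \<zeta> t x / 2"
      using t(1) by simp
    then have "\<bar>1 + t * z t x\<bar> * \<bar>r\<sigma> t x\<bar> \<le> K" using K(2)[OF t, of x] by (simp flip: abs_mult)
    moreover have "1 / 2 \<le> \<bar>1 + t * z t x\<bar>"
      using small(1)[OF t, of x] \<eta>_eq[OF t(1), of x] by linarith
    then have "1 / 2 * \<bar>r\<sigma> t x\<bar> \<le> \<bar>1 + t * z t x\<bar> * \<bar>r\<sigma> t x\<bar>" by (intro mult_right_mono) auto
    ultimately show "\<bar>r\<sigma> t x\<bar> \<le> 2 * K" by linarith
  qed
qed

text \<open>
  For a mode other than the critical one the linear term has the coefficient \<open>C 1 - S 1 \<noteq> 0\<close>, and the second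
  order of the identity determines the corresponding moment of \<open>d\<close>.
\<close>

lemma mode_expansion:
  fixes n :: nat and S C T :: "real \<Rightarrow> real" and m m2 :: real
  assumes S: "\<And>z. (S has_real_derivative C z) (at z)"
      "\<And>z. (C has_real_derivative ((real n)\<^sup>2 - 1) * S z) (at z)"
    and T: "\<And>z. (T has_real_derivative S z) (at z)" "\<And>z. C z = 1 + ((real n)\<^sup>2 - 1) * T z"
    and init: "S 0 = 0" "T 0 = 0"
    and m: "((\<lambda>x. cos (real n * x)) has_integral m) {0..2 * pi}"
      "((\<lambda>x. cos (real n * x) * cos x) has_integral 0) {0..2 * pi}"
      "((\<lambda>x. cos (real n * x) * (cos x)\<^sup>2) has_integral m2) {0..2 * pi}"
    and En: "\<And>t. t \<noteq> 0 \<Longrightarrow> \<bar>t\<bar> < t0 \<Longrightarrow> ((\<lambda>x. cos (real n * x) * d t x) has_integral En t) {0..2 * pi}"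
  shows "\<exists>K. \<forall>t. t \<noteq> 0 \<and> \<bar>t\<bar> < t0 \<longrightarrow>
    \<bar>(S 1 + c t * (1 - T 1) - cos (l t - 1)) / t\<^sup>2 * m + (C 1 - S 1) * En t + S 1 * (m / 2 - m2)
      + (((real n)\<^sup>2 - 1) * S 1 / 2 - C 1) * m2\<bar> \<le> K * \<bar>t\<bar>"
proof -
  define k where "k = ((real n)\<^sup>2 - 1) * S 1 / 2"
  define rS where "rS t x = (S (1 + t * z t x) - S 1 - C 1 * (t * z t x) - k * (t * z t x)\<^sup>2) / t ^ 3" for t x
  define rT where "rT t x = (T (1 + t * z t x) - T 1) / t" for t x
  obtain Z where Z: "\<And>t x. t \<noteq> 0 \<Longrightarrow> \<bar>t\<bar> < t0 \<Longrightarrow> \<bar>z t x\<bar> \<le> Z"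
    using bdd_z by (elim bounded_familyE) blast
  have h: "\<bar>t * z t x\<bar> \<le> 1 / 4" if "t \<noteq> 0" "\<bar>t\<bar> < t0" for t x
    using small(1)[OF that, of x] \<eta>_eq[OF that(1), of x] by simp
  have contS: "continuous_on UNIV S" using DERIV_continuous_on[of UNIV S C] S(1) by auto
  have bdd_rS: "bdd rS"
  proof -
    obtain K where K: "\<And>h. \<bar>h\<bar> \<le> 1 / 4 \<Longrightarrow> \<bar>S (1 + h) - S 1 - C 1 * h - k * h\<^sup>2\<bar> \<le> K * \<bar>h\<bar> ^ 3"
      using second_order_Taylor[OF S] unfolding k_def by blast
    have "0 \<le> K * \<bar>1/4::real\<bar> ^ 3" by (rule order_trans[OF abs_ge_zero K]) simp
    then have K0: "0 \<le> K" by (simp add: zero_le_mult_iff)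
    show ?thesis
    proof (rule bounded_familyI[of _ _ "K * Z ^ 3"])
      fix t x assume t: "t \<noteq> 0" "\<bar>t\<bar> < t0"
      have "\<bar>rS t x\<bar> * \<bar>t\<bar> ^ 3 = \<bar>S (1 + t * z t x) - S 1 - C 1 * (t * z t x) - k * (t * z t x)\<^sup>2\<bar>"
        unfolding rS_def using t(1) by (simp add: abs_divide power_abs)
      also have "\<dots> \<le> K * \<bar>t * z t x\<bar> ^ 3" by (rule K[OF h[OF t]])
      also have "\<dots> = K * \<bar>z t x\<bar> ^ 3 * \<bar>t\<bar> ^ 3" by (simp add: abs_mult power_mult_distrib)
      finally have "\<bar>rS t x\<bar> \<le> K * \<bar>z t x\<bar> ^ 3" using t(1) by simp
      also have "\<dots> \<le> K * Z ^ 3" using K0 Z[OF t] by (intro mult_left_mono power_mono) auto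
      finally show "\<bar>rS t x\<bar> \<le> K * Z ^ 3" .
    qed
  qed
  have bdd_rT: "bdd rT"
  proof -
    obtain K where K: "\<And>h. \<bar>h\<bar> \<le> 1 / 4 \<Longrightarrow> \<bar>T (1 + h) - T 1\<bar> \<le> K * \<bar>h\<bar>"
      using Lipschitz_at_1[OF T(1) contS] by blast
    have "0 \<le> K * \<bar>1/4::real\<bar>" by (rule order_trans[OF abs_ge_zero K]) simp
    then have K0: "0 \<le> K" by (simp add: zero_le_mult_iff)
    show ?thesis
    proof (rule bounded_familyI[of _ _ "K * Z"])
      fix t x assume t: "t \<noteq> 0" "\<bar>t\<bar> < t0"
      have "\<bar>rT t x\<bar> * \<bar>t\<bar> = \<bar>T (1 + t * z t x) - T 1\<bar>"
        unfolding rT_def using t(1) by (simp add: abs_divide)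
      also have "\<dots> \<le> K * \<bar>t * z t x\<bar>" by (rule K[OF h[OF t]])
      also have "\<dots> = K * \<bar>z t x\<bar> * \<bar>t\<bar>" by (simp add: abs_mult)
      finally have "\<bar>rT t x\<bar> \<le> K * \<bar>z t x\<bar>" using t(1) by simp
      also have "\<dots> \<le> K * Z" using K0 Z[OF t] by (intro mult_left_mono) auto
      finally show "\<bar>rT t x\<bar> \<le> K * Z" .
    qed
  qed
  define P where "P t x = 1 - t * z t x + t\<^sup>2 * ((z t x)\<^sup>2 + \<zeta> t x / 2) + t ^ 3 * r\<sigma> t x" for t x
  define r where "r t x = cos (real n * x) * (S 1 * r\<sigma> t x + C 1 * z t x * ((z t x)\<^sup>2 + \<zeta> t x / 2 + t * r\<sigma> t x)
      + k * (z t x)\<^sup>2 * (- z t x + t * ((z t x)\<^sup>2 + \<zeta> t x / 2) + t\<^sup>2 * r\<sigma> t x) + rS t x * P t x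
      - g t * rT t x + S 1 * \<rho> t x / 2
      + (S 1 + k - C 1) * (2 * cos x * d t x + t * (d t x)\<^sup>2))" for t x
  have r: "bdd r" unfolding r_def[abs_def] P_def[abs_def]
    by (intro bounded_family_intros bdd_r\<sigma> bdd_z bdd_\<zeta> bdd_rS bdd_g bdd_rT bdd_\<rho> bdd_d)
  define \<kappa> where "\<kappa> t = (S 1 + c t * (1 - T 1) - cos (l t - 1)) / t\<^sup>2" for t
  define f where "f t x = (cos (real n * x) * (S (1 + t * z t x) * \<sigma> t x + c t * (1 - T (1 + t * z t x))
     - cos (l t - 1))) / t\<^sup>2" for t x
  define a where "a t x = \<kappa> t * cos (real n * x) + (C 1 - S 1) / t * (cos (real n * x) * cos x)
     + (C 1 - S 1) * (cos (real n * x) * d t x)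
     + (S 1 / 2 * cos (real n * x) - S 1 * (cos (real n * x) * (cos x)\<^sup>2))
     + (k - C 1) * (cos (real n * x) * (cos x)\<^sup>2)" for t x
  show ?thesis
    unfolding k_def[symmetric] \<kappa>_def[symmetric]
  proof (rule remainder_bound[OF r, of f a])
    fix t assume t: "t \<noteq> 0" "\<bar>t\<bar> < t0"
    show "(f t has_integral 0) {0..2 * pi}"
      unfolding f_def using has_integral_divide[OF identity_has_integral[OF t S T init], of "t\<^sup>2"] by simp
    have "(a t has_integral \<kappa> t * m + (C 1 - S 1) / t * 0 + (C 1 - S 1) * En t + (S 1 / 2 * m - S 1 * m2)
      + (k - C 1) * m2) {0..2 * pi}"
      unfolding a_def
      by (intro has_integral_add has_integral_diff has_integral_mult_right m En[OF t])
    then show "(a t has_integral \<kappa> t * m + (C 1 - S 1) * En t + S 1 * (m / 2 - m2) + (k - C 1) * m2) {0..2 * pi}"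
      by (simp add: algebra_simps)
    show "f t x = a t x + t * r t x" for x
    proof -
      define D where "D = C 1 - S 1"
      have Se: "S (1 + t * z t x) = S 1 + C 1 * (t * z t x) + k * (t * z t x)\<^sup>2 + t ^ 3 * rS t x"
        unfolding rS_def using t(1) by simp
      have Te: "T (1 + t * z t x) = T 1 + t * rT t x" unfolding rT_def using t(1) by simp
      have \<kappa>e: "S 1 + c t * (1 - T 1) - cos (l t - 1) = t\<^sup>2 * \<kappa> t" unfolding \<kappa>_def using t(1) by simp
      have ct: "c t = t\<^sup>2 * g t" using t by (simp add: g_def)
      have "t\<^sup>2 * (a t x + t * r t x) = t\<^sup>2 * \<kappa> t * cos (real n * x) + t * (D * (cos (real n * x) * cos x))
          + t\<^sup>2 * (D * (cos (real n * x) * d t x)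
          + (S 1 / 2 * cos (real n * x) - S 1 * (cos (real n * x) * (cos x)\<^sup>2))
          + (k - C 1) * (cos (real n * x) * (cos x)\<^sup>2) + t * r t x)"
        unfolding a_def D_def[symmetric] using t(1) by (simp add: algebra_simps power2_eq_square)
      also have "\<dots> = cos (real n * x) * (S (1 + t * z t x) * P t x + c t * (1 - T (1 + t * z t x))
          - cos (l t - 1))"
      proof -
        have "S (1 + t * z t x) * P t x + c t * (1 - T (1 + t * z t x)) - cos (l t - 1) =
          S (1 + t * z t x) * P t x - S 1 + t\<^sup>2 * \<kappa> t - t ^ 3 * g t * rT t x"
          unfolding Te \<kappa>e[symmetric] using ct by algebra
        moreover have "t\<^sup>2 * \<kappa> t * cos (real n * x) + t * (D * (cos (real n * x) * cos x))
          + t\<^sup>2 * (D * (cos (real n * x) * d t x)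
          + (S 1 / 2 * cos (real n * x) - S 1 * (cos (real n * x) * (cos x)\<^sup>2))
          + (k - C 1) * (cos (real n * x) * (cos x)\<^sup>2) + t * r t x) =
          cos (real n * x) * (S (1 + t * z t x) * P t x - S 1 + t\<^sup>2 * \<kappa> t - t ^ 3 * g t * rT t x)"
          unfolding Se unfolding r_def P_def D_def \<zeta>_eq[OF t(1)] z_def
          by (simp add: field_simps power2_eq_square power3_eq_cube)
        ultimately show ?thesis by simp
      qed
      also have "P t x = \<sigma> t x" unfolding P_def using \<sigma>_eq[OF t(1), of x] by simp
      finally show ?thesis unfolding f_def using t(1) by (simp add: field_simps)
    qed
  qed
qed

lemma tendsto_0_of_bound:
  assumes "0 < t0" "\<exists>K. \<forall>t. t \<noteq> 0 \<and> \<bar>t\<bar> < t0 \<longrightarrow> \<bar>f t\<bar> \<le> K * \<bar>t\<bar>"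
  shows "(f \<longlongrightarrow> 0) (at (0::real))"
proof -
  obtain K where K: "\<And>t. t \<noteq> 0 \<Longrightarrow> \<bar>t\<bar> < t0 \<Longrightarrow> \<bar>f t\<bar> \<le> K * \<bar>t\<bar>" using assms(2) by blast
  have "((\<lambda>t. K * \<bar>t\<bar>) \<longlongrightarrow> 0) (at (0::real))" by (auto intro!: tendsto_eq_intros)
  then show ?thesis
    by (rule Lim_null_comparison[rotated])
      (use K assms(1) in \<open>auto simp: eventually_at dist_norm intro!: exI[of _ t0]\<close>)
qed

text \<open>
  The constant terms of the mode 0 do not vanish identically, but they combine to
  \<open>sin 1 (1 - sin \<lambda>)\<close>, which is of fourth order in \<open>t\<close>.
\<close>

lemma mean_limit:
  assumes "0 < t0"
  shows "(E0 \<longlongrightarrow> pi * (cos 1 + sin 1 / 2) / (cos 1 - sin 1)) (at 0)"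
proof -
  define \<kappa> where "\<kappa> t = (sin 1 + c t * (1 - (1 - cos 1)) - cos (l t - 1)) / t\<^sup>2" for t
  have "\<exists>K. \<forall>t. t \<noteq> 0 \<and> \<bar>t\<bar> < t0 \<longrightarrow> \<bar>\<kappa> t\<bar> \<le> K * \<bar>t\<bar>"
  proof -
    have "bdd (\<lambda>t x. (g t)\<^sup>2 * t)" by (intro bounded_family_intros bdd_g)
    then obtain K where K: "\<And>t. t \<noteq> 0 \<Longrightarrow> \<bar>t\<bar> < t0 \<Longrightarrow> \<bar>(g t)\<^sup>2 * t\<bar> \<le> K"
      by (elim bounded_familyE) blast
    have "\<bar>\<kappa> t\<bar> \<le> K * \<bar>t\<bar>" if t: "t \<noteq> 0" "\<bar>t\<bar> < t0" for t
    proof -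
      have "\<kappa> t = sin 1 * (1 - sin (l t)) / t\<^sup>2"
        unfolding \<kappa>_def c_def by (simp add: cos_diff algebra_simps)
      moreover have "0 \<le> sin (1::real)" "0 \<le> 1 - sin (l t)"
        using cos_1_less_sin_1 half_less_cos_1 by auto
      ultimately have "\<bar>\<kappa> t\<bar> = sin 1 * (1 - sin (l t)) / t\<^sup>2" by simp
      also have "\<dots> \<le> 1 * (1 - sin (l t)) / t\<^sup>2"
        using \<open>0 \<le> 1 - sin (l t)\<close> by (intro divide_right_mono mult_right_mono) auto
      also have "\<dots> \<le> (c t)\<^sup>2 / t\<^sup>2"
      proof (rule divide_right_mono)
        have "sin (l t) * sin (l t) \<le> 1 * sin (l t)"
          using sin_l[OF t] by (intro mult_right_mono) auto
        then show "1 * (1 - sin (l t)) \<le> (c t)\<^sup>2"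
          unfolding c_def cos_squared_eq by (simp add: power2_eq_square)
      qed simp
      also have "\<dots> = \<bar>(g t)\<^sup>2 * t\<bar> * \<bar>t\<bar>"
      proof -
        have "\<bar>(g t)\<^sup>2 * t\<bar> * \<bar>t\<bar> = (g t)\<^sup>2 * (t * t)" by (simp add: abs_mult)
        also have "\<dots> = (c t)\<^sup>2 / t\<^sup>2" using t(1) by (simp add: g_def power2_eq_square)
        finally show ?thesis by simp
      qed
      also have "\<dots> \<le> K * \<bar>t\<bar>" using K[OF t] by (intro mult_right_mono) auto
      finally show ?thesis .
    qed
    then show ?thesis by blast
  qed
  then have \<kappa>: "(\<kappa> \<longlongrightarrow> 0) (at 0)" by (rule tendsto_0_of_bound[OF assms])
  have "\<exists>K. \<forall>t. t \<noteq> 0 \<and> \<bar>t\<bar> < t0 \<longrightarrow>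
    \<bar>(sin 1 + c t * (1 - (1 - cos 1)) - cos (l t - 1)) / t\<^sup>2 * (2 * pi) + (cos 1 - sin 1) * E0 t
      + sin 1 * (2 * pi / 2 - pi) + (((real 0)\<^sup>2 - 1) * sin 1 / 2 - cos 1) * pi\<bar> \<le> K * \<bar>t\<bar>"
  proof (rule mode_expansion[where n = 0 and S = sin and C = cos and T = "\<lambda>z. 1 - cos z"])
    show "((\<lambda>x. cos (real 0 * x)) has_integral 2 * pi) {0..2 * pi}"
      using has_integral_const_real[of "1::real" 0 "2 * pi"] by simp
  qed (use has_integral_cos has_integral_cos_squared has_integral_d
      in \<open>auto intro!: derivative_eq_intros\<close>)
  from tendsto_0_of_bound[OF assms this]
  have "((\<lambda>t. \<kappa> t * (2 * pi) + (cos 1 - sin 1) * E0 t - (sin 1 / 2 + cos 1) * pi) \<longlongrightarrow> 0) (at 0)"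
    unfolding \<kappa>_def[symmetric] by (simp add: algebra_simps)
  from tendsto_diff[OF this tendsto_mult_right[OF \<kappa>, of "2 * pi"]]
  have "((\<lambda>t. (cos 1 - sin 1) * E0 t - (sin 1 / 2 + cos 1) * pi) \<longlongrightarrow> 0) (at 0)" by simp
  from tendsto_add[OF this tendsto_const[of "(sin 1 / 2 + cos 1) * pi"]]
  have "((\<lambda>t. (cos 1 - sin 1) * E0 t) \<longlongrightarrow> (sin 1 / 2 + cos 1) * pi) (at 0)" by simp
  moreover have "cos 1 - sin 1 \<noteq> (0::real)" using cos_1_less_sin_1 by simp
  ultimately have "((\<lambda>t. (cos 1 - sin 1) * E0 t / (cos 1 - sin 1)) \<longlongrightarrow>
      (sin 1 / 2 + cos 1) * pi / (cos 1 - sin 1)) (at 0)"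
    by (intro tendsto_divide tendsto_const)
  then show ?thesis
    using \<open>cos 1 - sin 1 \<noteq> (0::real)\<close> by (simp add: mult.commute add.commute)
qed

lemma second_harmonic_limit:
  assumes "0 < t0"
  shows "(E2 \<longlongrightarrow> pi * (cosh (sqrt 3) / 2 - hyp 1 / 4) / (cosh (sqrt 3) - hyp 1)) (at 0)"
proof -
  have "\<exists>K. \<forall>t. t \<noteq> 0 \<and> \<bar>t\<bar> < t0 \<longrightarrow>
    \<bar>(hyp 1 + c t * (1 - (cosh (sqrt 3 * 1) - 1) / 3) - cos (l t - 1)) / t\<^sup>2 * 0 + (cosh (sqrt 3 * 1) - hyp 1) * E2 t
      + hyp 1 * (0 / 2 - pi / 2) + (((real 2)\<^sup>2 - 1) * hyp 1 / 2 - cosh (sqrt 3 * 1)) * (pi / 2)\<bar> \<le> K * \<bar>t\<bar>"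
  proof (rule mode_expansion[where n = 2 and S = hyp and C = "\<lambda>z. cosh (sqrt 3 * z)"
        and T = "\<lambda>z. (cosh (sqrt 3 * z) - 1) / 3"])
    show "(hyp has_real_derivative cosh (sqrt 3 * z)) (at z)" for z by (rule has_derivative_hyp)
    show "((\<lambda>z. cosh (sqrt 3 * z)) has_real_derivative ((real 2)\<^sup>2 - 1) * hyp z) (at z)" for z
      using has_derivative_cosh_sqrt_3 by simp
    show "((\<lambda>z. (cosh (sqrt 3 * z) - 1) / 3) has_real_derivative hyp z) (at z)" for z
      using DERIV_cdivide[OF DERIV_diff[OF has_derivative_cosh_sqrt_3[of z] DERIV_const[of 1]], of 3] by simp
  qed (use has_integral_cos_double has_integral_cos_double_cos has_integral_cos_double_cos_squared
      has_integral_d in \<open>auto simp: hyp_def diff_divide_distrib\<close>)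
  from tendsto_0_of_bound[OF assms this]
  have "((\<lambda>t. (cosh (sqrt 3) - hyp 1) * E2 t - (cosh (sqrt 3) / 2 - hyp 1 / 4) * pi) \<longlongrightarrow> 0) (at 0)"
    by (simp add: algebra_simps)
  from tendsto_add[OF this tendsto_const[of "(cosh (sqrt 3) / 2 - hyp 1 / 4) * pi"]]
  have "((\<lambda>t. (cosh (sqrt 3) - hyp 1) * E2 t) \<longlongrightarrow> (cosh (sqrt 3) / 2 - hyp 1 / 4) * pi) (at 0)" by simp
  from tendsto_divide[OF this tendsto_const[of "cosh (sqrt 3) - hyp 1"]]
  moreover have "cosh (sqrt 3) - hyp 1 \<noteq> 0" using sinh_less_cosh_sqrt_3 by (simp add: hyp_def field_simps)
  ultimately show ?thesis by (simp add: mult.commute)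
qed

lemma cos_l_limit:
  assumes "0 < t0"
  shows "((\<lambda>t. cos (l t) / t\<^sup>2) \<longlongrightarrow> - (3 / 2 + 3 * ((cos 1 + sin 1 / 2) / (cos 1 - sin 1))
    + (cosh (sqrt 3) / 2 - hyp 1 / 4) / (cosh (sqrt 3) - hyp 1)) / 2) (at 0)"
proof -
  define p where "p = (cos 1 + sin 1 / 2) / (cos 1 - sin (1::real))"
  define p2 where "p2 = (cosh (sqrt 3) / 2 - hyp 1 / 4) / (cosh (sqrt 3) - hyp 1)"
  have E: "(E0 \<longlongrightarrow> pi * p) (at 0)" "(E2 \<longlongrightarrow> pi * p2) (at 0)"
    using mean_limit[OF assms] second_harmonic_limit[OF assms] by (simp_all add: p_def p2_def)
  note 3 = tendsto_0_of_bound[OF assms third_order]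
  have "((\<lambda>t. (- (3 / 2) * E0 t - 1 / 2 * E2 t - 3 * pi / 4
      - (- (3 / 2) * E0 t - 1 / 2 * E2 t - 3 * pi / 4 - g t * pi)) / pi) \<longlongrightarrow>
      (- (3 / 2) * (pi * p) - 1 / 2 * (pi * p2) - 3 * pi / 4 - 0) / pi) (at 0)"
    by (intro tendsto_intros E 3) simp
  moreover have "(- (3 / 2) * (pi * p) - 1 / 2 * (pi * p2) - 3 * pi / 4 - 0) / pi =
      - (3 / 2 + 3 * p + p2) / 2" by (simp add: field_simps)
  moreover have "(- (3 / 2) * E0 t - 1 / 2 * E2 t - 3 * pi / 4
      - (- (3 / 2) * E0 t - 1 / 2 * E2 t - 3 * pi / 4 - g t * pi)) / pi = g t" for t by simp
  ultimately have "(g \<longlongrightarrow> - (3 / 2 + 3 * p + p2) / 2) (at 0)" by (simp only:)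
  then show ?thesis unfolding g_def[abs_def] c_def p_def p2_def .
qed

end

section \<open>The bifurcation curve\<close>

text \<open>
  The curve parameter is restricted so that the waves stay shallow, \<open>\<lambda>\<close> stays close to \<open>\<pi> / 2\<close> and the
  vertical derivative of the stream function at the surface keeps its sign.
\<close>

lemma small_waves_of_curve:
  assumes \<beta>: "0 < \<beta>" "\<beta> < 1"
    and curve: "lambda_bifurcation_curve 1 \<beta> 1 (1, -1, pi / 2) \<epsilon> w lam"
  shows "\<exists>t0 A. 0 < t0 \<and> small_waves t0 A (\<lambda>t. fst (w t)) (\<lambda>t. deriv (fst (w t))) lam"
proof -
  define ws where "ws = w_star 1 1 (1, -1, pi / 2)"
  have ws: "ws \<in> X 1 \<beta>" unfolding ws_def by (rule w_star_in_X[OF \<beta>])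
  have sc: "solution_curve 1 \<beta> ws \<epsilon> w (\<lambda>t. (1, -1, lam t))"
    and smooth: "smooth_real_on {-\<epsilon><..<\<epsilon>} lam" and lam0: "lam 0 = pi / 2"
    using curve unfolding lambda_bifurcation_curve_def ws_def by auto
  obtain K \<delta> where \<epsilon>: "0 < \<epsilon>" and \<delta>: "0 < \<delta>"
    and K: "\<And>t. \<bar>t\<bar> < \<delta> \<Longrightarrow> X_norm \<beta> (w t - t *\<^sub>R ws) \<le> K * t\<^sup>2"
    and w: "\<And>t. t \<in> {-\<epsilon><..<\<epsilon>} \<Longrightarrow> w t \<in> \<O> 1 \<beta>"
      "\<And>t. t \<in> {-\<epsilon><..<\<epsilon>} \<Longrightarrow> F (w t) (1, -1, lam t) = 0"
    using sc unfolding solution_curve_def by blast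
  define A0 where "A0 = max K 1"
  have A0: "1 \<le> A0" "K \<le> A0" by (auto simp: A0_def)
  have "lam differentiable (at 0)" using smooth \<epsilon> unfolding smooth_real_on_def
    by (metis funpow_0 greaterThanLessThan_iff neg_less_0_iff_less)
  then obtain L where L: "(lam has_real_derivative L) (at 0)" by (auto simp: real_differentiable_def)
  have "((\<lambda>t. cos (lam t)) has_real_derivative - L) (at 0)"
    by (rule DERIV_cong[OF DERIV_fun_cos[OF L]]) (simp add: lam0)
  then have "((\<lambda>t. cos (lam t) / t) \<longlongrightarrow> - L) (at 0)" by (simp add: DERIV_def lam0)
  then have "((\<lambda>t. \<bar>cos (lam t) / t\<bar>) \<longlongrightarrow> \<bar>L\<bar>) (at 0)" using tendsto_rabs by fastforce
  then have "eventually (\<lambda>t. \<bar>cos (lam t) / t\<bar> < \<bar>L\<bar> + 1) (at 0)"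
    by (rule order_tendstoD) simp
  moreover have lam_lim: "(lam \<longlongrightarrow> pi / 2) (at 0)" using DERIV_isCont[OF L] by (simp add: isCont_def lam0)
  have "((\<lambda>t. \<bar>cos (lam t)\<bar>) \<longlongrightarrow> \<bar>cos (pi / 2)\<bar>) (at 0)" by (intro tendsto_intros lam_lim)
  then have "eventually (\<lambda>t. \<bar>cos (lam t)\<bar> < 1 / 4) (at 0)" by (rule order_tendstoD) simp
  moreover have "((\<lambda>t. sin (lam t)) \<longlongrightarrow> sin (pi / 2)) (at 0)" by (intro tendsto_intros lam_lim)
  then have "eventually (\<lambda>t. 1 / 2 < sin (lam t)) (at 0)" by (rule order_tendstoD) simp
  ultimately have "eventually (\<lambda>t. \<bar>cos (lam t) / t\<bar> < \<bar>L\<bar> + 1 \<and> \<bar>cos (lam t)\<bar> < 1 / 4 \<and>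
      1 / 2 < sin (lam t)) (at 0)" by (intro eventually_conj)
  then obtain \<delta>' where \<delta>': "0 < \<delta>'" and near: "\<And>t. t \<noteq> 0 \<Longrightarrow> \<bar>t\<bar> < \<delta>' \<Longrightarrow>
      \<bar>cos (lam t) / t\<bar> < \<bar>L\<bar> + 1 \<and> \<bar>cos (lam t)\<bar> < 1 / 4 \<and> 1 / 2 < sin (lam t)"
    unfolding eventually_at by (auto simp: dist_norm)
  define t0 where "t0 = min (min \<epsilon> \<delta>) (min \<delta>' (1 / (8 * A0)))"
  define A where "A = max A0 (\<bar>L\<bar> + 1)"
  have t0: "0 < t0" using \<epsilon> \<delta> \<delta>' A0 by (simp add: t0_def)
  have ws_eq: "t *\<^sub>R ws = (\<lambda>x. t * cos x, ray_profile t)" for t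
    unfolding ws_def by (rule ray_eq)
  have at: "t \<in> {-\<epsilon><..<\<epsilon>} \<and> \<bar>t\<bar> < \<delta> \<and> \<bar>t\<bar> < \<delta>' \<and> \<bar>t\<bar> < 1 / (8 * A0)" if "\<bar>t\<bar> < t0" for t
    using that by (auto simp: t0_def abs_less_iff)
  have wX: "w t \<in> X 1 \<beta>" if "\<bar>t\<bar> < t0" for t using w(1)[of t] at[OF that] by (auto simp: \<O>_def)
  have dist: "X_norm \<beta> (w t - t *\<^sub>R ws) \<le> A0 * t\<^sup>2" if "\<bar>t\<bar> < t0" for t
  proof -
    have "X_norm \<beta> (w t - t *\<^sub>R ws) \<le> K * t\<^sup>2" using K at[OF that] by blast
    also have "\<dots> \<le> A0 * t\<^sup>2" using A0 by (intro mult_right_mono) auto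
    finally show ?thesis .
  qed
  have A0t: "A0 * t\<^sup>2 \<le> 1 / 8 * \<bar>t\<bar>" "\<bar>t\<bar> \<le> 1 / 8" if "\<bar>t\<bar> < t0" for t
  proof -
    have "A0 * \<bar>t\<bar> < 1 / 8" using at[OF that] A0 by (simp add: field_simps)
    then have "A0 * \<bar>t\<bar> * \<bar>t\<bar> \<le> 1 / 8 * \<bar>t\<bar>" by (intro mult_right_mono) auto
    then show "A0 * t\<^sup>2 \<le> 1 / 8 * \<bar>t\<bar>" by (simp add: power2_eq_square mult.assoc)
    have "1 * \<bar>t\<bar> \<le> A0 * \<bar>t\<bar>" using A0 by (intro mult_right_mono) auto
    with \<open>A0 * \<bar>t\<bar> < 1 / 8\<close> show "\<bar>t\<bar> \<le> 1 / 8" by simp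
  qed
  have line: "fst (w t) \<in> holder_line (Suc (Suc 0)) \<beta>" "snd (w t) \<in> holder_strip (Suc (Suc 0)) \<beta>"
    "fst (w t) (x + 2 * pi) = fst (w t) x" if "\<bar>t\<bar> < t0" for t x
    using wX[OF that] by (auto simp: X_def C_line_def C_strip_def numeral_2_eq_2 mem_Times_iff)
  have der: "(fst (w t) has_real_derivative deriv (fst (w t)) x) (at x)"
    "(deriv (fst (w t)) has_real_derivative deriv (deriv (fst (w t))) x) (at x)" if "\<bar>t\<bar> < t0" for t x
    using line(1)[OF that] by (auto simp: DERIV_deriv_iff_real_differentiable)
  have diffX: "w t - t *\<^sub>R ws \<in> X 1 \<beta>" if "\<bar>t\<bar> < t0" for t
    by (intro X_diff wX[OF that] X_scale(1) ws)
  have close: "\<bar>fst (w t) x - t * cos x\<bar> \<le> A0 * t\<^sup>2" if "\<bar>t\<bar> < t0" for t x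
    using order_trans[OF X_norm_ge(1)[OF diffX[OF that], of x] dist[OF that]]
    by (simp add: ws_eq fst_diff fun_diff_def)
  have close': "\<bar>deriv (fst (w t)) x + t * sin x\<bar> \<le> A0 * t\<^sup>2" if "\<bar>t\<bar> < t0" for t x
  proof -
    have "((\<lambda>x. fst (w t) x - t * cos x) has_real_derivative deriv (fst (w t)) x + t * sin x) (at x)"
      by (rule DERIV_cong[OF DERIV_diff[OF der(1)[OF that] DERIV_cmult[OF DERIV_cos]]]) simp
    then have "deriv (fst (w t - t *\<^sub>R ws)) x = deriv (fst (w t)) x + t * sin x"
      by (intro DERIV_imp_deriv) (simp add: ws_eq fun_diff_def)
    then show ?thesis using order_trans[OF X_norm_ge(2)[OF diffX[OF that], of x] dist[OF that]] by simp
  qed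
  have close_ds: "\<bar>ds (snd (w t)) (x, 1)\<bar> \<le> A0 * t\<^sup>2" if "\<bar>t\<bar> < t0" for t x
  proof -
    have "ray_profile t \<in> holder_strip (Suc (Suc 0)) \<beta>"
      using X_scale(1)[OF ws, of t] unfolding ws_eq by (auto simp: X_def C_strip_def numeral_2_eq_2)
    from DERIV_diff[OF holder_strip_has_ds[OF line(2)[OF that], of 1 x] holder_strip_has_ds[OF this, of 1 x]]
    have "((\<lambda>r. snd (w t) (x, r) - ray_profile t (x, r)) has_real_derivative ds (snd (w t)) (x, 1))
        (at 1 within {0..1})"
      by (simp add: ds_ray_profile profile_s_def)
    then have "ds (snd (w t - t *\<^sub>R ws)) (x, 1) = ds (snd (w t)) (x, 1)"
      by (intro ds_eqI) (auto simp: ws_eq fun_diff_def)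
    then show ?thesis using order_trans[OF X_norm_ge(3)[OF diffX[OF that], of 1 x] dist[OF that]] by simp
  qed
  have "small_waves t0 A (\<lambda>t. fst (w t)) (\<lambda>t. deriv (fst (w t))) lam"
  proof
    fix t x :: real assume t: "t \<noteq> 0" "\<bar>t\<bar> < t0"
    show "(fst (w t) has_real_derivative deriv (fst (w t)) x) (at x)" by (rule der(1)[OF t(2)])
    show "continuous_on UNIV (deriv (fst (w t)))"
      using DERIV_continuous_on[of UNIV "deriv (fst (w t))" "deriv (deriv (fst (w t)))"] der(2)[OF t(2)]
      by auto
    show "fst (w t) (2 * pi) = fst (w t) 0" using line(3)[OF t(2), of 0] by simp
    have A: "A0 * t\<^sup>2 \<le> A * t\<^sup>2" by (intro mult_right_mono) (auto simp: A_def)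
    show "\<bar>fst (w t) x - t * cos x\<bar> \<le> A * t\<^sup>2" using close[OF t(2), of x] A by linarith
    show "\<bar>deriv (fst (w t)) x + t * sin x\<bar> \<le> A * t\<^sup>2" using close'[OF t(2), of x] A by linarith
    have n: "\<bar>cos (lam t) / t\<bar> < \<bar>L\<bar> + 1" "\<bar>cos (lam t)\<bar> < 1 / 4" "1 / 2 < sin (lam t)"
      using near t at[OF t(2)] by blast+
    have "\<bar>cos (lam t)\<bar> \<le> (\<bar>L\<bar> + 1) * \<bar>t\<bar>" using n(1) t(1) by (simp add: abs_divide divide_less_eq)
    also have "\<dots> \<le> A * \<bar>t\<bar>" by (intro mult_right_mono) (auto simp: A_def)
    finally show "\<bar>cos (lam t)\<bar> \<le> A * \<bar>t\<bar>" .
    show "0 < sin (lam t)" "\<bar>cos (lam t)\<bar> \<le> 1 / 4" using n by auto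
    have "\<bar>t * cos x\<bar> \<le> \<bar>t\<bar>" using mult_left_mono[OF abs_cos_le_one[of x], of "\<bar>t\<bar>"] by (simp add: abs_mult)
    then show "\<bar>fst (w t) x\<bar> \<le> 1 / 4" using close[OF t(2), of x] A0t[OF t(2)] by linarith
    fix n :: nat and S C T :: "real \<Rightarrow> real"
    assume *: "\<And>z. (S has_real_derivative C z) (at z)"
      "\<And>z. (C has_real_derivative ((real n)\<^sup>2 - 1) * S z) (at z)"
      "\<And>z. (T has_real_derivative S z) (at z)" "\<And>z. C z = 1 + ((real n)\<^sup>2 - 1) * T z"
      "S 0 = 0" "T 0 = 0"
    show "integral {0..2 * pi} (\<lambda>x. cos (real n * x) *
        (S (1 + fst (w t) x) * sqrt ((1 + (deriv (fst (w t)) x)\<^sup>2) * ((sin (lam t))\<^sup>2 - 2 * fst (w t) x))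
          + cos (lam t) * (1 - T (1 + fst (w t) x)) - cos (lam t - 1))) = 0"
    proof (rule surface_identity[OF \<beta>, where \<phi> = "snd (w t)"])
      show "(fst (w t), snd (w t)) \<in> \<O> 1 \<beta>" using w(1) at[OF t(2)] by simp
      show "F (fst (w t), snd (w t)) (1, -1, lam t) = 0" using w(2) at[OF t(2)] by simp
      show "psi0_s (1, -1, lam t) 1 + ds (snd (w t)) (x, 1) < 0" for x
        using close_ds[OF t(2), of x] A0t[OF t(2)] n(3) unfolding psi0_s_eq by simp
    qed (fact *)+
  qed
  with t0 show ?thesis by blast
qed

text \<open>
  The curve \<open>cos \<lambda>\<close> has second derivative \<open>- \<lambda>''(0)\<close> at 0, since \<open>\<lambda>(0) = \<pi> / 2\<close>.  The limits of the moments
  divided by \<open>\<pi>\<close> are \<open>a\<^sub>0(1)\<close> and \<open>a\<^sub>2(1) / 2\<close>.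
\<close>

lemma second_derivative_lam:
  assumes \<beta>: "0 < \<beta>" "\<beta> < 1"
    and curve: "lambda_bifurcation_curve 1 \<beta> 1 (1, -1, pi / 2) \<epsilon> w lam"
  shows "deriv (deriv lam) 0 = 3 / 2 + 3 * (1 + 3 * sin 1 / (2 * (cos 1 - sin 1))) +
   1 / 2 * (1 + sinh (sqrt 3) / (2 * (sqrt 3 * cosh (sqrt 3) - sinh (sqrt 3))))"
proof -
  obtain t0 A where t0: "0 < t0"
    and sw: "small_waves t0 A (\<lambda>t. fst (w t)) (\<lambda>t. deriv (fst (w t))) lam"
    using small_waves_of_curve[OF assms] by blast
  define R where "R = 3 / 2 + 3 * ((cos 1 + sin 1 / 2) / (cos 1 - sin 1))
    + (cosh (sqrt 3) / 2 - hyp 1 / 4) / (cosh (sqrt 3) - hyp 1)"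
  have L: "((\<lambda>t. cos (lam t) / t\<^sup>2) \<longlongrightarrow> - R / 2) (at 0)"
    using small_waves.cos_l_limit[OF sw t0] unfolding R_def .
  have smooth: "smooth_real_on {-\<epsilon><..<\<epsilon>} lam" and lam0: "lam 0 = pi / 2" and \<epsilon>: "0 < \<epsilon>"
    using curve unfolding lambda_bifurcation_curve_def solution_curve_def by auto
  have d: "(lam has_real_derivative deriv lam t) (at t)"
    "(deriv lam has_real_derivative deriv (deriv lam) t) (at t)" if "t \<in> {-\<epsilon><..<\<epsilon>}" for t
  proof -
    have "(deriv ^^ k) lam differentiable (at t)" for k
      using smooth that unfolding smooth_real_on_def by blast
    from this[of 0] this[of 1] show "(lam has_real_derivative deriv lam t) (at t)"
      "(deriv lam has_real_derivative deriv (deriv lam) t) (at t)"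
      by (simp_all add: DERIV_deriv_iff_real_differentiable)
  qed
  have "- deriv (deriv lam) 0 = 2 * (- R / 2)"
  proof (rule second_order_limit[OF _ _ _ L])
    show "cos (lam 0) = 0" by (simp add: lam0)
    show "eventually (\<lambda>t. ((\<lambda>t. cos (lam t)) has_real_derivative - sin (lam t) * deriv lam t) (at t)) (nhds 0)"
      unfolding eventually_nhds
      by (intro exI[of _ "{-\<epsilon><..<\<epsilon>}"]) (use \<epsilon> d in \<open>auto intro!: derivative_eq_intros\<close>)
    have "0 \<in> {-\<epsilon><..<\<epsilon>}" using \<epsilon> by simp
    from d[OF this] show "((\<lambda>t. - sin (lam t) * deriv lam t) has_real_derivative - deriv (deriv lam) 0) (at 0)"
      by (auto intro!: derivative_eq_intros simp: lam0)
  qed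
  then have "deriv (deriv lam) 0 = R" by simp
  also have "R = 3 / 2 + 3 * (1 + 3 * sin 1 / (2 * (cos 1 - sin 1))) +
   1 / 2 * (1 + sinh (sqrt 3) / (2 * (sqrt 3 * cosh (sqrt 3) - sinh (sqrt 3))))"
  proof -
    have 1: "(cos 1 + sin 1 / 2) / (cos 1 - sin 1) = 1 + 3 * sin 1 / (2 * (cos 1 - sin (1::real)))"
      using cos_1_less_sin_1 by (simp add: field_simps)
    define q where "q = cosh (sqrt 3) - hyp 1"
    have q: "sqrt 3 * cosh (sqrt 3) - sinh (sqrt 3) = sqrt 3 * q"
      by (simp add: q_def hyp_def field_simps)
    then have q0: "q \<noteq> 0" using sinh_less_cosh_sqrt_3 by auto
    have "sinh (sqrt 3) / (2 * (sqrt 3 * q)) = hyp 1 / (2 * q)" by (simp add: hyp_def)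
    moreover have "(cosh (sqrt 3) / 2 - hyp 1 / 4) / q = 1 / 2 * (1 + hyp 1 / (2 * q))"
      using q0 by (simp add: field_simps) (simp add: q_def)
    ultimately show ?thesis unfolding R_def 1 q q_def[symmetric] by simp
  qed
  finally show ?thesis .
qed

theorem theorem4p9:
  fixes \<beta> \<epsilon> :: real
    and \<Lambda> :: params
    and B :: "state \<Rightarrow> state \<Rightarrow> state"
    and w :: "real \<Rightarrow> state"
    and lam :: "real \<Rightarrow> real"
  assumes "0 < \<beta>" and "\<beta> < 1"
    and "\<Lambda> = (1, -1, pi / 2)"
    and "second_frechet_derivative_in (X 1 \<beta>) (X_norm \<beta>) (Y 1 \<beta>) (Y_norm \<beta>) (\<lambda>w. F w \<Lambda>) 0 B"
    and "lambda_bifurcation_curve 1 \<beta> 1 \<Lambda> \<epsilon> w lam"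
  shows
    "M 1 \<Lambda> = {1} \<and>
     (\<exists>c0 c2 b0 b2. quadratic_coeffs 1 1 \<Lambda> B c0 c2 b0 b2) \<and>
     (\<forall>c0 c2 b0 b2 a0 a2. quadratic_coeffs 1 1 \<Lambda> B c0 c2 b0 b2 \<longrightarrow>
        (is_a_solution 1 1 \<Lambda> 0 c0 b0 a0 \<longleftrightarrow>
           (\<forall>s\<in>{0..1}. a0 s = s + 1 / 2 * s\<^sup>2 * sin (s - 1) + 3 * sin s / (2 * (cos 1 - sin 1)))) \<and>
        (is_a_solution 1 1 \<Lambda> 2 c2 b2 a2 \<longleftrightarrow>
           (\<forall>s\<in>{0..1}. a2 s = s + 1 / 2 * s\<^sup>2 * sin (s - 1)
              + sinh (sqrt 3 * s) / (2 * (sqrt 3 * cosh (sqrt 3) - sinh (sqrt 3))))) \<and>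
        (is_a_solution 1 1 \<Lambda> 0 c0 b0 a0 \<and> is_a_solution 1 1 \<Lambda> 2 c2 b2 a2 \<longrightarrow>
           deriv (deriv lam) 0 = 3 / 2 + 3 * a0 1 + 1 / 2 * a2 1)) \<and>
     deriv (deriv lam) 0 < 0 \<and>
     (\<forall>\<delta>. 0 < \<delta> \<and> \<delta> \<le> \<epsilon> \<longrightarrow> \<not> (\<exists>k. \<forall>t\<in>{-\<delta><..<\<delta>}. lam t = k)) \<and>
     (\<forall>\<epsilon>' v mu \<delta> \<delta>'. mu_bifurcation_curve 1 \<beta> 1 \<Lambda> \<epsilon>' v mu \<and>
        0 < \<delta> \<and> \<delta> \<le> \<epsilon> \<and> 0 < \<delta>' \<and> \<delta>' \<le> \<epsilon>' \<longrightarrow>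
        (\<lambda>t. (w t, (1 :: real, -1 :: real, lam t))) ` {-\<delta><..<\<delta>} \<noteq>
        (\<lambda>t. (v t, (mu t, -1 :: real, pi / 2))) ` {-\<delta>'<..<\<delta>'})"
proof -
  note \<beta> = assms(1,2) and \<Lambda> = assms(3) and B = assms(4)[unfolded assms(3)]
    and curve = assms(5)[unfolded assms(3)]
  note Q = quadratic_coeffs_iff[OF \<beta> B]
  note lam2 = second_derivative_lam[OF \<beta> curve]
  have neg: "deriv (deriv lam) 0 < 0" unfolding lam2 by (rule second_derivative_negative)
  have nonconst: "\<not> (\<forall>t\<in>{-\<delta><..<\<delta>}. lam t = k)" if "0 < \<delta>" for \<delta> k
  proof
    assume c: "\<forall>t\<in>{-\<delta><..<\<delta>}. lam t = k"
    have z: "deriv lam t = 0" if "t \<in> {-\<delta><..<\<delta>}" for t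
    proof (rule DERIV_imp_deriv)
      show "(lam has_real_derivative 0) (at t)"
        by (rule has_field_derivative_transform_within_open[of "\<lambda>_. k" 0 t "{-\<delta><..<\<delta>}"])
          (use that c in auto)
    qed
    have "(deriv lam has_real_derivative 0) (at 0)"
      by (rule has_field_derivative_transform_within_open[of "\<lambda>_. 0" 0 0 "{-\<delta><..<\<delta>}"])
        (use \<open>0 < \<delta>\<close> z in auto)
    then have "deriv (deriv lam) 0 = 0" by (rule DERIV_imp_deriv)
    then show False using neg by simp
  qed
  have ex: "\<exists>c0 c2 b0 b2. quadratic_coeffs 1 1 (1, -1, pi / 2) B c0 c2 b0 b2"
    unfolding Q by (intro exI conjI ballI) (rule refl)+
  have a0: "is_a_solution 1 1 (1, -1, pi / 2) 0 c0 b0 a0 \<longleftrightarrow>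
           (\<forall>s\<in>{0..1}. a0 s = s + 1 / 2 * s\<^sup>2 * sin (s - 1) + 3 * sin s / (2 * (cos 1 - sin 1)))" (is ?p0)
    and a2: "is_a_solution 1 1 (1, -1, pi / 2) 2 c2 b2 a2 \<longleftrightarrow>
           (\<forall>s\<in>{0..1}. a2 s = s + 1 / 2 * s\<^sup>2 * sin (s - 1)
              + sinh (sqrt 3 * s) / (2 * (sqrt 3 * cosh (sqrt 3) - sinh (sqrt 3))))" (is ?p2)
    if "quadratic_coeffs 1 1 (1, -1, pi / 2) B c0 c2 b0 b2" for c0 c2 b0 b2 a0 a2
  proof -
    have c: "c0 = 2" "c2 = 1"
      and b: "\<And>s. s \<in> {0..1} \<Longrightarrow> b0 s = - s - sin (s - 1) - 2 * s * cos (s - 1)"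
        "\<And>s. s \<in> {0..1} \<Longrightarrow> b2 s = 3 * s + 2 * s\<^sup>2 * sin (s - 1) - sin (s - 1) - 2 * s * cos (s - 1)"
      using that unfolding Q by blast+
    show ?p0
      unfolding c by (rule a0_iff[OF b(1)])
    show ?p2
      unfolding c by (rule a2_iff[OF b(2)])
  qed
  have formula: "deriv (deriv lam) 0 = 3 / 2 + 3 * a0 1 + 1 / 2 * a2 1"
    if q: "quadratic_coeffs 1 1 (1, -1, pi / 2) B c0 c2 b0 b2"
      and "is_a_solution 1 1 (1, -1, pi / 2) 0 c0 b0 a0" "is_a_solution 1 1 (1, -1, pi / 2) 2 c2 b2 a2"
    for c0 c2 b0 b2 a0 a2
  proof -
    have "a0 1 = 1 + 3 * sin 1 / (2 * (cos 1 - sin 1))"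
      "a2 1 = 1 + sinh (sqrt 3) / (2 * (sqrt 3 * cosh (sqrt 3) - sinh (sqrt 3)))"
      using that(2,3) unfolding a0[OF q] a2[OF q] by auto
    then show ?thesis unfolding lam2 by simp
  qed
  have images: False
    if "0 < \<delta>" and e: "(\<lambda>t. (w t, (1 :: real, -1 :: real, lam t))) ` {-\<delta><..<\<delta>} =
        (\<lambda>t. (v t, (mu t, -1 :: real, pi / 2))) ` {-\<delta>'<..<\<delta>'}" for v mu \<delta> \<delta>'
  proof -
    have "lam t = pi / 2" if "t \<in> {-\<delta><..<\<delta>}" for t
    proof -
      have "(w t, (1 :: real, -1 :: real, lam t)) \<in> (\<lambda>t. (v t, (mu t, -1 :: real, pi / 2))) ` {-\<delta>'<..<\<delta>'}"
        using that unfolding e[symmetric] by blast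
      then show ?thesis by auto
    qed
    then show False using nonconst[OF \<open>0 < \<delta>\<close>] by blast
  qed
  show ?thesis
    unfolding \<Lambda>
    by (intro conjI allI impI notI M_crit ex neg)
      ((rule a0, assumption) | (rule a2, assumption) | (elim conjE, rule formula, assumption+)
        | (elim conjE, rule images, assumption, assumption) | (elim conjE exE, erule (1) notE[OF nonconst]))+
qed

end
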